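(* Let $a\in\mathbb{C}$ and, for $\Im(z)>0$, let $$\mathcal{S}_a(z):=\sum_{n=1}^\infty\sigma_a(n)\,e^{2\pi i n z},\qquad E_{a+1}(z):=1+\frac{2}{\zeta(-a)}\mathcal{S}_a(z),\qquad \psi_a(z):=E_{a+1}(z)-\frac{1}{z^{a+1}}E_{a+1}\Big(-\frac1z\Big).$$ Then for $\Im(z)>0$, $\psi_a$ satisfies the three term relation $$\psi_a(z)-\psi_a(z+1)=\frac{1}{(z+1)^{1+a}}\psi_a\Big(\frac{z}{z+1}\Big),$$ and $\psi_a$ extends to an analytic function on $\mathbb{C}':=\mathbb{C}\setminus\mathbb{R}_{\le 0}$ via the representation $$\psi_a(z)=\frac{i}{\pi z}\frac{\zeta(1-a)}{\zeta(-a)}-\frac{i}{z^{1+a}}\cot\frac{\pi a}{2}+i\frac{g_a(z)}{\zeta(-a)},$$ where $$g_a(z):=-2\sum_{1\le n\le M}(-1)^n\frac{B_{2n}}{(2n)!}\zeta(1-2n-a)(2\pi z)^{2n-1}+\frac{1}{\pi i}\int_{(-\frac12-2M)}\zeta(s)\zeta(s-a)\Gamma(s)\frac{\cos\frac{\pi a}{2}}{\sin\frac{\pi(s-a)}{2}}(2\pi z)^{-s}\,ds,$$ and $M$ is any integer with $M\ge -\frac12\min(0,\Re(a))$.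
   Context: $\sigma_a(n)=\sum_{d\mid n}d^a$; $B_{2n}$ denotes the $2n$-th Bernoulli number; $\zeta$ is the Riemann zeta function; powers $z^{w}$ use the principal branch. $\int_{(c)}$ denotes integration over the vertical line $\Re(s)=c$ traversed upward. All equalities are to be interpreted as identities between meromorphic functions of $a$ (values at special $a$ where individual terms have poles are understood as limits).
   Formalization: The finite sum in g_a is taken with +2 in place of the printed -2: the residues at s = 1-2n enter with a plus sign, and with -2 the function g_a would depend on M, so the representation would fail for M at least 1. *)

theory Defs
  imports "HOL-Complex_Analysis.Complex_Analysis"
begin

(* The Riemann zeta function is the analytic continuation of its Dirichlet series to the complex
   plane without 1. At the pole 1 it gets the conventional value 0, which makes the object unique. *)
definition zeta :: "complex \<Rightarrow> complex" where
  "zeta = (THE f. f holomorphic_on (- {1}) \<and>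
                  (\<forall>s. Re s > 1 \<longrightarrow> (\<lambda>n. 1 / of_nat (Suc n) powr s) sums f s) \<and>
                  f 1 = 0)"

(* Exponential generating function X / (exp X - 1). *)
definition bernoulli :: "nat \<Rightarrow> complex" where
  "bernoulli n = fact n * fps_nth (fps_X / (fps_exp 1 - 1)) n"

definition divisor_sigma :: "complex \<Rightarrow> nat \<Rightarrow> complex" where
  "divisor_sigma a n = (\<Sum>d | d dvd n. of_nat d powr a)"

definition div_series :: "complex \<Rightarrow> complex \<Rightarrow> complex" where
  "div_series a z =
     (\<Sum>n. divisor_sigma a (Suc n) * exp (2 * of_real pi * \<i> * of_nat (Suc n) * z))"

(* eisenstein k is the Eisenstein series of weight k, so E_{a+1} is eisenstein (a + 1).
   At k = 0 the zeta factor is at its pole; since zeta 1 = 0 and division by 0 is 0, the value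
   there is 1, which is also the limit in k. *)
definition eisenstein :: "complex \<Rightarrow> complex \<Rightarrow> complex" where
  "eisenstein k z = 1 + 2 / zeta (1 - k) * div_series (k - 1) z"

definition period_fun :: "complex \<Rightarrow> complex \<Rightarrow> complex" where
  "period_fun a z = eisenstein (a + 1) z - 1 / z powr (a + 1) * eisenstein (a + 1) (- (1 / z))"

(* The integrand of \<integral>_{(c)} f(s) ds after substituting s = c + it is i * f (c + it). *)
definition vline_integral :: "real \<Rightarrow> (complex \<Rightarrow> complex) \<Rightarrow> complex" where
  "vline_integral c f = \<i> * (\<integral>t. f (Complex c t) \<partial>lborel)"

definition mellin_kernel :: "complex \<Rightarrow> complex \<Rightarrow> complex \<Rightarrow> complex" where
  "mellin_kernel a z s =
     zeta s * zeta (s - a) * Gamma s * (cos (of_real pi * a / 2) / sin (of_real pi * (s - a) / 2))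
       * (2 * of_real pi * z) powr (- s)"

(* The finite sum is 2 times the sum of the residues of mellin_kernel at s = 1 - 2n for
   1 \<le> n \<le> M, hence enters with sign +; with the sign -, which is found in print, g_fun would depend
   on M, and the representation of the period function below would fail for M \<ge> 1. *)
definition g_fun :: "nat \<Rightarrow> complex \<Rightarrow> complex \<Rightarrow> complex" where
  "g_fun M a z =
     2 * (\<Sum>n=1..M. (-1) ^ n * (bernoulli (2 * n) / fact (2 * n))
            * zeta (1 - 2 * of_nat n - a) * (2 * of_real pi * z) ^ (2 * n - 1))
     + 1 / (of_real pi * \<i>) * vline_integral (- 1/2 - 2 * real M) (mellin_kernel a z)"

definition period_rep :: "nat \<Rightarrow> complex \<Rightarrow> complex \<Rightarrow> complex" where
  "period_rep M a z =
     \<i> / (of_real pi * z) * (zeta (1 - a) / zeta (- a))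
     - \<i> / z powr (1 + a) * cot (of_real pi * a / 2)
     + \<i> * (g_fun M a z / zeta (- a))"

(* The parameters at which period_fun, as a meromorphic function of a, is defined: 1 / zeta (- a)
   has its poles exactly at the zeros of zeta (- a) and is regular at a = -1, where zeta (- a)
   has its pole. *)
definition regular_param :: "complex \<Rightarrow> bool" where
  "regular_param a \<longleftrightarrow> a = -1 \<or> zeta (- a) \<noteq> 0"

end

theory Submission
  imports Defs
begin

text \<open>
  By Mellin inversion of \<^term>\<open>exp (- x)\<close>, the divisor series is the inverse Mellin transform of
  \<open>\<Gamma>(s) \<zeta>(s) \<zeta>(s - b)\<close>. Moving the line of integration to \<open>Re s = - 1/2 - 2 M\<close> picks up the residues at
  \<open>1\<close>, \<open>1 + b\<close> and the nonpositive integers. The reflection \<open>s \<mapsto> 1 + b - s\<close> brings the integral belonging to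
  \<open>- 1 / z\<close> to the same line, and there the functional equation of zeta turns the difference of the two
  integrands into \<open>\<i>\<close> times the kernel of the representation. Each of the two integrands decays only for \<open>z\<close> in
  the upper half plane, but the kernel decays for all \<open>z\<close> with \<open>|arg z| < \<pi>\<close>, which is the continuation.
  Exceptional parameters are limits of generic ones.

  Zeta is continued by splitting the Mellin integral of \<open>1 / (exp x - 1)\<close> at \<open>1\<close> and expanding the part over
  \<open>[0, 1]\<close> into the Bernoulli series; the functional equation comes from the partial fractions of this
  function.
\<close>

text \<open>Two demands fix the line: it avoids the poles of Gamma, hence the half integer, and it
  lies left of \<open>Re a\<close>, so that \<open>1 + a - s\<close> has real part above 1. There
  Gamma and zeta of \<open>1 + a - s\<close> are holomorphic, and every zero of sin (pi (s - a) / 2)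
  meets a trivial zero of zeta (s - a). The obstacle is merging poles. For integral \<open>a\<close>
  the poles of Gamma s, zeta s and zeta (s - a) can coincide, so residues are computed only at
  non-integral parameters, and each ingredient is kept holomorphic or meromorphic in the parameter
  so that limits can be taken afterwards. At a = -2m the summand n = m and the cotangent are both
  singular and leave a logarithm of z, so the limit is not obtained by substitution; its existence
  is inherited from one point of the upper half plane. All convergence questions are settled by
  exponential rates in |Im s|: -pi/2 for Gamma s, pi/2 for cos (pi s / 2), 0 for zeta, |arg w| for
  the powers of w.\<close>

section \<open>Integrals depending on a complex parameter\<close>

text \<open>Dominating the integrand suffices: Cauchy's inequality turns \<open>g\<close> into a
  bound for the derivative, hence for the difference quotients, to which dominated convergence
  applies.\<close>

lemma has_field_derivative_lebesgue_integral:
  fixes f :: "complex \<Rightarrow> 'a \<Rightarrow> complex"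
  assumes r: "r > 0"
    and meas: "\<And>s. s \<in> ball s0 r \<Longrightarrow> f s \<in> borel_measurable M"
    and hol: "\<And>x. x \<in> space M \<Longrightarrow> (\<lambda>s. f s x) holomorphic_on ball s0 r"
    and int: "integrable M g"
    and bound: "\<And>s x. s \<in> ball s0 r \<Longrightarrow> x \<in> space M \<Longrightarrow> norm (f s x) \<le> g x"
  shows "((\<lambda>s. \<integral>x. f s x \<partial>M) has_field_derivative (\<integral>x. deriv (\<lambda>s. f s x) s0 \<partial>M)) (at s0)"
proof -
  \<comment> \<open>A disc of radius q / 2 around a point at distance less than \<open>q\<close>
    stays within 3 r / 4 of \<open>s0\<close>, so Cauchy's inequality can be used on it.\<close>
  define q where "q = r / 2"
  have q: "q > 0" "q < r" using r by (auto simp: q_def)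
  have integrable_f: "integrable M (f s)" if "s \<in> ball s0 r" for s
    using int meas[OF that]
  proof (rule Bochner_Integration.integrable_bound, intro AE_I2)
    show "norm (f s x) \<le> norm (g x)" if "x \<in> space M" for x
      unfolding real_norm_def by (rule order.trans[OF bound[OF \<open>s \<in> ball s0 r\<close> that] abs_ge_self])
  qed
  have deriv_bound: "norm (deriv (\<lambda>s. f s x) s) \<le> g x / (q/2)"
    if "s \<in> ball s0 q" "x \<in> space M" for s x
  proof -
    have sub: "cball s (q/2) \<subseteq> ball s0 r"
    proof
      fix w assume "w \<in> cball s (q/2)"
      hence "dist s0 w < q + q/2" using that(1) dist_triangle[of s0 w s] by auto
      thus "w \<in> ball s0 r" using q r unfolding q_def by (auto simp: field_simps)
    qed
    have "norm ((deriv ^^ 1) (\<lambda>s. f s x) s) \<le> fact 1 * g x / (q/2) ^ 1"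
    proof (rule Cauchy_inequality)
      show "(\<lambda>s. f s x) holomorphic_on ball s (q/2)"
        using sub by (intro holomorphic_on_subset[OF hol[OF that(2)]]) auto
      show "continuous_on (cball s (q/2)) (\<lambda>s. f s x)"
        using sub by (intro holomorphic_on_imp_continuous_on holomorphic_on_subset[OF hol[OF that(2)]]) auto
      show "norm (f y x) \<le> g x" if "norm (s - y) = q/2" for y
        using sub that \<open>x \<in> space M\<close> by (intro bound) (auto simp: dist_norm)
    qed (use q in auto)
    thus ?thesis by simp
  qed
  have "((\<lambda>s. (\<integral>x. (f s x - f s0 x) / (s - s0) \<partial>M)) \<longlongrightarrow> (\<integral>x. deriv (\<lambda>s. f s x) s0 \<partial>M)) (at s0 within ball s0 q)"
    unfolding tendsto_at_iff_sequentially comp_def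
  proof (intro allI impI)
    \<comment> \<open>Dominated convergence concerns sequences, so the limit is tested along
      sequences in the smaller ball.\<close>
    fix X assume X: "\<forall>i. X i \<in> ball s0 q - {s0}" and lim: "X \<longlonglongrightarrow> s0"
    have Xin: "X i \<in> ball s0 r" "X i \<in> ball s0 q" "X i \<noteq> s0" for i using spec[OF X, of i] q by simp_all
    have s0: "s0 \<in> ball s0 r" "s0 \<in> ball s0 q" using r q by simp_all
    have conv: "(\<lambda>i. (f (X i) x - f s0 x) / (X i - s0)) \<longlonglongrightarrow> deriv (\<lambda>s. f s x) s0"
      if "x \<in> space M" for x
    proof -
      have "((\<lambda>s. f s x) has_field_derivative deriv (\<lambda>s. f s x) s0) (at s0)"
        by (rule holomorphic_derivI[OF hol[OF that] open_ball s0(1)])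
      hence "((\<lambda>y. (f y x - f s0 x) / (y - s0)) \<longlongrightarrow> deriv (\<lambda>s. f s x) s0) (at s0)"
        unfolding has_field_derivative_iff .
      thus ?thesis
        by (rule filterlim_compose) (simp add: filterlim_at lim Xin(3))
    qed
    show "(\<lambda>i. (\<integral>x. (f (X i) x - f s0 x) / (X i - s0) \<partial>M)) \<longlonglongrightarrow> (\<integral>x. deriv (\<lambda>s. f s x) s0 \<partial>M)"
    proof (rule integral_dominated_convergence)
      show m: "(\<lambda>x. (f (X i) x - f s0 x) / (X i - s0)) \<in> borel_measurable M" for i
        by (intro borel_measurable_divide borel_measurable_diff meas[OF Xin(1)] meas[OF s0(1)] borel_measurable_const)
      show "(\<lambda>x. deriv (\<lambda>s. f s x) s0) \<in> borel_measurable M"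
        by (rule borel_measurable_LIMSEQ_metric[OF m conv])
      show "integrable M (\<lambda>x. g x / (q/2))" using int by simp
      show "AE x in M. (\<lambda>i. (f (X i) x - f s0 x) / (X i - s0)) \<longlonglongrightarrow> deriv (\<lambda>s. f s x) s0"
        by (intro AE_I2 conv)
      show "AE x in M. norm ((f (X i) x - f s0 x) / (X i - s0)) \<le> g x / (q/2)" for i
      proof (intro AE_I2)
        fix x assume x: "x \<in> space M"
        have "norm (f (X i) x - f s0 x) \<le> g x / (q/2) * norm (X i - s0)"
        proof (rule field_differentiable_bound[where S="ball s0 q" and f="\<lambda>s. f s x" and f'="\<lambda>z. deriv (\<lambda>s. f s x) z"])
          show "((\<lambda>s. f s x) has_field_derivative deriv (\<lambda>s. f s x) z) (at z within ball s0 q)"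
            if "z \<in> ball s0 q" for z
            using that q by (intro has_field_derivative_at_within[OF holomorphic_derivI[OF hol[OF x] open_ball]]) simp
          show "norm (deriv (\<lambda>s. f s x) z) \<le> g x / (q/2)" if "z \<in> ball s0 q" for z
            by (rule deriv_bound[OF that x])
        qed (rule convex_ball Xin s0)+
        thus "norm ((f (X i) x - f s0 x) / (X i - s0)) \<le> g x / (q/2)"
          using Xin(3)[of i] by (simp add: norm_divide pos_divide_le_eq)
      qed
    qed
  qed
  hence "((\<lambda>s. (\<integral>x. (f s x - f s0 x) / (s - s0) \<partial>M)) \<longlongrightarrow> (\<integral>x. deriv (\<lambda>s. f s x) s0 \<partial>M)) (at s0)"
    using q by (subst (asm) at_within_open) auto
  moreover have "\<forall>\<^sub>F s in at s0. (\<integral>x. (f s x - f s0 x) / (s - s0) \<partial>M)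
      = ((\<integral>x. f s x \<partial>M) - (\<integral>x. f s0 x \<partial>M)) / (s - s0)"
    using eventually_at_ball[OF r, of s0 UNIV]
  proof eventually_elim
    case (elim s)
    have "integrable M (f s)" "integrable M (f s0)" using elim r by (auto intro!: integrable_f)
    thus ?case by simp
  qed
  ultimately show ?thesis unfolding has_field_derivative_iff
    by (rule Lim_transform_eventually)
qed

text \<open>Differentiability is local, so the dominating function may change with the point.
  Intersecting with \<open>U\<close> in the hypothesis frees the choice of the radius from the
  boundary of \<open>U\<close>.\<close>

lemma holomorphic_on_lebesgue_integral:
  fixes f :: "complex \<Rightarrow> 'a \<Rightarrow> complex"
  assumes "open U"
    and meas: "\<And>s. s \<in> U \<Longrightarrow> f s \<in> borel_measurable M"
    and hol: "\<And>x. x \<in> space M \<Longrightarrow> (\<lambda>s. f s x) holomorphic_on U"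
    and bound: "\<And>s0. s0 \<in> U \<Longrightarrow> \<exists>r>0. \<exists>g. integrable M g \<and>
        (\<forall>s\<in>ball s0 r \<inter> U. \<forall>x\<in>space M. norm (f s x) \<le> g x)"
  shows "(\<lambda>s. \<integral>x. f s x \<partial>M) holomorphic_on U"
proof -
  have "\<exists>D. ((\<lambda>s. \<integral>x. f s x \<partial>M) has_field_derivative D) (at s0)" if s0: "s0 \<in> U" for s0
  proof -
    obtain r g where r: "r > 0" and g: "integrable M g"
      "\<And>s x. s\<in>ball s0 r \<inter> U \<Longrightarrow> x\<in>space M \<Longrightarrow> norm (f s x) \<le> g x"
      using bound[OF s0] by blast
    obtain e where e: "e > 0" "ball s0 e \<subseteq> U" using \<open>open U\<close> s0 by (meson openE)
    have sub: "ball s0 (min r e) \<subseteq> ball s0 r \<inter> U" using e by auto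
    show ?thesis
    proof (rule exI, rule has_field_derivative_lebesgue_integral[of "min r e" s0 f M g])
      show "(\<lambda>s. f s x) holomorphic_on ball s0 (min r e)" if "x \<in> space M" for x
        using sub by (intro holomorphic_on_subset[OF hol[OF that]]) auto
      show "f s \<in> borel_measurable M" if "s \<in> ball s0 (min r e)" for s
        using sub that by (intro meas) auto
      show "norm (f s x) \<le> g x" if "s \<in> ball s0 (min r e)" "x \<in> space M" for s x
        using sub that by (intro g) auto
    qed (use r e g in auto)
  qed
  thus ?thesis using \<open>open U\<close> by (auto simp: holomorphic_on_open)
qed

section \<open>Integrals over vertical lines\<close>

lemma integrable_exp_minus_abs:
  assumes "(d::real) > 0"
  shows "integrable lborel (\<lambda>t::real. exp (- d * \<bar>t\<bar>))"
proof -
  have "(\<lambda>t::real. exp (- d * t)) absolutely_integrable_on {0..}"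
    using integrable_on_exp_minus_to_infinity[OF assms, of 0] by (intro nonnegative_absolutely_integrable_1) auto
  hence "integrable lborel (\<lambda>t::real. indicator {0..} t *\<^sub>R exp (- d * t))"
    unfolding set_integrable_def by (subst (asm) integrable_completion) auto
  also have "?this \<longleftrightarrow> integrable lborel (\<lambda>t::real. indicator {0..} t *\<^sub>R exp (- d * \<bar>t\<bar>))"
    by (intro Bochner_Integration.integrable_cong) (auto simp: indicator_def)
  finally show ?thesis
    using has_bochner_integral_even_function[of "\<lambda>t::real. exp (- d * \<bar>t\<bar>)"]
    by (auto simp: has_bochner_integral_iff)
qed

text \<open>Growth estimates are available only for large |t|; on the remaining compact interval
  continuity gives a bound, at the price of a larger constant.\<close>

lemma exp_bound_extend:
  fixes g :: "real \<Rightarrow> complex"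
  assumes "continuous_on UNIV g" and "\<And>t. \<bar>t\<bar> \<ge> T \<Longrightarrow> norm (g t) \<le> C * exp (- d * \<bar>t\<bar>)"
  shows "\<exists>C'\<ge>0. \<forall>t. norm (g t) \<le> C' * exp (- d * \<bar>t\<bar>)"
proof -
  define h where "h = (\<lambda>t. norm (g t) * exp (d * \<bar>t\<bar>))"
  have "continuous_on {-\<bar>T\<bar>..\<bar>T\<bar>} h" unfolding h_def
    by (intro continuous_intros continuous_on_subset[OF assms(1)]) simp_all
  then obtain x where x: "\<And>t. t \<in> {-\<bar>T\<bar>..\<bar>T\<bar>} \<Longrightarrow> h t \<le> h x"
    using continuous_attains_sup[of "{-\<bar>T\<bar>..\<bar>T\<bar>}" h]
    by (metis abs_ge_zero atLeastAtMost_iff compact_Icc empty_iff neg_le_0_iff_le)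
  define B where "B = h x"
  have B: "norm (g t) * exp (d * \<bar>t\<bar>) \<le> B" if "t \<in> {-\<bar>T\<bar>..\<bar>T\<bar>}" for t
    using x[OF that] by (simp add: h_def B_def)
  have "norm (g t) \<le> max \<bar>B\<bar> \<bar>C\<bar> * exp (- d * \<bar>t\<bar>)" for t
  proof (cases "\<bar>t\<bar> \<ge> T")
    case True
    have "C * exp (- d * \<bar>t\<bar>) \<le> max \<bar>B\<bar> \<bar>C\<bar> * exp (- d * \<bar>t\<bar>)" by (intro mult_right_mono) auto
    with assms(2)[OF True] show ?thesis by linarith
  next
    case False
    hence "norm (g t) * exp (d * \<bar>t\<bar>) \<le> B" by (intro B) auto
    hence "norm (g t) \<le> B * exp (- d * \<bar>t\<bar>)" by (simp add: exp_minus field_simps)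
    also have "\<dots> \<le> max \<bar>B\<bar> \<bar>C\<bar> * exp (- d * \<bar>t\<bar>)" by (intro mult_right_mono) auto
    finally show ?thesis .
  qed
  thus ?thesis by (intro exI[of _ "max \<bar>B\<bar> \<bar>C\<bar>"]) simp_all
qed

lemma integrable_exp_bounded:
  fixes g :: "real \<Rightarrow> complex"
  assumes "continuous_on UNIV g" "d > 0" and "\<And>t. \<bar>t\<bar> \<ge> T \<Longrightarrow> norm (g t) \<le> C * exp (- d * \<bar>t\<bar>)"
  shows "integrable lborel g"
proof -
  obtain C' where "C' \<ge> 0" and C': "\<And>t. norm (g t) \<le> C' * exp (- d * \<bar>t\<bar>)"
    using exp_bound_extend[of g T C d] assms(1,3) by auto
  have "integrable lborel (\<lambda>t. C' * exp (- d * \<bar>t\<bar>))"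
    by (intro integrable_mult_right integrable_exp_minus_abs[OF assms(2)])
  moreover have "g \<in> borel_measurable lborel"
    using borel_measurable_continuous_onI[OF assms(1)] by simp
  ultimately show ?thesis
  proof (rule Bochner_Integration.integrable_bound, intro AE_I2)
    show "norm (g t) \<le> norm (C' * exp (- d * \<bar>t\<bar>))" for t
      unfolding real_norm_def by (rule order.trans[OF C' abs_ge_self])
  qed
qed

lemma interval_integral_tendsto_lborel:
  fixes g :: "real \<Rightarrow> complex"
  assumes "integrable lborel g" "continuous_on UNIV g"
  shows "(\<lambda>n. integral {- real n..real n} g) \<longlonglongrightarrow> (\<integral>t. g t \<partial>lborel)"
proof -
  have "(\<lambda>n. \<integral>t. indicator {- real n..real n} t *\<^sub>R g t \<partial>lborel) \<longlonglongrightarrow> (\<integral>t. g t \<partial>lborel)"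
  proof (rule integral_dominated_convergence)
    show "integrable lborel (\<lambda>t. norm (g t))" using assms(1) by simp
    show "AE t in lborel. (\<lambda>n. indicator {- real n..real n} t *\<^sub>R g t) \<longlonglongrightarrow> g t"
    proof (intro AE_I2 tendsto_eventually)
      fix t :: real
      have "\<forall>\<^sub>F n in sequentially. real n \<ge> \<bar>t\<bar>"
        using filterlim_real_sequentially unfolding filterlim_at_top by blast
      thus "\<forall>\<^sub>F n in sequentially. indicator {- real n..real n} t *\<^sub>R g t = g t"
        by eventually_elim (auto simp: indicator_def)
    qed
    have m: "g \<in> borel_measurable lborel" using borel_measurable_continuous_onI[OF assms(2)] by simp
    show "g \<in> borel_measurable lborel" by (fact m)
    show "(\<lambda>t. indicator {- real n..real n} t *\<^sub>R g t) \<in> borel_measurable lborel" for n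
      using m by measurable
    show "AE t in lborel. norm (indicator {- real n..real n} t *\<^sub>R g t) \<le> norm (g t)" for n
      by (intro AE_I2) (simp add: indicator_def)
  qed
  moreover have "(\<integral>t. indicator {- real n..real n} t *\<^sub>R g t \<partial>lborel) = integral {- real n..real n} g" for n
  proof -
    have "set_integrable lborel {- real n..real n} g"
      using assms(1) by (intro integrable_mult_indicator[of _ lborel, folded set_integrable_def]) auto
    from set_borel_integral_eq_integral(2)[OF this] show ?thesis
      by (simp add: set_lebesgue_integral_def)
  qed
  ultimately show ?thesis by simp
qed

text \<open>The residue theorem on the rectangle with corners (c', -n) and (c, n): the decay makes
  the horizontal sides vanish as n grows. Since \<open>S\<close> need only contain the closed strip,
  it can be chosen to end before the next pole on the left.\<close>

theorem vline_integral_shift: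
  fixes f :: "complex \<Rightarrow> complex"
  assumes less: "c' < c" and S: "open S" "connected S" and strip: "\<And>s. c' \<le> Re s \<Longrightarrow> Re s \<le> c \<Longrightarrow> s \<in> S"
    and pts: "finite pts" "\<And>p. p \<in> pts \<Longrightarrow> c' < Re p \<and> Re p < c"
    and hol: "f holomorphic_on S - pts" and d: "d > 0"
    and bound: "\<And>s. c' \<le> Re s \<Longrightarrow> Re s \<le> c \<Longrightarrow> \<bar>Im s\<bar> \<ge> T \<Longrightarrow> norm (f s) \<le> C * exp (- d * \<bar>Im s\<bar>)"
  shows "integrable lborel (\<lambda>t. f (Complex c t))" and "integrable lborel (\<lambda>t. f (Complex c' t))"
    and "vline_integral c f = vline_integral c' f + 2 * of_real pi * \<i> * (\<Sum>p\<in>pts. residue f p)"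
proof -
  have cont: "continuous_on UNIV (\<lambda>t. f (Complex x t))" if "x \<in> {c, c'}" for x
  proof (rule continuous_on_compose2[OF holomorphic_on_imp_continuous_on[OF hol]])
    show "continuous_on UNIV (Complex x)" by (auto simp: Complex_eq intro!: continuous_intros)
    show "range (Complex x) \<subseteq> S - pts" using that less strip pts(2) by fastforce
  qed
  show int1: "integrable lborel (\<lambda>t. f (Complex c t))"
    by (rule integrable_exp_bounded[OF cont d, of _ T C]) (use bound[of "Complex c _"] less in auto)
  show int2: "integrable lborel (\<lambda>t. f (Complex c' t))"
    by (rule integrable_exp_bounded[OF cont d, of _ T C]) (use bound[of "Complex c' _"] less in auto)
  define L1 L3 where "L1 = (\<lambda>n. linepath (Complex c' (-real n)) (Complex c (- real n)))"
    and "L3 = (\<lambda>n. linepath (Complex c (real n)) (Complex c' (real n)))"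
  \<comment> \<open>From height \<open>P\<close> on, the rectangle contains every pole in its
    interior and is not degenerate.\<close>
  define P where "P = Max (insert 1 ((\<lambda>p. \<bar>Im p\<bar> + 1) ` pts))"
  have P: "\<bar>Im p\<bar> < P" if "p \<in> pts" for p
  proof -
    have "\<bar>Im p\<bar> + 1 \<le> P" using that pts(1) unfolding P_def by (intro Max_ge) auto
    thus ?thesis by simp
  qed
  have P1: "P \<ge> 1" using pts(1) unfolding P_def by (intro Max_ge) auto
  have contH: "f contour_integrable_on linepath (Complex c1 y) (Complex c2 y)"
    if "c1 \<in> {c'..c}" "c2 \<in> {c'..c}" "\<bar>y\<bar> \<ge> P" for c1 c2 y
  proof (intro contour_integrable_continuous_linepath continuous_on_subset[OF holomorphic_on_imp_continuous_on[OF hol]])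
    show "closed_segment (Complex c1 y) (Complex c2 y) \<subseteq> S - pts"
      using that P strip by (fastforce simp: closed_segment_same_Im closed_segment_eq_real_ivl split: if_splits)
  qed
  have contV: "f contour_integrable_on linepath (Complex x y1) (Complex x y2)" if "x \<in> {c, c'}" for x y1 y2
  proof (intro contour_integrable_continuous_linepath continuous_on_subset[OF holomorphic_on_imp_continuous_on[OF hol]])
    show "closed_segment (Complex x y1) (Complex x y2) \<subseteq> S - pts"
      using that pts(2) strip less by (fastforce simp: closed_segment_same_Re)
  qed
  have key: "contour_integral (L1 n) f + (\<i> * integral {-real n..real n} (\<lambda>t. f (Complex c t)) +
      (contour_integral (L3 n) f - \<i> * integral {-real n..real n} (\<lambda>t. f (Complex c' t))))
      = 2 * of_real pi * \<i> * (\<Sum>p\<in>pts. residue f p)" if n: "real n \<ge> P" for n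
  proof -
    let ?a = "Complex c' (-real n)" and ?b = "Complex c (real n)"
    let ?g = "rectpath ?a ?b"
    have n0: "real n > 0" using n P1 by linarith
    have box: "z \<in> box ?a ?b" if "z \<in> pts" for z
      using that pts(2)[OF that] P[OF that] n by (auto simp: in_box_complex_iff)
    have im: "path_image ?g \<subseteq> S - pts"
    proof -
      have "path_image ?g \<subseteq> cbox ?a ?b"
        using n0 less by (intro path_image_rectpath_subset_cbox) auto
      moreover have "cbox ?a ?b \<subseteq> S" using strip by (auto simp: in_cbox_complex_iff)
      moreover have "path_image ?g \<inter> box ?a ?b = {}"
        using n0 less by (intro path_image_rectpath_inter_box) auto
      ultimately show ?thesis using box by blast
    qed
    have "contour_integral ?g f = 2 * of_real pi * \<i> * (\<Sum>p\<in>pts. winding_number ?g p * residue f p)"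
    proof (subst Residue_theorem[OF S pts(1) hol _ _ im])
      show "\<forall>z. z \<notin> S \<longrightarrow> winding_number ?g z = 0"
        using strip n0 less by (intro allI impI winding_number_rectpath_outside) (auto simp: in_cbox_complex_iff)
    qed auto
    also have "(\<Sum>p\<in>pts. winding_number ?g p * residue f p) = (\<Sum>p\<in>pts. residue f p)"
      by (intro sum.cong refl) (simp add: winding_number_rectpath[OF box])
    also have "contour_integral ?g f = contour_integral (L1 n) f +
        (contour_integral (linepath (Complex c (-real n)) (Complex c (real n))) f +
        (contour_integral (L3 n) f + contour_integral (linepath (Complex c' (real n)) (Complex c' (-real n))) f))"
      unfolding rectpath_def Let_def L1_def L3_def using n less P1
      by (subst contour_integral_join; (intro contour_integrable_joinI contH contV)?; auto intro!: valid_path_join contH contV)+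
    also have "contour_integral (linepath (Complex c' (real n)) (Complex c' (-real n))) f =
        - contour_integral (linepath (Complex c' (-real n)) (Complex c' (real n))) f"
      using contour_integral_reversepath[of "linepath (Complex c' (-real n)) (Complex c' (real n))" f] by simp
    also have "contour_integral (linepath (Complex c (-real n)) (Complex c (real n))) f =
        \<i> * integral {-real n..real n} (\<lambda>t. f (Complex c t))"
      by (rule contour_integral_linepath_same_Re) (use n0 in auto)
    also have "contour_integral (linepath (Complex c' (-real n)) (Complex c' (real n))) f =
        \<i> * integral {-real n..real n} (\<lambda>t. f (Complex c' t))"
      by (rule contour_integral_linepath_same_Re) (use n0 in auto)
    finally show ?thesis by simp
  qed
  have ev: "\<forall>\<^sub>F n in sequentially. real n \<ge> max P \<bar>T\<bar>"
    using filterlim_real_sequentially unfolding filterlim_at_top by blast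
  have lim0: "(\<lambda>n. contour_integral (L n) f) \<longlonglongrightarrow> 0" if "L \<in> {L1, L3}" for L
  proof (rule Lim_null_comparison)
    show "\<forall>\<^sub>F n in sequentially. norm (contour_integral (L n) f) \<le> \<bar>C\<bar> * exp (- d * real n) * (c - c')"
      using ev
    proof eventually_elim
      case (elim n)
      have b: "norm (f z) \<le> \<bar>C\<bar> * exp (- d * real n)" if "c' \<le> Re z" "Re z \<le> c" "\<bar>Im z\<bar> = real n" for z
      proof -
        have "norm (f z) \<le> C * exp (- d * real n)" using bound[OF that(1,2)] that(3) elim by auto
        also have "\<dots> \<le> \<bar>C\<bar> * exp (- d * real n)" by (intro mult_right_mono) auto
        finally show ?thesis .
      qed
      have "norm (contour_integral (linepath (Complex c1 y) (Complex c2 y)) f) \<le> \<bar>C\<bar> * exp (- d * real n) * norm (Complex c2 y - Complex c1 y)"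
        if "c1 \<in> {c'..c}" "c2 \<in> {c'..c}" "\<bar>y\<bar> = real n" for c1 c2 y
        using that elim less by (intro contour_integral_bound_linepath contH b)
          (auto simp: closed_segment_same_Im closed_segment_eq_real_ivl split: if_splits)
      from this[of c' c "-real n"] this[of c c' "real n"] show ?case using that less
        by (auto simp: L1_def L3_def cmod_def)
    qed
    have "(\<lambda>n. exp (- d) ^ n) \<longlonglongrightarrow> 0" using d by (intro LIMSEQ_power_zero) simp
    also have "(\<lambda>n. exp (- d) ^ n) = (\<lambda>n. exp (- d * real n))"
      by (simp add: mult.commute flip: exp_of_nat_mult)
    finally have "(\<lambda>n. exp (- d * real n)) \<longlonglongrightarrow> 0" .
    from tendsto_mult[OF tendsto_mult[OF tendsto_const[of "\<bar>C\<bar>"] this] tendsto_const[of "c - c'"]]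
    show "(\<lambda>n. \<bar>C\<bar> * exp (- d * real n) * (c - c')) \<longlonglongrightarrow> 0" by simp
  qed
  have "(\<lambda>n. contour_integral (L1 n) f + (\<i> * integral {-real n..real n} (\<lambda>t. f (Complex c t)) +
      (contour_integral (L3 n) f - \<i> * integral {-real n..real n} (\<lambda>t. f (Complex c' t)))))
      \<longlonglongrightarrow> 0 + (vline_integral c f + (0 - vline_integral c' f))"
    unfolding vline_integral_def
    by (intro tendsto_intros lim0 interval_integral_tendsto_lborel int1 int2 cont) auto
  moreover have "(\<lambda>n. contour_integral (L1 n) f + (\<i> * integral {-real n..real n} (\<lambda>t. f (Complex c t)) +
      (contour_integral (L3 n) f - \<i> * integral {-real n..real n} (\<lambda>t. f (Complex c' t)))))
      \<longlonglongrightarrow> 2 * of_real pi * \<i> * (\<Sum>p\<in>pts. residue f p)"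
    by (rule tendsto_eventually) (use ev key in \<open>auto elim!: eventually_mono\<close>)
  ultimately have "0 + (vline_integral c f + (0 - vline_integral c' f)) = 2 * of_real pi * \<i> * (\<Sum>p\<in>pts. residue f p)"
    by (rule LIMSEQ_unique)
  thus "vline_integral c f = vline_integral c' f + 2 * of_real pi * \<i> * (\<Sum>p\<in>pts. residue f p)"
    by (simp add: algebra_simps)
qed

section \<open>From gauge to Lebesgue integrals; series of holomorphic functions\<close>

text \<open>For nonnegative functions gauge integrability is absolute. This carries the classical
  improper integrals over to the Lebesgue setting, where sums and integrals may be
  interchanged.\<close>

lemma has_bochner_integral_lborel_nonneg:
  fixes g :: "real \<Rightarrow> real"
  assumes "(g has_integral I) S" "\<And>x. x \<in> S \<Longrightarrow> g x \<ge> 0"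
    "(\<lambda>x. indicator S x * g x) \<in> borel_measurable borel"
  shows "has_bochner_integral lborel (\<lambda>x. indicator S x * g x) I"
proof -
  have eq: "(\<lambda>x. if x \<in> S then g x else 0) = (\<lambda>x. indicator S x * g x)"
    by (auto simp: indicator_def)
  have 1: "((\<lambda>x. indicator S x * g x) has_integral I) UNIV"
    using assms(1) by (subst (asm) has_integral_restrict_UNIV[symmetric]) (simp add: eq)
  have "(\<lambda>x. indicator S x * g x) absolutely_integrable_on UNIV"
    using assms(2) 1 by (intro nonnegative_absolutely_integrable_1) (auto simp: indicator_def)
  hence 2: "integrable lborel (\<lambda>x. indicator S x * g x)"
    using assms(3) by (simp add: set_integrable_def integrable_completion)
  from has_integral_unique[OF has_integral_integral_lborel[OF this] 1] 2 show ?thesis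
    by (simp add: has_bochner_integral_iff)
qed

lemma continuous_on_compact_norm_bound:
  fixes f :: "'a::topological_space \<Rightarrow> 'b::real_normed_vector"
  assumes "compact S" "continuous_on S f"
  shows "\<exists>B\<ge>0. \<forall>x\<in>S. norm (f x) \<le> B"
proof -
  have "bounded (f ` S)" by (intro compact_imp_bounded compact_continuous_image assms)
  then obtain B where "\<And>x. x \<in> S \<Longrightarrow> norm (f x) \<le> B" unfolding bounded_iff by auto
  thus ?thesis by (intro exI[of _ "max B 0"]) (auto simp: max.coboundedI1)
qed

text \<open>A series is an integral over the counting measure, so the theorem on parameter integrals
  applies to its tail; the finitely many terms below \<open>K\<close>, which the bound does not
  cover, are added separately.\<close>

lemma holomorphic_on_suminf:
  fixes f :: "nat \<Rightarrow> complex \<Rightarrow> complex"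
  assumes "open U" and hol: "\<And>k. f k holomorphic_on U"
    and bound: "\<And>s0. s0 \<in> U \<Longrightarrow> \<exists>r>0. \<exists>M K. summable M \<and>
        (\<forall>k\<ge>K. \<forall>s\<in>ball s0 r \<inter> U. norm (f k s) \<le> M k)"
  shows "(\<lambda>s. \<Sum>k. f k s) holomorphic_on U" and "\<And>s. s \<in> U \<Longrightarrow> summable (\<lambda>k. f k s)"
proof -
  show summ: "summable (\<lambda>k. f k s)" if s: "s \<in> U" for s
  proof -
    have "\<exists>M K. summable M \<and> (\<forall>k\<ge>K. norm (f k s) \<le> M k)"
      using bound[OF s] s by (meson IntI centre_in_ball)
    then obtain M K where M: "summable M" "\<forall>k\<ge>K. norm (f k s) \<le> M k" by auto
    thus ?thesis by (intro summable_comparison_test[of "\<lambda>k. f k s" M]) auto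
  qed
  have "\<exists>r>0. (\<lambda>s. \<Sum>k. f k s) holomorphic_on ball s0 r" if s0: "s0 \<in> U" for s0
  proof -
    obtain r M K where r: "r > 0" and M: "summable M"
      "\<And>k s. k \<ge> K \<Longrightarrow> s\<in>ball s0 r \<Longrightarrow> s \<in> U \<Longrightarrow> norm (f k s) \<le> M k"
      using bound[OF s0] by blast
    obtain e where e: "e > 0" "ball s0 e \<subseteq> U" using \<open>open U\<close> s0 by (meson openE)
    define q where "q = min r e"
    have q: "q > 0" using r e by (simp add: q_def)
    have sub: "s \<in> ball s0 r" "s \<in> U" if "s \<in> ball s0 q" for s using that e by (auto simp: q_def)
    have "(\<lambda>s. \<integral>k. f (k + K) s \<partial>count_space UNIV) holomorphic_on ball s0 q"
    proof (rule holomorphic_on_lebesgue_integral)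
      show "(\<lambda>s. f (k + K) s) holomorphic_on ball s0 q" for k
        using sub by (intro holomorphic_on_subset[OF hol]) auto
      show "\<exists>r>0. \<exists>g. integrable (count_space UNIV) g \<and>
          (\<forall>s\<in>ball s1 r \<inter> ball s0 q. \<forall>k\<in>space (count_space UNIV). norm (f (k + K) s) \<le> g k)" for s1
      proof (intro exI[of _ 1] conjI exI[of _ "\<lambda>k. M (k + K)"])
        have "M k \<ge> 0" if "k \<ge> K" for k
          using order.trans[OF norm_ge_zero M(2)[OF that, of s0]] r s0 by simp
        hence "norm (M (k + K)) = M (k + K)" for k by simp
        thus "integrable (count_space UNIV) (\<lambda>k. M (k + K))"
          using summable_ignore_initial_segment[OF M(1), of K] by (simp add: integrable_count_space_nat_iff)
        show "\<forall>s\<in>ball s1 1 \<inter> ball s0 q. \<forall>k\<in>space (count_space UNIV). norm (f (k + K) s) \<le> M (k + K)"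
          by (intro ballI M(2) sub) simp_all
      qed simp
    qed auto
    moreover have "(\<integral>k. f (k + K) s \<partial>count_space UNIV) = (\<Sum>k. f (k + K) s)" if "s \<in> ball s0 q" for s
    proof (rule integral_count_space_nat)
      have "norm (f (k + K) s) \<le> M (k + K)" for k using that sub by (intro M(2)) auto
      hence "summable (\<lambda>k. norm (f (k + K) s))"
        by (intro summable_comparison_test[OF _ summable_ignore_initial_segment[OF M(1), of K]]) simp
      thus "integrable (count_space UNIV) (\<lambda>k. f (k + K) s)"
        by (simp add: integrable_count_space_nat_iff)
    qed
    ultimately have "(\<lambda>s. \<Sum>k. f (k + K) s) holomorphic_on ball s0 q"
      by (rule holomorphic_transform)
    hence "(\<lambda>s. (\<Sum>k. f (k + K) s) + (\<Sum>k<K. f k s)) holomorphic_on ball s0 q"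
      using sub by (intro holomorphic_intros holomorphic_on_subset[OF hol]) auto
    also have "?this \<longleftrightarrow> (\<lambda>s. \<Sum>k. f k s) holomorphic_on ball s0 q"
      by (intro holomorphic_cong refl suminf_split_initial_segment[symmetric] summ sub)
    finally show ?thesis using q by blast
  qed
  hence "(\<lambda>s. \<Sum>k. f k s) analytic_on U" by (auto simp: analytic_on_def)
  thus "(\<lambda>s. \<Sum>k. f k s) holomorphic_on U" by (rule analytic_imp_holomorphic)
qed

section \<open>The Bernoulli series\<close>

text \<open>The Bernoulli number divided by the factorial: unlike the Bernoulli numbers themselves,
  these coefficients are absolutely summable.\<close>

definition bern_coeff :: "nat \<Rightarrow> complex" where
  "bern_coeff n = fps_nth (fps_X / (fps_exp 1 - 1)) n"

lemma bernoulli_conv_coeff: "bernoulli n / fact n = bern_coeff n"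
  by (simp add: bernoulli_def bern_coeff_def)

text \<open>The zeros of exp z - 1 are the integral multiples of 2 pi i. This is the origin of the
  radius 2 pi of the Bernoulli series, which therefore converges absolutely on all of
  [0, 1].\<close>

lemma exp_minus_one_nonzero:
  fixes z :: complex
  assumes "norm z < 2 * pi" "z \<noteq> 0"
  shows "exp z \<noteq> 1"
proof
  assume "exp z = 1"
  then obtain n :: int where n: "Re z = 0" "Im z = of_int (2 * n) * pi" by (auto simp: exp_eq_1)
  hence "n \<noteq> 0" using assms(2) by (auto simp: complex_eq_iff)
  hence "2 * pi \<le> 2 * \<bar>of_int n\<bar> * pi" by (intro mult_right_mono) auto
  also have "\<dots> = norm z" using n by (simp add: cmod_def abs_mult)
  finally show False using assms by simp
qed

lemma fps_exp_minus_one: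
  shows "fps_conv_radius (fps_exp 1 - 1 :: complex fps) = \<infinity>"
    and "eval_fps (fps_exp 1 - 1) z = exp z - (1 :: complex)"
    and "subdegree (fps_exp 1 - 1 :: complex fps) = 1"
proof -
  show "fps_conv_radius (fps_exp 1 - 1 :: complex fps) = \<infinity>"
    using fps_conv_radius_diff[of "fps_exp 1 :: complex fps" 1] by simp
  show "eval_fps (fps_exp 1 - 1) z = exp z - (1 :: complex)"
    by (subst eval_fps_diff) simp_all
  show "subdegree (fps_exp 1 - 1 :: complex fps) = 1"
    by (rule subdegreeI) simp_all
qed

lemma bern_conv_radius: "fps_conv_radius (fps_X / (fps_exp 1 - 1) :: complex fps) \<ge> ereal (2 * pi)"
proof -
  have "fps_conv_radius (fps_X / (fps_exp 1 - 1) :: complex fps) \<ge>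
     Min {ereal (2 * pi), fps_conv_radius (fps_X :: complex fps), fps_conv_radius (fps_exp 1 - 1 :: complex fps)}"
    by (rule fps_conv_radius_divide) (simp_all add: fps_exp_minus_one exp_minus_one_nonzero del: subdegree_minus_commute)
  thus ?thesis by (simp add: fps_exp_minus_one)
qed

lemma bern_coeff_sums:
  assumes "norm z < 2 * pi" "z \<noteq> 0"
  shows "(\<lambda>k. bern_coeff k * z ^ k) sums (z / (exp z - 1))"
proof -
  have "ereal (norm z) < fps_conv_radius (fps_X / (fps_exp 1 - 1) :: complex fps)"
    using assms by (intro less_le_trans[OF _ bern_conv_radius]) simp
  from summable_sums[OF summable_fps[OF this]]
  have "(\<lambda>k. bern_coeff k * z ^ k) sums eval_fps (fps_X / (fps_exp 1 - 1)) z"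
    by (simp add: bern_coeff_def eval_fps_def)
  also have "eval_fps (fps_X / (fps_exp 1 - 1)) z = z / (exp z - 1)"
    by (subst eval_fps_divide[where r = "ereal (2 * pi)"])
       (use assms in \<open>simp_all add: fps_exp_minus_one exp_minus_one_nonzero del: subdegree_minus_commute\<close>)
  finally show ?thesis .
qed

lemma summable_bern_coeff: "summable (\<lambda>k. norm (bern_coeff k))"
proof -
  have "ereal (norm (1::complex)) < fps_conv_radius (fps_X / (fps_exp 1 - 1) :: complex fps)"
    using bern_conv_radius pi_gt3 by (intro less_le_trans[OF _ bern_conv_radius]) auto
  from norm_summable_fps[OF this] show ?thesis by (simp add: bern_coeff_def)
qed

lemma bern_coeff_0 [simp]: "bern_coeff 0 = 1"
proof -
  have "eval_fps (fps_X / (fps_exp 1 - 1)) (0::complex) = 1"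
    by (subst eval_fps_divide[where r = "ereal (2 * pi)" and c = 1])
       (simp_all add: fps_exp_minus_one exp_minus_one_nonzero zero_ereal_def del: subdegree_minus_commute)
  thus ?thesis by (simp add: bern_coeff_def eval_fps_at_0)
qed

lemma bern_coeff_1 [simp]: "bern_coeff (Suc 0) = - 1 / 2"
proof -
  have "(fps_X / (fps_exp 1 - 1)) * (fps_exp 1 - 1) = (fps_X :: complex fps)"
  proof (rule dvd_div_mult_self)
    have "fps_exp 1 - 1 \<noteq> (0 :: complex fps)" using fps_exp_minus_one(3) by force
    thus "fps_exp 1 - 1 dvd (fps_X :: complex fps)"
      by (subst fps_dvd_iff) (simp_all only: fps_exp_minus_one subdegree_fps_X fps_X_neq_zero, simp_all)
  qed
  \<comment> \<open>Coefficient 2 rather than 1, because the factor exp X - 1 itself starts with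
    X.\<close>
  hence "fps_nth ((fps_X / (fps_exp 1 - 1)) * (fps_exp 1 - 1)) 2 = fps_nth (fps_X :: complex fps) 2"
    by simp
  hence "bern_coeff 0 / 2 + bern_coeff (Suc 0) = 0"
    by (simp add: fps_mult_nth numeral_2_eq_2 flip: bern_coeff_def)
  hence "bern_coeff (Suc 0) = - (bern_coeff 0 / 2)" by (simp only: add_eq_0_iff)
  thus ?thesis by simp
qed

subsection \<open>The tail of the Mellin integral\<close>

text \<open>For x >= 1 the denominator is at least half of exp x, so twice the integrand of a Gamma
  integral dominates.\<close>

lemma integrable_powr_over_exp:
  "integrable lborel (\<lambda>x::real. indicator {1..} x * (x powr b / (exp x - 1)))"
proof -
  \<comment> \<open>Raising a negative exponent to 0 keeps the Gamma integral convergent and only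
    increases the power on [1, oo).\<close>
  define c where "c = max b 0 + 1"
  have c: "c > 0" "b \<le> c - 1" unfolding c_def by linarith+
  have "has_bochner_integral lborel (\<lambda>t. indicator {0..} t * (t powr (c - 1) / exp t)) (Gamma c)"
    using Gamma_integral_real[OF c(1)] by (intro has_bochner_integral_lborel_nonneg) auto
  hence int: "integrable lborel (\<lambda>t. 2 * (indicator {0..} t * (t powr (c - 1) / exp t)))"
    by (intro integrable_mult_right) (simp add: has_bochner_integral_iff)
  have "norm (indicator {1..} x * (x powr b / (exp x - 1))) \<le> norm (2 * (indicator {0..} x * (x powr (c - 1) / exp x)))" for x
  proof -
    show "norm (indicator {1..} x * (x powr b / (exp x - 1))) \<le> norm (2 * (indicator {0..} x * (x powr (c - 1) / exp x)))"
    proof (cases "x \<ge> 1")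
      case True
      have "exp x \<ge> 2" using exp_ge_add_one_self[of x] True by linarith
      have "x powr b / (exp x - 1) \<le> x powr (c - 1) / (exp x / 2)"
        using True c \<open>exp x \<ge> 2\<close> by (intro frac_le powr_mono) auto
      moreover have "x powr b / (exp x - 1) \<ge> 0"
        using \<open>exp x \<ge> 2\<close> True by (intro divide_nonneg_nonneg) simp_all
      ultimately show ?thesis using True by (simp add: abs_mult mult.commute)
    qed simp
  qed
  hence ae: "AE x in lborel. norm (indicator {1..} x * (x powr b / (exp x - 1))) \<le> norm (2 * (indicator {0..} x * (x powr (c - 1) / exp x)))"
    by (intro AE_I2)
  have "(\<lambda>x::real. indicator {1..} x * (x powr b / (exp x - 1)) :: real) \<in> borel_measurable lborel"
    by measurable
  thus ?thesis by (rule Bochner_Integration.integrable_bound[OF int _ ae])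
qed

definition mellin_tail :: "complex \<Rightarrow> complex" where
  "mellin_tail s = (\<integral>x. indicator {1..} x *\<^sub>R (of_real x powr (s - 1) / of_real (exp x - 1)) \<partial>lborel)"

lemma norm_mellin_tail_integrand:
  "norm (indicator {1..} x *\<^sub>R (of_real x powr (s - 1) / of_real (exp x - 1) :: complex))
    = indicator {1..} x * (x powr (Re s - 1) / (exp x - 1))"
proof (cases "x \<ge> 1")
  case True
  hence "norm (of_real x powr (s - 1)) = x powr (Re s - 1)" by (simp add: norm_powr_real_powr)
  thus ?thesis using True by (simp add: norm_divide del: of_real_diff)
qed (auto simp: indicator_def)

lemma mellin_tail_integrable:
  "integrable lborel (\<lambda>x. indicator {1..} x *\<^sub>R (of_real x powr (s - 1) / of_real (exp x - 1) :: complex))"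
proof (rule Bochner_Integration.integrable_bound[OF integrable_powr_over_exp[of "Re s - 1"]])
  show "(\<lambda>x. indicator {1..} x *\<^sub>R (of_real x powr (s - 1) / of_real (exp x - 1) :: complex)) \<in> borel_measurable lborel"
    by measurable
  show "AE x in lborel. norm (indicator {1..} x *\<^sub>R (of_real x powr (s - 1) / of_real (exp x - 1) :: complex))
      \<le> norm (indicator {1..} x * (x powr (Re s - 1) / (exp x - 1)))"
    unfolding norm_mellin_tail_integrand real_norm_def by (intro AE_I2 abs_ge_self)
qed

lemma mellin_tail_holomorphic [holomorphic_intros]:
  assumes "f holomorphic_on A"
  shows "(\<lambda>s. mellin_tail (f s)) holomorphic_on A"
proof -
  have "mellin_tail holomorphic_on UNIV"
    unfolding mellin_tail_def
  proof (rule holomorphic_on_lebesgue_integral)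
    show "(\<lambda>x. indicator {1..} x *\<^sub>R (of_real x powr (s - 1) / of_real (exp x - 1) :: complex)) \<in> borel_measurable lborel" for s
      using mellin_tail_integrable[of s] by (rule borel_measurable_integrable)
    show "(\<lambda>s. indicator {1..} x *\<^sub>R (of_real x powr (s - 1) / of_real (exp x - 1) :: complex)) holomorphic_on UNIV" for x :: real
      by (cases "x \<ge> 1") (auto intro!: holomorphic_intros)
    fix s0 :: complex
    show "\<exists>r>0. \<exists>g. integrable lborel g \<and> (\<forall>s\<in>ball s0 r \<inter> UNIV. \<forall>x\<in>space lborel.
        norm (indicator {1..} x *\<^sub>R (of_real x powr (s - 1) / of_real (exp x - 1) :: complex)) \<le> g x)"
    proof (intro exI[of _ 1] conjI exI[of _ "\<lambda>x. indicator {1..} x * (x powr (Re s0) / (exp x - 1))"] ballI)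
      fix s :: complex and x :: real assume "s \<in> ball s0 1 \<inter> UNIV"
      hence "\<bar>Re s - Re s0\<bar> < 1" using abs_Re_le_cmod[of "s - s0"] by (auto simp: dist_norm norm_minus_commute)
      hence "Re s - 1 \<le> Re s0" by linarith
      thus "norm (indicator {1..} x *\<^sub>R (of_real x powr (s - 1) / of_real (exp x - 1) :: complex))
        \<le> indicator {1..} x * (x powr (Re s0) / (exp x - 1))"
        unfolding norm_mellin_tail_integrand
        by (auto simp: indicator_def intro!: divide_right_mono powr_mono)
    qed (simp_all only: integrable_powr_over_exp zero_less_one)
  qed auto
  from holomorphic_on_compose[OF assms holomorphic_on_subset[OF this]]  show ?thesis
    by (simp add: o_def)
qed

subsection \<open>Analytic continuation\<close>

text \<open>The Mellin integral yields Gamma s zeta s as the tail plus 1 / (s - 1) plus the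
  fractions \<open>bern_coeff (Suc k) / (s + k)\<close>. After multiplication by 1 / Gamma the
  quotient \<open>rGamma s / (s + k)\<close> is written with \<open>pochhammer\<close>, which
  displays its cancelled pole: every summand is entire.\<close>

definition zeta_reg :: "complex \<Rightarrow> complex" where
  "zeta_reg s = rGamma s * mellin_tail s + (\<Sum>k. bern_coeff (Suc k) * (pochhammer s k * rGamma (s + of_nat (Suc k))))"

lemma pochhammer_rGamma_eq: "(s + of_nat k) * (pochhammer s k * rGamma (s + of_nat (Suc k))) = rGamma s"
  using pochhammer_rGamma[of s "Suc k"] by (simp add: pochhammer_Suc mult_ac)

text \<open>Once k exceeds |s0| + 2, every s in the unit ball satisfies |s + k| >= 1, so
  \<open>pochhammer_rGamma_eq\<close> bounds the second factor by |rGamma s|, and the coefficients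
  are summable.\<close>

lemma zeta_reg_series:
  shows "(\<lambda>s. \<Sum>k. bern_coeff (Suc k) * (pochhammer s k * rGamma (s + of_nat (Suc k)))) holomorphic_on UNIV"
    and "summable (\<lambda>k. bern_coeff (Suc k) * (pochhammer s k * rGamma (s + of_nat (Suc k))))"
proof -
  note * = holomorphic_on_suminf[of UNIV "\<lambda>k s. bern_coeff (Suc k) * (pochhammer s k * rGamma (s + of_nat (Suc k)))"]
  have hol: "(\<lambda>s. bern_coeff (Suc k) * (pochhammer s k * rGamma (s + of_nat (Suc k)))) holomorphic_on UNIV" for k
    by (auto simp: pochhammer_prod intro!: holomorphic_intros)
  have bnd: "\<exists>r>0. \<exists>M K. summable M \<and> (\<forall>k\<ge>K. \<forall>s\<in>ball s0 r \<inter> UNIV.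
      norm (bern_coeff (Suc k) * (pochhammer s k * rGamma (s + of_nat (Suc k)))) \<le> M k)" for s0
  proof -
    obtain B where B: "B \<ge> 0" "\<And>s. s \<in> cball s0 1 \<Longrightarrow> norm (rGamma s) \<le> B"
      using continuous_on_compact_norm_bound[OF compact_cball holomorphic_on_imp_continuous_on[OF holomorphic_rGamma]]
      by blast
    have "norm (bern_coeff (Suc k) * (pochhammer s k * rGamma (s + of_nat (Suc k)))) \<le> norm (bern_coeff (Suc k)) * B"
      if k: "k \<ge> nat \<lceil>norm s0\<rceil> + 2" and s: "s \<in> ball s0 1 \<inter> UNIV" for k s
    proof -
      have "norm s \<le> norm s0 + 1" using s norm_triangle_ineq2[of s s0] by (auto simp: dist_norm norm_minus_commute)
      moreover have "real k \<ge> norm s0 + 2" using k by linarith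
      moreover have "real k - norm s \<le> norm (s + of_nat k)"
        using norm_triangle_ineq2[of "of_nat k" "- s"] by (simp add: add.commute)
      ultimately have "norm (s + of_nat k) \<ge> 1" by linarith
      hence "1 * norm (pochhammer s k * rGamma (s + of_nat (Suc k)))
          \<le> norm (s + of_nat k) * norm (pochhammer s k * rGamma (s + of_nat (Suc k)))"
        by (intro mult_right_mono) auto
      also have "\<dots> = norm (rGamma s)" by (simp only: norm_mult[symmetric] pochhammer_rGamma_eq)
      also have "\<dots> \<le> B" using s by (intro B) auto
      finally have "norm (pochhammer s k * rGamma (s + of_nat (Suc k))) \<le> B" by simp
      thus ?thesis unfolding norm_mult[of "bern_coeff (Suc k)"] by (intro mult_left_mono) auto
    qed
    moreover have "summable (\<lambda>k. norm (bern_coeff (Suc k)) * B)"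
      using summable_bern_coeff summable_Suc_iff[of "\<lambda>k. norm (bern_coeff k)"] by (intro summable_mult2) simp
    ultimately show ?thesis
      by (intro exI[of _ 1] conjI exI[of _ "\<lambda>k. norm (bern_coeff (Suc k)) * B"] exI[of _ "nat \<lceil>norm s0\<rceil> + 2"] allI impI ballI) simp_all
  qed
  show "(\<lambda>s. \<Sum>k. bern_coeff (Suc k) * (pochhammer s k * rGamma (s + of_nat (Suc k)))) holomorphic_on UNIV"
    by (rule *(1)[OF open_UNIV hol bnd])
  show "summable (\<lambda>k. bern_coeff (Suc k) * (pochhammer s k * rGamma (s + of_nat (Suc k))))"
    by (rule *(2)[OF open_UNIV hol bnd]) auto
qed

lemma zeta_reg_holomorphic: "zeta_reg holomorphic_on A"
  unfolding zeta_reg_def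
  by (rule holomorphic_on_subset[OF _ subset_UNIV]) (intro holomorphic_intros zeta_reg_series)

definition zeta_cont :: "complex \<Rightarrow> complex" where
  "zeta_cont s = (if s = 1 then 0 else rGamma s / (s - 1) + zeta_reg s)"

lemma zeta_cont_holomorphic: "zeta_cont holomorphic_on (- {1})"
proof -
  have "(\<lambda>s. rGamma s / (s - 1) + zeta_reg s) holomorphic_on (- {1})"
    by (intro holomorphic_intros zeta_reg_holomorphic) auto
  thus ?thesis by (rule holomorphic_transform) (auto simp: zeta_cont_def)
qed

text \<open>Undoes the division by Gamma: where Gamma is finite, the entire summands become simple
  fractions again, which is the form the integral over (0, 1] produces.\<close>

lemma Gamma_zeta_cont:
  assumes "s \<noteq> 1" "s \<notin> \<int>\<^sub>\<le>\<^sub>0"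
  shows "Gamma s * zeta_cont s = mellin_tail s + 1 / (s - 1) + (\<Sum>k. bern_coeff (Suc k) / (s + of_nat k))"
    and "summable (\<lambda>k. bern_coeff (Suc k) / (s + of_nat k))"
proof -
  have nz: "Gamma s \<noteq> 0" using assms(2) by (simp add: Gamma_eq_zero_iff)
  have "Gamma s * (bern_coeff (Suc k) * (pochhammer s k * rGamma (s + of_nat (Suc k)))) = bern_coeff (Suc k) / (s + of_nat k)" for k
  proof -
    have "s + of_nat k \<noteq> 0" using assms(2) by (metis add_eq_0_iff2 minus_of_nat_in_nonpos_Ints neg_eq_iff_add_eq_0)
    hence "pochhammer s k * rGamma (s + of_nat (Suc k)) = rGamma s / (s + of_nat k)"
      using pochhammer_rGamma_eq[of s k] by (simp add: field_simps)
    thus ?thesis using nz by (simp add: rGamma_inverse_Gamma)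
  qed
  note eq = this
  show "summable (\<lambda>k. bern_coeff (Suc k) / (s + of_nat k))"
    using summable_mult[OF zeta_reg_series(2)[of s], of "Gamma s"] by (simp only: eq)
  have "Gamma s * zeta_reg s = mellin_tail s + (\<Sum>k. bern_coeff (Suc k) / (s + of_nat k))"
    unfolding zeta_reg_def distrib_left suminf_mult[OF zeta_reg_series(2), symmetric] eq
    using nz by (simp add: rGamma_inverse_Gamma)
  thus "Gamma s * zeta_cont s = mellin_tail s + 1 / (s - 1) + (\<Sum>k. bern_coeff (Suc k) / (s + of_nat k))"
    using assms(1) nz by (simp add: zeta_cont_def distrib_left rGamma_inverse_Gamma)
qed

lemma norm_dirichlet_term: "norm (1 / of_nat (Suc n) powr s :: complex) = real (Suc n) powr (- Re s)"
proof -
  have "norm (of_nat (Suc n) powr s) = real (Suc n) powr Re s"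
    using norm_powr_real_powr[of "of_nat (Suc n)" s] by simp
  thus ?thesis by (simp add: norm_divide powr_minus_divide)
qed

lemma summable_Suc_powr:
  assumes "(x::real) > 1"
  shows "summable (\<lambda>n. real (Suc n) powr (- x))"
  using assms by (subst summable_Suc_iff) (simp add: summable_real_powr_iff)

lemma dirichlet_series:
  shows "(\<lambda>s. \<Sum>n. 1 / of_nat (Suc n) powr s) holomorphic_on {s::complex. Re s > 1}"
    and "\<And>s::complex. Re s > 1 \<Longrightarrow> summable (\<lambda>n. 1 / of_nat (Suc n) powr s)"
proof -
  note * = holomorphic_on_suminf[of "{s::complex. Re s > 1}" "\<lambda>n s. 1 / of_nat (Suc n) powr s"]
  have op: "open {s::complex. Re s > 1}" by (rule open_halfspace_Re_gt)
  have hol: "(\<lambda>s. 1 / of_nat (Suc n) powr s) holomorphic_on {s::complex. Re s > 1}" for n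
    by (intro holomorphic_intros) auto
  have bnd: "\<exists>r>0. \<exists>M K. summable M \<and> (\<forall>k\<ge>K. \<forall>s\<in>ball s0 r \<inter> {s. Re s > 1}. norm (1 / of_nat (Suc k) powr s :: complex) \<le> M k)"
    if s0: "s0 \<in> {s. Re s > 1}" for s0
  proof (rule exI[of _ "(Re s0 - 1) / 2"], rule conjI, use s0 in simp,
      rule exI[of _ "\<lambda>k. real (Suc k) powr (- ((Re s0 + 1) / 2))"], rule exI[of _ 0], rule conjI)
    show "summable (\<lambda>k. real (Suc k) powr - ((Re s0 + 1) / 2))" using s0 by (intro summable_Suc_powr) simp
    show "\<forall>k\<ge>0. \<forall>s\<in>ball s0 ((Re s0 - 1) / 2) \<inter> {s. 1 < Re s}.
        norm (1 / of_nat (Suc k) powr s :: complex) \<le> real (Suc k) powr - ((Re s0 + 1) / 2)"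
    proof (intro allI impI ballI)
      fix k s assume "s \<in> ball s0 ((Re s0 - 1) / 2) \<inter> {s. 1 < Re s}"
      hence "\<bar>Re s0 - Re s\<bar> < (Re s0 - 1) / 2" using abs_Re_le_cmod[of "s0 - s"] by (simp add: dist_norm)
      hence "(Re s0 + 1) / 2 \<le> Re s" by (simp add: field_simps abs_if split: if_splits)
      thus "norm (1 / of_nat (Suc k) powr s :: complex) \<le> real (Suc k) powr - ((Re s0 + 1) / 2)"
        unfolding norm_dirichlet_term by (intro powr_mono) auto
    qed
  qed
  show "(\<lambda>s. \<Sum>n. 1 / of_nat (Suc n) powr s) holomorphic_on {s::complex. Re s > 1}"
    by (rule *(1)[OF op hol bnd])
  show "\<And>s::complex. Re s > 1 \<Longrightarrow> summable (\<lambda>n. 1 / of_nat (Suc n) powr s)"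
    by (rule *(2)[OF op hol bnd]) auto
qed

section \<open>The Mellin integral of 1 / (exp x - 1) at real exponents\<close>

lemma has_bochner_integral_Gamma_scaled:
  assumes "s > (0::real)" "c > 0"
  shows "has_bochner_integral lborel (\<lambda>x. indicator {0..} x * (x powr (s - 1) * exp (- (c * x)))) (Gamma s * c powr (- s))"
proof -
  have "has_bochner_integral lborel (\<lambda>t. indicator {0..} t * (t powr (s - 1) / exp t)) (Gamma s)"
    using Gamma_integral_real[OF assms(1)] by (intro has_bochner_integral_lborel_nonneg) auto
  hence "has_bochner_integral lborel (\<lambda>x. indicator {0..} (c * x) * ((c * x) powr (s - 1) / exp (c * x))) (Gamma s / c)"
    using assms(2) by (subst (asm) lborel_has_bochner_integral_real_affine_iff[of c _ _ 0]) (auto simp: field_simps)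
  hence "has_bochner_integral lborel (\<lambda>x. c powr (1 - s) * (indicator {0..} (c * x) * ((c * x) powr (s - 1) / exp (c * x)))) (c powr (1 - s) * (Gamma s / c))"
    by (intro has_bochner_integral_mult_right)
  also have "(\<lambda>x. c powr (1 - s) * (indicator {0..} (c * x) * ((c * x) powr (s - 1) / exp (c * x))))
      = (\<lambda>x. indicator {0..} x * (x powr (s - 1) * exp (- (c * x))))"
  proof
    fix x :: real
    show "c powr (1 - s) * (indicator {0..} (c * x) * ((c * x) powr (s - 1) / exp (c * x)))
      = indicator {0..} x * (x powr (s - 1) * exp (- (c * x)))"
    proof (cases "x \<ge> 0")
      case True
      have "c powr (1 - s) * c powr (s - 1) = 1" using assms(2) by (simp flip: powr_add)
      hence "c powr (1 - s) * (c powr (s - 1) * y) = y" for y by (simp add: mult.assoc[symmetric])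
      thus ?thesis using assms(2) True by (simp add: powr_mult exp_minus field_simps zero_le_mult_iff)
    qed (use assms(2) in \<open>auto simp: indicator_def zero_le_mult_iff\<close>)
  qed
  also have "c powr (1 - s) * (Gamma s / c) = Gamma s * c powr (- s)"
    using assms(2) by (simp add: powr_diff powr_minus field_simps)
  finally show ?thesis .
qed

text \<open>Expand 1 / (exp x - 1) into the geometric series of exp (-n x) with n >= 1. All terms
  are nonnegative, so the interchange needs only the convergence of the sum of their
  integrals.\<close>

lemma has_bochner_integral_zeta_real:
  assumes s: "s > (1::real)"
  shows "has_bochner_integral lborel (\<lambda>x. indicator {0..} x * (x powr (s - 1) / (exp x - 1)))
     (Gamma s * (\<Sum>n. real (Suc n) powr (- s)))"
proof -
  define f where "f = (\<lambda>n x. indicator {0..} x * (x powr (s - 1) * exp (- (real (Suc n) * x))))"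
  have f: "has_bochner_integral lborel (f n) (Gamma s * real (Suc n) powr (- s))" for n
    unfolding f_def by (rule has_bochner_integral_Gamma_scaled) (use s in auto)
  have f_nonneg: "f n x \<ge> 0" for n x by (simp add: f_def)
  have sums: "(\<lambda>n. f n x) sums (indicator {0..} x * (x powr (s - 1) / (exp x - 1)))" for x
  proof (cases "x > 0")
    case True
    have "(\<lambda>n. exp (-x) * exp (-x) ^ n) sums (exp (-x) * (1 / (1 - exp (-x))))"
      using True by (intro sums_mult geometric_sums) simp
    also have "(\<lambda>n. exp (-x) * exp (-x) ^ n) = (\<lambda>n. exp (- (real (Suc n) * x)))"
      by (simp add: exp_of_nat_mult[symmetric] algebra_simps flip: exp_add)
    also have "exp (-x) * (1 / (1 - exp (-x))) = 1 / (exp x - 1)"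
      using True by (simp add: exp_minus divide_simps) (simp add: field_simps)?
    finally have "(\<lambda>n. indicator {0..} x * x powr (s - 1) * exp (- (real (Suc n) * x))) sums
      (indicator {0..} x * x powr (s - 1) * (1 / (exp x - 1)))" by (rule sums_mult)
    thus ?thesis by (simp add: f_def mult.assoc)
  \<comment> \<open>At x = 0 both sides vanish because 0 raised to any power by \<open>powr\<close>
    is 0.\<close>
  qed (auto simp: f_def indicator_def)
  have int: "integrable lborel (f n)" "(\<integral>x. norm (f n x) \<partial>lborel) = Gamma s * real (Suc n) powr (- s)" for n
    using f[of n] f_nonneg by (simp_all add: has_bochner_integral_iff)
  have summ: "summable (\<lambda>n. \<integral>x. norm (f n x) \<partial>lborel)"
    unfolding int(2) using s by (intro summable_mult summable_Suc_powr)
  have ae: "AE x in lborel. summable (\<lambda>n. norm (f n x))"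
    using sums f_nonneg by (intro AE_I2) (simp add: sums_iff)
  have "(\<integral>x. (\<Sum>n. f n x) \<partial>lborel) = (\<Sum>n. \<integral>x. f n x \<partial>lborel)"
    by (rule integral_suminf[OF int(1) ae summ])
  also have "\<dots> = (\<Sum>n. Gamma s * real (Suc n) powr (- s))"
    using f by (simp add: has_bochner_integral_iff)
  also have "\<dots> = Gamma s * (\<Sum>n. real (Suc n) powr (- s))"
    by (rule suminf_mult[OF summable_Suc_powr[OF s]])
  finally have "(\<integral>x. (\<Sum>n. f n x) \<partial>lborel) = Gamma s * (\<Sum>n. real (Suc n) powr (- s))" .
  moreover have "integrable lborel (\<lambda>x. \<Sum>n. f n x)" by (rule integrable_suminf[OF int(1) ae summ])
  moreover have "(\<lambda>x. \<Sum>n. f n x) = (\<lambda>x. indicator {0..} x * (x powr (s - 1) / (exp x - 1)))"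
    using sums by (simp add: sums_iff fun_eq_iff)
  ultimately show ?thesis by (simp add: has_bochner_integral_iff)
qed

lemma has_bochner_integral_powr_unit:
  assumes "a > (-1::real)"
  shows "has_bochner_integral lborel (\<lambda>x. indicator {0..1} x * x powr a) (1 / (a + 1))"
  using has_integral_powr_from_0[OF assms, of 1] by (intro has_bochner_integral_lborel_nonneg) auto

lemma bern_coeff_powr_sums:
  assumes "0 < x" "x \<le> 1"
  shows "(\<lambda>k. bern_coeff k * of_real (x powr (real k + s - 2))) sums of_real (x powr (s - 1) / (exp x - 1))"
proof -
  have "(\<lambda>k. of_real (x powr (s - 2)) * (bern_coeff k * of_real x ^ k)) sums
      (of_real (x powr (s - 2)) * (of_real x / (exp (of_real x) - 1)))"
    using assms pi_gt3 by (intro sums_mult bern_coeff_sums) auto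
  also have "of_real (x powr (s - 2)) * (of_real x / (exp (of_real x) - 1)) = complex_of_real (x powr (s - 2) * x / (exp x - 1))"
    by (simp add: exp_of_real)
  also have "x powr (s - 2) * x = x powr (s - 1)"
    using assms powr_add[of x "s - 2" 1] by simp
  also have "(\<lambda>k. of_real (x powr (s - 2)) * (bern_coeff k * of_real x ^ k)) = (\<lambda>k. bern_coeff k * of_real (x powr (real k + s - 2)))"
    using assms by (auto simp: fun_eq_iff powr_add powr_diff powr_realpow field_simps)
  finally show ?thesis .
qed

text \<open>The offset \<open>K\<close> discards the leading terms of the Bernoulli series. It
  serves with K = 0 for s > 1 and with K = 2 for -1 < s < 0; the condition on \<open>K\<close> says
  that every remaining power is integrable at 0.\<close>

lemma integral_unit_bern_coeff:
  assumes K: "real K + s > 1"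
    and sums: "\<And>x. 0 < x \<Longrightarrow> x \<le> 1 \<Longrightarrow> (\<lambda>k. bern_coeff (k + K) * of_real (x powr (real (k + K) + s - 2))) sums g x"
  shows "has_bochner_integral lborel (\<lambda>x. indicator {0<..1} x *\<^sub>R g x) (\<Sum>k. bern_coeff (k + K) / of_real (real (k + K) + s - 1))"
    and "summable (\<lambda>k. norm (bern_coeff (k + K) / of_real (real (k + K) + s - 1)))"
proof -
  define f where "f = (\<lambda>k x. bern_coeff (k + K) * complex_of_real (indicator {0..1} x * x powr (real (k + K) + s - 2)))"
  have e: "real (k + K) + s - 2 > -1" for k using K by simp
  have e': "\<bar>1 / (real k + real K + s - 1)\<bar> = 1 / (real k + real K + s - 1)" for k using e[of k] by simp
  have f: "has_bochner_integral lborel (f k) (bern_coeff (k + K) * of_real (1 / (real (k + K) + s - 2 + 1)))" for k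
    unfolding f_def by (intro has_bochner_integral_mult_right has_bochner_integral_of_real has_bochner_integral_powr_unit e)
  have f': "has_bochner_integral lborel (\<lambda>x. norm (f k x)) (norm (bern_coeff (k + K)) * (1 / (real (k + K) + s - 2 + 1)))" for k
  proof -
    have "has_bochner_integral lborel (\<lambda>x. norm (bern_coeff (k + K)) * (indicator {0..1} x * x powr (real (k + K) + s - 2)))
       (norm (bern_coeff (k + K)) * (1 / (real (k + K) + s - 2 + 1)))"
      by (intro has_bochner_integral_mult_right has_bochner_integral_powr_unit e)
    thus ?thesis by (simp add: f_def norm_mult abs_mult)
  qed
  have int: "integrable lborel (f n)" for n using f by (simp add: has_bochner_integral_iff)
  have summ': "summable (\<lambda>k. norm (bern_coeff (k + K)) * (1 / (real (k + K) + s - 2 + 1)))"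
  proof (rule summable_comparison_test)
    show "summable (\<lambda>k. norm (bern_coeff (k + K)) * (1 / (real K + s - 1)))"
      by (intro summable_mult2 summable_ignore_initial_segment[OF summable_bern_coeff])
    show "\<exists>N. \<forall>k\<ge>N. norm (norm (bern_coeff (k + K)) * (1 / (real (k + K) + s - 2 + 1))) \<le> norm (bern_coeff (k + K)) * (1 / (real K + s - 1))"
    proof (intro exI[of _ 0] allI impI)
      fix k
      have "1 / (real (k + K) + s - 2 + 1) \<le> 1 / (real K + s - 1)"
        using K by (intro divide_left_mono) auto
      hence "norm (bern_coeff (k + K)) * (1 / (real (k + K) + s - 2 + 1)) \<le> norm (bern_coeff (k + K)) * (1 / (real K + s - 1))"
        by (intro mult_left_mono) simp_all
      moreover have "0 \<le> norm (bern_coeff (k + K)) * (1 / (real (k + K) + s - 2 + 1))"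
        using e[of k] by (intro mult_nonneg_nonneg divide_nonneg_nonneg norm_ge_zero) linarith+
      ultimately show "norm (norm (bern_coeff (k + K)) * (1 / (real (k + K) + s - 2 + 1))) \<le> norm (bern_coeff (k + K)) * (1 / (real K + s - 1))"
        unfolding real_norm_def by linarith
    qed
  qed
  hence summ: "summable (\<lambda>k. \<integral>x. norm (f k x) \<partial>lborel)"
    using f' by (simp add: has_bochner_integral_iff)
  have ae: "AE x in lborel. summable (\<lambda>k. norm (f k x))"
  proof (intro AE_I2)
    fix x :: real
    show "summable (\<lambda>k. norm (f k x))"
    proof (cases "x \<in> {0<..1}")
      case True
      have "summable (\<lambda>k. norm (bern_coeff (k + K)) * x powr (real K + s - 2))"
        by (intro summable_mult2 summable_ignore_initial_segment[OF summable_bern_coeff])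
      thus ?thesis
      proof (rule summable_comparison_test[rotated], intro exI[of _ 0] allI impI)
        fix k
        have "x powr (real (k + K) + s - 2) \<le> x powr (real K + s - 2)"
          using True by (intro powr_mono') auto
        thus "norm (norm (f k x)) \<le> norm (bern_coeff (k + K)) * x powr (real K + s - 2)"
          using True by (simp add: f_def norm_mult mult_left_mono)
      qed
    next
      case False
      hence "f k x = 0" for k by (auto simp: f_def indicator_def)
      thus ?thesis by simp
    qed
  qed
  have eq: "(\<Sum>k. f k x) = indicator {0<..1} x *\<^sub>R g x" for x
  proof (cases "x \<in> {0<..1}")
    case True
    thus ?thesis using sums[of x] by (simp add: f_def sums_iff)
  next
    case False
    hence "f k x = 0" for k by (auto simp: f_def indicator_def)
    thus ?thesis using False by simp
  qed
  have "has_bochner_integral lborel (\<lambda>x. \<Sum>k. f k x) (\<Sum>k. \<integral>x. f k x \<partial>lborel)"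
    using integral_suminf[OF int ae summ] integrable_suminf[OF int ae summ] by (simp add: has_bochner_integral_iff)
  also have "(\<lambda>k. \<integral>x. f k x \<partial>lborel) = (\<lambda>k. bern_coeff (k + K) / of_real (real (k + K) + s - 1))"
    using f by (auto simp: has_bochner_integral_iff fun_eq_iff)
  finally show "has_bochner_integral lborel (\<lambda>x. indicator {0<..1} x *\<^sub>R g x) (\<Sum>k. bern_coeff (k + K) / of_real (real (k + K) + s - 1))"
    by (simp only: eq)
  have "norm (bern_coeff (k + K)) * (1 / (real (k + K) + s - 2 + 1)) = norm (bern_coeff (k + K) / of_real (real (k + K) + s - 1))" for k
  proof -
    have "norm (complex_of_real (real (k + K) + s - 1)) = real (k + K) + s - 1"
      using e[of k] unfolding norm_of_real by linarith
    thus ?thesis by (simp add: norm_divide)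
  qed
  with summ' show "summable (\<lambda>k. norm (bern_coeff (k + K) / of_real (real (k + K) + s - 1)))" by (simp only:)
qed

lemma Re_pos_not_nonpos_Int: "Re s > 0 \<Longrightarrow> s \<notin> \<int>\<^sub>\<le>\<^sub>0"
  by (auto simp: nonpos_Ints_def)

lemma Gamma_zeta_real:
  assumes s: "s > (1::real)"
  shows "complex_of_real (Gamma s * (\<Sum>n. real (Suc n) powr (- s))) = Gamma (of_real s) * zeta_cont (of_real s)"
proof -
  let ?I = "\<lambda>x. x powr (s - 1) / (exp x - 1) :: real"
  have A: "has_bochner_integral lborel (\<lambda>x. indicator {0..} x *\<^sub>R complex_of_real (?I x)) (complex_of_real (Gamma s * (\<Sum>n. real (Suc n) powr (- s))))"
    using has_bochner_integral_of_real[OF has_bochner_integral_zeta_real[OF s], where 'a=complex]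
    by (simp add: scaleR_conv_of_real)
  have K: "real 0 + s > 1" using s by simp
  have sums: "(\<lambda>k. bern_coeff (k + 0) * of_real (x powr (real (k + 0) + s - 2))) sums complex_of_real (?I x)"
    if "0 < x" "x \<le> 1" for x using bern_coeff_powr_sums[OF that] by simp
  have B: "has_bochner_integral lborel (\<lambda>x. indicator {0<..1} x *\<^sub>R complex_of_real (?I x)) (\<Sum>k. bern_coeff (k + 0) / of_real (real (k + 0) + s - 1))"
    by (rule integral_unit_bern_coeff(1)[OF K sums])
  have "summable (\<lambda>k. norm (bern_coeff (k + 0) / of_real (real (k + 0) + s - 1)))"
    by (rule integral_unit_bern_coeff(2)[OF K sums])
  hence summ: "summable (\<lambda>k. bern_coeff k / of_real (real k + s - 1))"
    unfolding add_0_right by (rule summable_norm_cancel)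
  have C: "has_bochner_integral lborel (\<lambda>x. indicator {1..} x *\<^sub>R complex_of_real (?I x)) (mellin_tail (of_real s))"
  proof -
    have "(\<lambda>x. indicator {1..} x *\<^sub>R (of_real x powr (of_real s - 1) / of_real (exp x - 1) :: complex)) =
        (\<lambda>x. indicator {1..} x *\<^sub>R complex_of_real (?I x))"
      by (auto simp: fun_eq_iff indicator_def powr_of_real[symmetric])
    thus ?thesis using mellin_tail_integrable[of "of_real s"]
      by (simp add: has_bochner_integral_iff mellin_tail_def)
  qed
  have "has_bochner_integral lborel (\<lambda>x. indicator {0<..1} x *\<^sub>R complex_of_real (?I x) + indicator {1..} x *\<^sub>R complex_of_real (?I x))
     ((\<Sum>k. bern_coeff (k + 0) / of_real (real (k + 0) + s - 1)) + mellin_tail (of_real s))"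
    by (rule has_bochner_integral_add[OF B C])
  \<comment> \<open>The two pieces overlap in the point 1, which is a null set.\<close>
  moreover have "AE x in lborel. indicator {0<..1} x *\<^sub>R complex_of_real (?I x) + indicator {1..} x *\<^sub>R complex_of_real (?I x) = indicator {0..} x *\<^sub>R complex_of_real (?I x)"
    using AE_lborel_singleton[of "1::real"] by eventually_elim (auto simp: indicator_def)
  ultimately have "has_bochner_integral lborel (\<lambda>x. indicator {0..} x *\<^sub>R complex_of_real (?I x)) ((\<Sum>k. bern_coeff (k + 0) / of_real (real (k + 0) + s - 1)) + mellin_tail (of_real s))"
    using has_bochner_integral_iff[of lborel "\<lambda>x. indicator {0..} x *\<^sub>R complex_of_real (?I x)"] A
    by (subst (asm) has_bochner_integral_cong_AE) (auto simp: has_bochner_integral_iff)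
  from has_bochner_integral_eq[OF A this]
  have "complex_of_real (Gamma s * (\<Sum>n. real (Suc n) powr (- s))) = (\<Sum>k. bern_coeff k / of_real (real k + s - 1)) + mellin_tail (of_real s)"
    by simp
  also have "(\<Sum>k. bern_coeff k / of_real (real k + s - 1)) = 1 / (of_real s - 1) + (\<Sum>k. bern_coeff (Suc k) / (of_real s + of_nat k))"
    using suminf_split_head[OF summ] by (simp add: algebra_simps)
  also have "\<dots> + mellin_tail (of_real s) = Gamma (of_real s) * zeta_cont (of_real s)"
    using s Re_pos_not_nonpos_Int[of "of_real s"] by (subst Gamma_zeta_cont) simp_all
  finally show ?thesis .
qed

text \<open>The integrals were evaluated at real exponents only; the half plane follows by the
  identity theorem from the real ray.\<close>

lemma zeta_cont_dirichlet:
  assumes "Re s > 1"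
  shows "(\<lambda>n. 1 / of_nat (Suc n) powr s) sums zeta_cont s"
proof -
  define D where "D = (\<lambda>s::complex. \<Sum>n. 1 / of_nat (Suc n) powr s)"
  have real_case: "zeta_cont (of_real x) = D (of_real x)" if x: "x > 1" for x
  proof -
    have nz: "Gamma (complex_of_real x) \<noteq> 0"
      using x Re_pos_not_nonpos_Int[of "of_real x"] by (simp add: Gamma_eq_zero_iff)
    have eq: "complex_of_real (real (Suc n) powr (- x)) = 1 / of_nat (Suc n) powr of_real x" for n
      using powr_of_real[of "real (Suc n)" x] by (simp add: powr_minus_divide)
    have "D (of_real x) = (\<Sum>n. complex_of_real (real (Suc n) powr (- x)))"
      unfolding D_def eq ..
    also have "\<dots> = of_real (\<Sum>n. real (Suc n) powr (- x))"
      by (rule suminf_of_real[OF summable_Suc_powr[OF x], symmetric])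
    finally have "Gamma (of_real x) * D (of_real x) = Gamma (of_real x) * zeta_cont (of_real x)"
      using Gamma_zeta_real[OF x] by (simp add: Gamma_complex_of_real)
    thus ?thesis using nz by simp
  qed
  have "zeta_cont s - D s = 0"
  proof (rule analytic_continuation[of "\<lambda>s. zeta_cont s - D s" "{s. Re s > 1}" "of_real ` {1<..}" 2])
    show "(\<lambda>s. zeta_cont s - D s) holomorphic_on {s. Re s > 1}"
      unfolding D_def by (intro holomorphic_intros dirichlet_series holomorphic_on_subset[OF zeta_cont_holomorphic]) auto
    show "(2::complex) islimpt of_real ` {1<..}"
      unfolding islimpt_approachable
    proof (intro allI impI)
      fix e :: real assume "e > 0"
      thus "\<exists>x'\<in>of_real ` {1<..}. x' \<noteq> (2::complex) \<and> dist x' 2 < e"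
        by (intro bexI[of _ "of_real (2 + e/2)"] imageI) (simp_all add: dist_norm norm_divide)
    qed
    show "connected {s. Re s > 1}" by (intro convex_connected convex_halfspace_Re_gt)
    show "zeta_cont z - D z = 0" if "z \<in> of_real ` {1<..}" for z
      using that real_case by auto
  qed (use assms in \<open>auto simp: open_halfspace_Re_gt\<close>)
  thus ?thesis using dirichlet_series(2)[OF assms] by (simp add: D_def sums_iff)
qed

section \<open>Zeta and its values at nonpositive integers\<close>

lemma connected_punctured_complex: "connected (- {p :: complex})"
  by (intro path_connected_imp_connected path_connected_punctured_universe) simp

lemma zeta_unique:
  assumes "f holomorphic_on (- {1})" "\<And>s. Re s > 1 \<Longrightarrow> (\<lambda>n. 1 / of_nat (Suc n) powr s) sums f s"
    and "f 1 = 0"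
  shows "f = zeta_cont"
proof
  fix s
  show "f s = zeta_cont s"
  proof (cases "s = 1")
    case False
    have "f s - zeta_cont s = 0"
    proof (rule analytic_continuation[where f="\<lambda>s. f s - zeta_cont s" and S="- {1}" and U="{s. Re s > 1}" and \<xi>=2])
      show "f s - zeta_cont s = 0" if "s \<in> {s. 1 < Re s}" for s
        using sums_unique2[OF assms(2) zeta_cont_dirichlet, of s] that by simp
      show "(2::complex) islimpt {s. 1 < Re s}"
        by (rule interior_limit_point) (simp add: interior_open open_halfspace_Re_gt)
      show "(\<lambda>s. f s - zeta_cont s) holomorphic_on - {1}"
        by (intro holomorphic_intros assms zeta_cont_holomorphic)
      show "{s. 1 < Re s} \<subseteq> - {1}" by auto
    qed (use False in \<open>simp_all add: connected_punctured_complex open_Compl\<close>)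
    thus ?thesis by simp
  qed (simp add: assms zeta_cont_def)
qed

lemma zeta_eq: "zeta = zeta_cont"
  unfolding zeta_def
proof (rule the_equality)
  show "zeta_cont holomorphic_on - {1} \<and> (\<forall>s. 1 < Re s \<longrightarrow> (\<lambda>n. 1 / of_nat (Suc n) powr s) sums zeta_cont s) \<and> zeta_cont 1 = 0"
    using zeta_cont_holomorphic zeta_cont_dirichlet by (simp add: zeta_cont_def[of 1] del: of_nat_Suc)
qed (blast intro: zeta_unique)

lemma zeta_holomorphic [holomorphic_intros]:
  assumes "f holomorphic_on A" "\<And>x. x \<in> A \<Longrightarrow> f x \<noteq> 1"
  shows "(\<lambda>x. zeta (f x)) holomorphic_on A"
proof -
  have "(zeta \<circ> f) holomorphic_on A"
    using assms zeta_cont_holomorphic by (intro holomorphic_on_compose_gen[of f A zeta "- {1}"]) (auto simp: zeta_eq)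
  thus ?thesis by (simp add: o_def)
qed

lemma zeta_1 [simp]: "zeta 1 = 0"
  by (simp add: zeta_eq zeta_cont_def)

lemma zeta_sums: "Re s > 1 \<Longrightarrow> (\<lambda>n. 1 / of_nat (Suc n) powr s) sums zeta s"
  unfolding zeta_eq by (rule zeta_cont_dirichlet)

text \<open>At s = -k only the summand of index k survives: for larger indices the Pochhammer factor
  vanishes, for smaller ones the reciprocal Gamma factor does, and the remaining parts carry
  \<open>rGamma (-k)\<close>, which is 0.\<close>

lemma zeta_minus_of_nat: "zeta (- of_nat k) = (-1) ^ k * fact k * bern_coeff (Suc k)"
proof -
  let ?f = "\<lambda>j. bern_coeff (Suc j) * (pochhammer (- of_nat k) j * rGamma (- of_nat k + of_nat (Suc j)))"
  have zero: "rGamma (- of_nat k :: complex) = 0" by (simp add: rGamma_eq_zero_iff)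
  have "?f sums (\<Sum>j\<in>{k}. ?f j)"
  proof (rule sums_finite)
    fix j assume "j \<notin> {k}"
    hence "j > k \<or> j < k" by auto
    thus "?f j = 0"
    proof
      assume "j > k"
      thus ?thesis by (simp add: pochhammer_of_nat_eq_0_lemma)
    next
      assume "j < k"
      hence "- of_nat k + of_nat (Suc j) = - (of_nat (k - Suc j) :: complex)" by (simp add: of_nat_diff)
      hence "rGamma (- of_nat k + of_nat (Suc j) :: complex) = 0" by (simp add: rGamma_eq_zero_iff del: of_nat_Suc)
      thus ?thesis by simp
    qed
  qed simp
  moreover have "?f k = (-1) ^ k * fact k * bern_coeff (Suc k)"
    by (simp add: pochhammer_same)
  ultimately have "(\<Sum>j. ?f j) = (-1) ^ k * fact k * bern_coeff (Suc k)"
    by (simp add: sums_iff)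
  moreover have "- of_nat k \<noteq> (1 :: complex)"
  proof
    assume "- of_nat k = (1 :: complex)"
    hence "Re (- of_nat k) = 1" by simp
    thus False by simp
  qed
  ultimately show ?thesis using zero by (simp add: zeta_eq zeta_cont_def zeta_reg_def)
qed

lemma zeta_0: "zeta 0 = - 1 / 2"
  using zeta_minus_of_nat[of 0] by simp

lemma zeta_pole: "((\<lambda>s. (s - 1) * zeta s) \<longlongrightarrow> 1) (at 1)"
proof -
  have "isCont (\<lambda>s. rGamma s + (s - 1) * zeta_reg s) 1"
    by (rule analytic_at_imp_isCont) (auto intro!: analytic_on_holomorphic[THEN iffD2] exI[of _ UNIV] holomorphic_intros zeta_reg_holomorphic)
  hence "((\<lambda>s. rGamma s + (s - 1) * zeta_reg s) \<longlongrightarrow> 1) (at 1)"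
    by (simp add: isCont_def)
  moreover have "\<forall>\<^sub>F s in at 1. rGamma s + (s - 1) * zeta_reg s = (s - 1) * zeta s"
    by (auto simp: eventually_at_filter zeta_eq zeta_cont_def field_simps)
  ultimately show ?thesis by (rule Lim_transform_eventually)
qed

subsection \<open>Partial fractions\<close>

text \<open>The logarithmic derivative of the reflection formula, taken on the reciprocal Gamma
  function so that the product differentiated is entire.\<close>

lemma Digamma_reflection:
  fixes z :: complex
  assumes "z \<notin> \<int>"
  shows "Digamma (1 - z) - Digamma z = of_real pi * cot (of_real pi * z)"
proof -
  have z: "z \<notin> \<int>\<^sub>\<le>\<^sub>0" "1 - z \<notin> \<int>\<^sub>\<le>\<^sub>0"
    using assms nonpos_Ints_subset_Ints Ints_diff[of 1 "1 - z"] by auto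
  have sin: "sin (of_real pi * z) \<noteq> 0"
    using assms by (simp add: sin_eq_0) (metis Ints_of_int mult.commute mult_cancel_right of_real_eq_0_iff of_real_of_int_eq pi_neq_zero)
  have "((\<lambda>z. rGamma z * rGamma (1 - z)) has_field_derivative
     (- rGamma z * Digamma z * rGamma (1 - z) + rGamma z * (rGamma (1 - z) * Digamma (1 - z)))) (at z)"
    using z by (auto intro!: derivative_eq_intros)
  also have "(\<lambda>z. rGamma z * rGamma (1 - z)) = (\<lambda>z::complex. sin (of_real pi * z) / of_real pi)"
    by (simp add: fun_eq_iff rGamma_reflection_complex)
  finally have "((\<lambda>z::complex. sin (of_real pi * z) / of_real pi) has_field_derivative
     (- rGamma z * Digamma z * rGamma (1 - z) + rGamma z * (rGamma (1 - z) * Digamma (1 - z)))) (at z)" .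
  moreover have "((\<lambda>z::complex. sin (of_real pi * z) / of_real pi) has_field_derivative cos (of_real pi * z)) (at z)"
    by (auto intro!: derivative_eq_intros)
  ultimately have "- rGamma z * Digamma z * rGamma (1 - z) + rGamma z * (rGamma (1 - z) * Digamma (1 - z)) = cos (of_real pi * z)"
    by (rule DERIV_unique)
  hence "(rGamma z * rGamma (1 - z)) * (Digamma (1 - z) - Digamma z) = cos (of_real pi * z)"
    by (simp add: algebra_simps)
  hence "(sin (of_real pi * z) / of_real pi) * (Digamma (1 - z) - Digamma z) = cos (of_real pi * z)"
    by (simp only: rGamma_reflection_complex)
  thus ?thesis using sin by (simp add: cot_def field_simps)
qed

text \<open>The series of Digamma at 1 - z and at z are subtracted; their common regularising terms
  cancel.\<close>

lemma cot_partial_fractions: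
  fixes z :: complex
  assumes "z \<notin> \<int>"
  shows "(\<lambda>n. 1 / (z + of_nat (Suc n)) + 1 / (z - of_nat (Suc n))) sums (of_real pi * cot (of_real pi * z) - 1 / z)"
proof -
  have z0: "z \<noteq> 0" "1 - z \<noteq> 0" using assms by auto
  have ne: "z + of_nat n \<noteq> 0" "z - of_nat n \<noteq> 0" for n
    using assms by (metis Ints_minus Ints_of_nat add_eq_0_iff2, metis Ints_of_nat eq_iff_diff_eq_0)
  have D: "(\<lambda>k. inverse (of_nat (Suc k)) - inverse (w + of_nat k)) sums (Digamma w + euler_mascheroni)"
    if "w \<noteq> 0" for w :: complex
    using summable_sums[OF summable_Digamma[OF that]] by (simp add: Digamma_def)
  have "(\<lambda>k. (inverse (of_nat (Suc k)) - inverse ((1 - z) + of_nat k)) - (inverse (of_nat (Suc k)) - inverse (z + of_nat k)))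
     sums ((Digamma (1 - z) + euler_mascheroni) - (Digamma z + euler_mascheroni))"
    by (intro sums_diff D z0)
  hence A: "(\<lambda>k. inverse (z + of_nat k) + inverse (z - of_nat (Suc k))) sums (of_real pi * cot (of_real pi * z))"
  proof -
    have "(inverse (of_nat (Suc k)) - inverse ((1 - z) + of_nat k)) - (inverse (of_nat (Suc k)) - inverse (z + of_nat k))
       = inverse (z + of_nat k) + inverse (z - of_nat (Suc k))" for k
    proof -
      have "(1 - z) + of_nat k = - (z - of_nat (Suc k))" by simp
      hence "inverse ((1 - z) + of_nat k) = - inverse (z - of_nat (Suc k))" by (simp only: inverse_minus_eq)
      thus ?thesis by simp
    qed
    thus ?thesis using \<open>_ sums _\<close> Digamma_reflection[OF assms] by (simp only: ) simp
  qed
  \<comment> \<open>The difference pairs 1 / (z + k) with 1 / (z - k - 1). This telescoping series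
    moves the first fraction on to 1 / (z + k + 1) and accounts for the term -1 / z.\<close>
  have B: "(\<lambda>k. inverse (z + of_nat (Suc k)) - inverse (z + of_nat k)) sums (0 - inverse (z + of_nat 0))"
    by (intro telescope_sums filterlim_compose[OF tendsto_inverse_0]
          tendsto_add_filterlim_at_infinity[OF tendsto_const] tendsto_of_nat)
  from sums_add[OF A B] show ?thesis by (simp add: inverse_eq_divide algebra_simps)
qed

text \<open>The cotangent series at the imaginary point z = i x / (2 pi), because i cot (i x / 2) =
  1 + 2 / (exp x - 1).\<close>

lemma exp_partial_fractions:
  assumes "(x::real) > 0"
  shows "(\<lambda>n. 2 * x / (x\<^sup>2 + (2 * pi * real (Suc n))\<^sup>2)) sums (1 / (exp x - 1) - 1 / x + 1 / 2)"
proof -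
  define z where "z = \<i> * of_real (x / (2 * pi))"
  have z: "z \<notin> \<int>"
  proof
    assume "z \<in> \<int>"
    then obtain n where "z = of_int n" by (elim Ints_cases)
    hence "Im z = 0" by simp
    thus False using assms by (simp add: z_def)
  qed
  have trm: "1 / (z + of_nat (Suc n)) + 1 / (z - of_nat (Suc n)) = - 2 * of_real pi * \<i> * of_real (2 * x / (x\<^sup>2 + (2 * pi * real (Suc n))\<^sup>2))" for n
  proof -
    have ne: "z + of_nat (Suc n) \<noteq> 0" "z - of_nat (Suc n) \<noteq> 0"
      using assms by (auto simp: z_def complex_eq_iff)
    have pos: "x\<^sup>2 + (2 * pi * real (Suc n))\<^sup>2 > 0" using assms by (intro add_pos_nonneg) auto
    have "(z + of_nat (Suc n)) * (z - of_nat (Suc n)) = z\<^sup>2 - (of_nat (Suc n))\<^sup>2" by (simp add: power2_eq_square algebra_simps)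
    also have "\<dots> = - of_real ((x\<^sup>2 + (2 * pi * real (Suc n))\<^sup>2) / (4 * pi\<^sup>2))"
    proof -
      have "z\<^sup>2 = - of_real (x\<^sup>2 / (4 * pi\<^sup>2))" by (simp add: z_def power_mult_distrib power_divide)
      moreover have "(of_nat (Suc n))\<^sup>2 = complex_of_real ((2 * pi * real (Suc n))\<^sup>2 / (4 * pi\<^sup>2))"
        by (simp add: power_mult_distrib)
      ultimately show ?thesis by (simp only: add_divide_distrib of_real_add) simp
    qed
    finally have "(z + of_nat (Suc n)) * (z - of_nat (Suc n)) = - of_real ((x\<^sup>2 + (2 * pi * real (Suc n))\<^sup>2) / (4 * pi\<^sup>2))" .
    moreover have "1 / (z + of_nat (Suc n)) + 1 / (z - of_nat (Suc n)) = 2 * z / ((z + of_nat (Suc n)) * (z - of_nat (Suc n)))"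
      using ne by (simp add: divide_simps)
    ultimately have "1 / (z + of_nat (Suc n)) + 1 / (z - of_nat (Suc n)) = - (2 * z / of_real ((x\<^sup>2 + (2 * pi * real (Suc n))\<^sup>2) / (4 * pi\<^sup>2)))"
      by simp
    also have "2 * z = \<i> * of_real (x / pi)" by (simp add: z_def)
    also have "- (\<i> * of_real (x / pi) / of_real ((x\<^sup>2 + (2 * pi * real (Suc n))\<^sup>2) / (4 * pi\<^sup>2)))
       = - (\<i> * of_real ((x / pi) / ((x\<^sup>2 + (2 * pi * real (Suc n))\<^sup>2) / (4 * pi\<^sup>2))))"
      by (simp only: of_real_divide times_divide_eq_right)
    also have "(x / pi) / ((x\<^sup>2 + (2 * pi * real (Suc n))\<^sup>2) / (4 * pi\<^sup>2)) = 2 * pi * (2 * x / (x\<^sup>2 + (2 * pi * real (Suc n))\<^sup>2))"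
      using pos by (simp add: power2_eq_square)
    finally show ?thesis by simp
  qed
  have piz: "of_real pi * z = \<i> * of_real (x / 2)" by (simp add: z_def)
  have ex: "exp x > 1" using assms by simp
  have cot: "of_real pi * cot (of_real pi * z) - 1 / z = - 2 * of_real pi * \<i> * of_real (1 / (exp x - 1) - 1 / x + 1 / 2)"
  proof -
    define E where "E = exp (x / 2)"
    have E: "E > 1" "exp x = E\<^sup>2" using assms by (auto simp: E_def power2_eq_square simp flip: exp_add)
    have e1: "exp (\<i> * (\<i> * of_real (x / 2))) = of_real (1 / E)" "exp (- (\<i> * (\<i> * of_real (x / 2)))) = of_real E"
      by (simp_all add: E_def exp_minus inverse_eq_divide flip: exp_of_real)
    have "cos (\<i> * of_real (x / 2)) = of_real (1 / E + E) / 2"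
      unfolding cos_exp_eq e1 by simp
    have "sin (\<i> * of_real (x / 2)) = of_real (1 / E - E) / (2 * \<i>)"
      unfolding sin_exp_eq e1 by simp
    have "cot (of_real pi * z) = \<i> * of_real ((1 / E + E) / (1 / E - E))"
    proof -
      have i: "a / 2 / (b / (2 * \<i>)) = \<i> * (a / b)" for a b :: complex by (cases "b = 0") (simp_all add: field_simps)
      show ?thesis unfolding piz cot_def \<open>cos _ = _\<close> \<open>sin _ = _\<close> i by simp
    qed
    also have "(1 / E + E) / (1 / E - E) = - (1 + 2 / (exp x - 1))"
    proof -
      have "E\<^sup>2 > 1" using E(1) by (simp add: power2_eq_square less_1_mult)
      thus ?thesis using E(1) unfolding E(2) by (simp add: divide_simps power2_eq_square) (simp add: algebra_simps)
    qed
    finally have c: "cot (of_real pi * z) = \<i> * of_real (- (1 + 2 / (exp x - 1)))" .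
    have "1 / z = - \<i> * of_real (2 * pi / x)" using assms by (simp add: z_def field_simps)
    thus ?thesis unfolding c by (simp add: algebra_simps)
  qed
  have "(\<lambda>n. - 2 * of_real pi * \<i> * complex_of_real (2 * x / (x\<^sup>2 + (2 * pi * real (Suc n))\<^sup>2))) sums
      (- 2 * of_real pi * \<i> * of_real (1 / (exp x - 1) - 1 / x + 1 / 2))"
    using cot_partial_fractions[OF z] unfolding trm cot .
  hence "(\<lambda>n. complex_of_real (2 * x / (x\<^sup>2 + (2 * pi * real (Suc n))\<^sup>2))) sums
      of_real (1 / (exp x - 1) - 1 / x + 1 / 2)"
    by (subst (asm) sums_mult_iff) simp_all
  thus ?thesis by (simp only: sums_of_real_iff)
qed

text \<open>Substituting t = x^2 / (x^2 + 1) makes twice the integral a Beta integral with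
  parameters adding up to 1, and the reflection formula evaluates it.\<close>

lemma has_bochner_integral_powr_over_square:
  assumes s: "-1 < s" "s < (1::real)"
  shows "has_bochner_integral lborel (\<lambda>x. indicator {0<..} x * (x powr s / (x\<^sup>2 + 1))) (pi / (2 * cos (pi * s / 2)))"
proof -
  define g where "g = (\<lambda>x::real. x\<^sup>2 / (x\<^sup>2 + 1))"
  define g' where "g' = (\<lambda>x::real. 2 * x / (x\<^sup>2 + 1)\<^sup>2)"
  define f where "f = (\<lambda>t::real. t powr ((s + 1) / 2 - 1) * (1 - t) powr ((1 - s) / 2 - 1))"
  define B where "B = Beta ((s + 1) / 2) ((1 - s) / 2)"
  have img: "g ` {0<..} = {0<..<1}"
  proof (intro equalityI subsetI)
    fix t assume "t \<in> g ` {0<..}"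
    thus "t \<in> {0<..<1}" by (auto simp: g_def divide_simps add_pos_nonneg)
  next
    fix t :: real assume t: "t \<in> {0<..<1}"
    have "g (sqrt (t / (1 - t))) = t" using t by (simp add: g_def field_simps)
    moreover have "sqrt (t / (1 - t)) \<in> {0<..}" using t by simp
    ultimately show "t \<in> g ` {0<..}" by (metis imageI)
  qed
  have pos: "x\<^sup>2 + 1 > 0" for x :: real by (simp add: add_nonneg_pos)
  have inj: "inj_on g {0<..}"
  proof (rule inj_onI)
    fix x y :: real assume "x \<in> {0<..}" "y \<in> {0<..}" "g x = g y"
    hence "x\<^sup>2 * (y\<^sup>2 + 1) = y\<^sup>2 * (x\<^sup>2 + 1)" using pos[of x] pos[of y] by (simp add: g_def frac_eq_eq)
    hence "x\<^sup>2 = y\<^sup>2" by (simp add: algebra_simps)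
    thus "x = y" using \<open>x \<in> _\<close> \<open>y \<in> _\<close> by simp
  qed
  have der: "(g has_field_derivative g' x) (at x within {0<..})" for x
    unfolding g_def g'_def using pos[of x]
    by (auto intro!: derivative_eq_intros simp: power2_eq_square algebra_simps)
  have fB: "f absolutely_integrable_on {0<..<1} \<and> integral {0<..<1} f = B"
  proof -
    have "(f has_integral B) {0..1}"
      unfolding f_def B_def by (rule has_integral_Beta_real) (use s in auto)
    hence "(f has_integral B) {0<..<1}" by (simp add: has_integral_Icc_iff_Ioo)
    thus ?thesis by (auto simp: f_def has_integral_iff intro!: nonnegative_absolutely_integrable_1)
  qed
  hence *: "(\<lambda>x. \<bar>g' x\<bar> * f (g x)) absolutely_integrable_on {0<..}" "integral {0<..} (\<lambda>x. \<bar>g' x\<bar> * f (g x)) = B"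
    using has_absolute_integral_change_of_variables_1'[of "{0<..}" g g' f B, OF _ der inj] img by auto
  have eq: "\<bar>g' x\<bar> * f (g x) = 2 * (x powr s / (x\<^sup>2 + 1))" if "x \<in> {0<..}" for x
  proof -
    have x: "x > 0" using that by simp
    let ?c = "x\<^sup>2 + 1"
    have c: "?c > 0" by (rule pos)
    have "1 - g x = 1 / ?c" using c by (simp add: g_def field_simps)
    hence "f (g x) = (x\<^sup>2 / ?c) powr ((s - 1) / 2) * (1 / ?c) powr (- (s + 1) / 2)"
    proof -
      have "(s + 1) / 2 - 1 = (s - 1) / 2" "(1 - s) / 2 - 1 = - (s + 1) / 2" by (simp_all add: field_simps)
      thus ?thesis using \<open>1 - g x = 1 / ?c\<close> by (simp only: f_def) (simp only: g_def)
    qed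
    also have "\<dots> = (x\<^sup>2) powr ((s - 1) / 2) * ((1 / ?c) powr ((s - 1) / 2) * (1 / ?c) powr (- (s + 1) / 2))"
      using x c powr_mult[of "x\<^sup>2" "1 / ?c"] by simp
    also have "(1 / ?c) powr ((s - 1) / 2) * (1 / ?c) powr (- (s + 1) / 2) = (1 / ?c) powr (-1)"
      by (simp flip: powr_add add: field_simps)
    also have "\<dots> = ?c" using c by (simp add: powr_minus_divide)
    also have "(x\<^sup>2) powr ((s - 1) / 2) = x powr (s - 1)"
    proof -
      have "(x powr 2) powr ((s - 1) / 2) = x powr (s - 1)"
        unfolding powr_powr by (rule arg_cong[where f="(powr) x"]) (simp add: field_simps)
      thus ?thesis using x by simp
    qed
    also have "x powr (s - 1) = x powr s / x" using x by (simp add: powr_diff)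
    finally have "f (g x) = x powr s / x * ?c" .
    moreover have "\<bar>g' x\<bar> = 2 * x / ?c\<^sup>2" using x by (simp add: g'_def)
    ultimately show ?thesis using x c by (simp add: power2_eq_square)
  qed
  have "((\<lambda>x. 2 * (x powr s / (x\<^sup>2 + 1))) has_integral B) {0<..}"
  proof -
    have "((\<lambda>x. \<bar>g' x\<bar> * f (g x)) has_integral B) {0<..}"
      using * by (auto simp: has_integral_iff dest: set_lebesgue_integral_eq_integral)
    thus ?thesis by (rule has_integral_eq[rotated]) (rule eq)
  qed
  hence "((\<lambda>x. (x powr s / (x\<^sup>2 + 1))) has_integral B / 2) {0<..}"
    using has_integral_mult_right[of "\<lambda>x. 2 * (x powr s / (x\<^sup>2 + 1))" B "{0<..}" "1 / 2"] by simp
  hence "has_bochner_integral lborel (\<lambda>x. indicator {0<..} x * (x powr s / (x\<^sup>2 + 1))) (B / 2)"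
    by (rule has_bochner_integral_lborel_nonneg) auto
  also have "B = pi / cos (pi * s / 2)"
  proof -
    define r where "r = (s + 1) / 2"
    have "(1 - s) / 2 = 1 - r" by (simp add: r_def field_simps)
    hence "B = Beta r (1 - r)" by (simp only: B_def r_def)
    hence "complex_of_real B = Beta (of_real r) (1 - of_real r)"
      by (simp add: Beta_complex_of_real[symmetric])
    hence "complex_of_real B = Gamma (of_real ((s + 1) / 2)) * Gamma (1 - of_real ((s + 1) / 2))"
      by (simp add: Beta_def r_def)
    also have "\<dots> = of_real (pi / sin (pi * ((s + 1) / 2)))"
      by (subst Gamma_reflection_complex) (simp only: of_real_mult[symmetric] sin_of_real of_real_divide[symmetric])
    also have "sin (pi * ((s + 1) / 2)) = cos (pi * s / 2)"
    proof -
      have "pi * ((s + 1) / 2) = pi * s / 2 + pi / 2" by (simp add: field_simps)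
      thus ?thesis by (simp only: sin_add) simp
    qed
    finally show ?thesis by (simp only: of_real_eq_iff)
  qed
  finally show ?thesis by (simp add: mult.commute)
qed

subsection \<open>The functional equation\<close>

lemma has_bochner_integral_powr_over_square_scaled:
  assumes s: "-1 < s" "s < (1::real)" and c: "c > 0"
  shows "has_bochner_integral lborel (\<lambda>x. indicator {0<..} x * (x powr s / (x\<^sup>2 + c\<^sup>2))) (c powr (s - 1) * (pi / (2 * cos (pi * s / 2))))"
proof -
  let ?B = "pi / (2 * cos (pi * s / 2))"
  have "has_bochner_integral lborel (\<lambda>x. indicator {0<..} (1 / c * x) * ((1 / c * x) powr s / ((1 / c * x)\<^sup>2 + 1))) (c * ?B)"
    using has_bochner_integral_powr_over_square[OF s] c
    by (subst (asm) lborel_has_bochner_integral_real_affine_iff[of "1 / c" _ _ 0]) (auto simp: field_simps)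
  hence "has_bochner_integral lborel (\<lambda>x. c powr (s - 2) * (indicator {0<..} (1 / c * x) * ((1 / c * x) powr s / ((1 / c * x)\<^sup>2 + 1)))) (c powr (s - 2) * (c * ?B))"
    by (intro has_bochner_integral_mult_right)
  also have "(\<lambda>x. c powr (s - 2) * (indicator {0<..} (1 / c * x) * ((1 / c * x) powr s / ((1 / c * x)\<^sup>2 + 1))))
     = (\<lambda>x. indicator {0<..} x * (x powr s / (x\<^sup>2 + c\<^sup>2)))"
  proof
    fix x :: real
    show "c powr (s - 2) * (indicator {0<..} (1 / c * x) * ((1 / c * x) powr s / ((1 / c * x)\<^sup>2 + 1)))
     = indicator {0<..} x * (x powr s / (x\<^sup>2 + c\<^sup>2))"
    proof (cases "x > 0")
      case True
      have pos: "x\<^sup>2 + c\<^sup>2 > 0" using c by (simp add: add_nonneg_pos)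
      have "(1 / c * x) powr s = x powr s / c powr s" using c True by (simp add: powr_divide)
      moreover have "(1 / c * x)\<^sup>2 + 1 = (x\<^sup>2 + c\<^sup>2) / c\<^sup>2" using c by (simp add: field_simps power2_eq_square)
      moreover have "c powr (s - 2) = c powr s / c\<^sup>2" using c by (simp add: powr_diff)
      ultimately show ?thesis using c True pos by simp
    next
      case False
      hence "\<not> (1 / c * x > 0)" using c by (simp add: zero_less_divide_iff)
      thus ?thesis using False by (simp add: indicator_def)
    qed
  qed
  also have "c powr (s - 2) * (c * ?B) = c powr (s - 1) * ?B"
  proof -
    have "c powr (s - 2) * c = c powr (s - 1)" using c powr_add[of c "s - 2" 1] by simp
    thus ?thesis by (simp only: mult.assoc[symmetric])
  qed
  finally show ?thesis .
qed

text \<open>Each partial fraction contributes a scaled copy of the previous integral with c = 2 pi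
  n. The powers of n add up to the Dirichlet series at 1 - s, which converges since s < 0.\<close>

lemma has_bochner_integral_mellin_strip:
  assumes s: "-1 < s" "s < (0::real)"
  shows "has_bochner_integral lborel (\<lambda>x. indicator {0<..} x * (x powr (s - 1) * (1 / (exp x - 1) - 1 / x + 1 / 2)))
    (pi / cos (pi * s / 2) * (2 * pi) powr (s - 1) * (\<Sum>n. real (Suc n) powr (- (1 - s))))"
proof -
  define \<kappa> where "\<kappa> = pi / (2 * cos (pi * s / 2))"
  define f where "f = (\<lambda>n x. 2 * (indicator {0<..} x * (x powr s / (x\<^sup>2 + (2 * pi * real (Suc n))\<^sup>2))))"
  have val: "2 * ((2 * pi * real (Suc n)) powr (s - 1) * \<kappa>) = 2 * \<kappa> * (2 * pi) powr (s - 1) * real (Suc n) powr (- (1 - s))" for n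
    by (simp add: powr_mult)
  have f: "has_bochner_integral lborel (f n) (2 * \<kappa> * (2 * pi) powr (s - 1) * real (Suc n) powr (- (1 - s)))" for n
    unfolding f_def \<kappa>_def val[of n, symmetric, unfolded \<kappa>_def]
    by (intro has_bochner_integral_mult_right has_bochner_integral_powr_over_square_scaled) (use s in auto)
  have f_nonneg: "f n x \<ge> 0" for n x by (simp add: f_def)
  have sums: "(\<lambda>n. f n x) sums (indicator {0<..} x * (x powr (s - 1) * (1 / (exp x - 1) - 1 / x + 1 / 2)))" for x
  proof (cases "x > 0")
    case True
    have "x powr (s - 1) * (2 * x / (x\<^sup>2 + (2 * pi * real (Suc n))\<^sup>2)) = f n x" for n
      using True by (simp add: f_def powr_diff)
    thus ?thesis using sums_mult[OF exp_partial_fractions[OF True], of "x powr (s - 1)"] True by simp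
  qed (auto simp: f_def)
  have int: "integrable lborel (f n)" "(\<integral>x. norm (f n x) \<partial>lborel) = 2 * \<kappa> * (2 * pi) powr (s - 1) * real (Suc n) powr (- (1 - s))" for n
    using f[of n] f_nonneg by (simp_all add: has_bochner_integral_iff)
  have summ0: "summable (\<lambda>n. real (Suc n) powr (- (1 - s)))" using s by (intro summable_Suc_powr) auto
  have summ: "summable (\<lambda>n. \<integral>x. norm (f n x) \<partial>lborel)"
    unfolding int(2) by (intro summable_mult summ0)
  have ae: "AE x in lborel. summable (\<lambda>n. norm (f n x))"
    using sums f_nonneg by (intro AE_I2) (simp add: sums_iff)
  have "(\<integral>x. (\<Sum>n. f n x) \<partial>lborel) = (\<Sum>n. \<integral>x. f n x \<partial>lborel)"
    by (rule integral_suminf[OF int(1) ae summ])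
  also have "\<dots> = (\<Sum>n. 2 * \<kappa> * (2 * pi) powr (s - 1) * real (Suc n) powr (- (1 - s)))"
    using f by (simp add: has_bochner_integral_iff)
  also have "\<dots> = 2 * \<kappa> * (2 * pi) powr (s - 1) * (\<Sum>n. real (Suc n) powr (- (1 - s)))"
    by (rule suminf_mult[OF summ0])
  finally have "(\<integral>x. (\<Sum>n. f n x) \<partial>lborel) = pi / cos (pi * s / 2) * (2 * pi) powr (s - 1) * (\<Sum>n. real (Suc n) powr (- (1 - s)))"
    by (simp add: \<kappa>_def)
  moreover have "integrable lborel (\<lambda>x. \<Sum>n. f n x)" by (rule integrable_suminf[OF int(1) ae summ])
  moreover have "(\<lambda>x. \<Sum>n. f n x) = (\<lambda>x. indicator {0<..} x * (x powr (s - 1) * (1 / (exp x - 1) - 1 / x + 1 / 2)))"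
    using sums by (simp add: sums_iff fun_eq_iff)
  ultimately show ?thesis by (simp add: has_bochner_integral_iff)
qed

text \<open>The same integral by the Bernoulli series. On (0, 1] the extra terms -1 / x + 1 / 2
  remove the first two summands, and on [1, oo) they integrate to 1 / (s - 1) and -1 / (2 s), which
  are exactly the two missing fractions of \<open>Gamma_zeta_cont\<close>.\<close>

lemma Gamma_zeta_strip:
  assumes s: "-1 < s" "s < (0::real)"
  shows "has_bochner_integral lborel (\<lambda>x. indicator {0<..} x *\<^sub>R complex_of_real (x powr (s - 1) * (1 / (exp x - 1) - 1 / x + 1 / 2)))
    (Gamma (of_real s) * zeta (of_real s))"
proof -
  let ?I = "\<lambda>x. x powr (s - 1) * (1 / (exp x - 1) - 1 / x + 1 / 2) :: real"
  \<comment> \<open>The powers with exponents s - 2 and s - 1 are not integrable at 0 when s < 0, so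
    two terms have to go.\<close>
  have K: "real 2 + s > 1" using s by simp
  have sums: "(\<lambda>k. bern_coeff (k + 2) * of_real (x powr (real (k + 2) + s - 2))) sums complex_of_real (?I x)"
    if "0 < x" "x \<le> 1" for x
  proof -
    have "(\<lambda>k. bern_coeff (k + 2) * of_real (x powr (real (k + 2) + s - 2))) sums
      (complex_of_real (x powr (s - 1) / (exp x - 1)) - (\<Sum>k<2. bern_coeff k * of_real (x powr (real k + s - 2))))"
      by (rule sums_split_initial_segment[OF bern_coeff_powr_sums[OF that]])
    also have "(\<Sum>k<2. bern_coeff k * of_real (x powr (real k + s - 2))) = complex_of_real (x powr (s - 1) / x - x powr (s - 1) / 2)"
    proof -
      have "x powr (s - 2) = x powr (s - 1) / x" using that powr_diff[of x "s - 1" 1] by simp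
      moreover have "1 + s - 2 = s - 1" by simp
      ultimately show ?thesis by (simp add: numeral_2_eq_2)
    qed
    also have "complex_of_real (x powr (s - 1) / (exp x - 1)) - complex_of_real (x powr (s - 1) / x - x powr (s - 1) / 2) = complex_of_real (?I x)"
      unfolding of_real_diff[symmetric] by (simp add: algebra_simps)
    finally show ?thesis .
  qed
  have B: "has_bochner_integral lborel (\<lambda>x. indicator {0<..1} x *\<^sub>R complex_of_real (?I x)) (\<Sum>k. bern_coeff (k + 2) / of_real (real (k + 2) + s - 1))"
    by (rule integral_unit_bern_coeff(1)[OF K sums])
  have C1: "has_bochner_integral lborel (\<lambda>x. indicator {1..} x *\<^sub>R complex_of_real (x powr (s - 1) / (exp x - 1))) (mellin_tail (of_real s))"
  proof -
    have "(\<lambda>x. indicator {1..} x *\<^sub>R (of_real x powr (of_real s - 1) / of_real (exp x - 1) :: complex)) =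
        (\<lambda>x. indicator {1..} x *\<^sub>R complex_of_real (x powr (s - 1) / (exp x - 1)))"
      by (auto simp: fun_eq_iff indicator_def powr_of_real[symmetric])
    thus ?thesis using mellin_tail_integrable[of "of_real s"]
      by (simp add: has_bochner_integral_iff mellin_tail_def)
  qed
  have pw: "has_bochner_integral lborel (\<lambda>x. indicator {1..} x *\<^sub>R complex_of_real (x powr e)) (complex_of_real (- 1 / (e + 1)))"
    if "e < -1" for e
  proof -
    have "has_bochner_integral lborel (\<lambda>x. indicator {1..} x * x powr e) (- (1 powr (e + 1)) / (e + 1))"
      using that by (intro has_bochner_integral_lborel_nonneg has_integral_powr_to_inf) auto
    from has_bochner_integral_of_real[OF this, where 'a=complex] show ?thesis
      by (simp add: scaleR_conv_of_real)
  qed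
  have C: "has_bochner_integral lborel (\<lambda>x. indicator {1..} x *\<^sub>R complex_of_real (?I x)) (mellin_tail (of_real s) - complex_of_real (- 1 / (s - 2 + 1)) + complex_of_real (- 1 / (s - 1 + 1)) / 2)"
  proof -
    have "has_bochner_integral lborel (\<lambda>x. indicator {1..} x *\<^sub>R complex_of_real (x powr (s - 1) / (exp x - 1)) - indicator {1..} x *\<^sub>R complex_of_real (x powr (s - 2)) + indicator {1..} x *\<^sub>R complex_of_real (x powr (s - 1)) / 2)
      (mellin_tail (of_real s) - complex_of_real (- 1 / (s - 2 + 1)) + complex_of_real (- 1 / (s - 1 + 1)) / 2)"
      by (intro has_bochner_integral_add has_bochner_integral_diff C1 has_bochner_integral_divide_zero pw) (use s in auto)
    also have "(\<lambda>x. indicator {1..} x *\<^sub>R complex_of_real (x powr (s - 1) / (exp x - 1)) - indicator {1..} x *\<^sub>R complex_of_real (x powr (s - 2)) + indicator {1..} x *\<^sub>R complex_of_real (x powr (s - 1)) / 2)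
       = (\<lambda>x. indicator {1..} x *\<^sub>R complex_of_real (?I x))"
    proof
      fix x :: real
      show "indicator {1..} x *\<^sub>R complex_of_real (x powr (s - 1) / (exp x - 1)) - indicator {1..} x *\<^sub>R complex_of_real (x powr (s - 2)) + indicator {1..} x *\<^sub>R complex_of_real (x powr (s - 1)) / 2 = indicator {1..} x *\<^sub>R complex_of_real (?I x)"
      proof (cases "x \<ge> 1")
        case True
        hence "x powr (s - 2) = x powr (s - 1) / x" using powr_diff[of x "s - 1" 1] by simp
        thus ?thesis using True by (simp add: algebra_simps)
      qed simp
    qed
    finally show ?thesis .
  qed
  have A: "has_bochner_integral lborel (\<lambda>x. indicator {0<..} x * (?I x)) (pi / cos (pi * s / 2) * (2 * pi) powr (s - 1) * (\<Sum>n. real (Suc n) powr (- (1 - s))))"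
    by (rule has_bochner_integral_mellin_strip[OF s])
  have A': "integrable lborel (\<lambda>x. indicator {0<..} x *\<^sub>R complex_of_real (?I x))"
    using has_bochner_integral_of_real[OF A, where 'a=complex] by (simp add: scaleR_conv_of_real has_bochner_integral_iff)
  have "AE x in lborel. indicator {0<..1} x *\<^sub>R complex_of_real (?I x) + indicator {1..} x *\<^sub>R complex_of_real (?I x) = indicator {0<..} x *\<^sub>R complex_of_real (?I x)"
    using AE_lborel_singleton[of "1::real"] by eventually_elim (auto simp: indicator_def)
  moreover have BC: "has_bochner_integral lborel (\<lambda>x. indicator {0<..1} x *\<^sub>R complex_of_real (?I x) + indicator {1..} x *\<^sub>R complex_of_real (?I x))
     ((\<Sum>k. bern_coeff (k + 2) / of_real (real (k + 2) + s - 1)) + (mellin_tail (of_real s) - complex_of_real (- 1 / (s - 2 + 1)) + complex_of_real (- 1 / (s - 1 + 1)) / 2))"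
    by (rule has_bochner_integral_add[OF B C])
  ultimately have "has_bochner_integral lborel (\<lambda>x. indicator {0<..} x *\<^sub>R complex_of_real (?I x))
     ((\<Sum>k. bern_coeff (k + 2) / of_real (real (k + 2) + s - 1)) + (mellin_tail (of_real s) - complex_of_real (- 1 / (s - 2 + 1)) + complex_of_real (- 1 / (s - 1 + 1)) / 2))"
    using A' by (subst (asm) has_bochner_integral_cong_AE) (auto simp: has_bochner_integral_iff)
  moreover have "(\<Sum>k. bern_coeff (k + 2) / of_real (real (k + 2) + s - 1)) + (mellin_tail (of_real s) - complex_of_real (- 1 / (s - 2 + 1)) + complex_of_real (- 1 / (s - 1 + 1)) / 2)
     = Gamma (of_real s) * zeta (of_real s)"
  proof -
    have ns: "complex_of_real s \<notin> \<int>\<^sub>\<le>\<^sub>0" using s by (auto simp: nonpos_Ints_def complex_eq_iff)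
    have n1: "complex_of_real s \<noteq> 1" using s by (auto simp: complex_eq_iff)
    note Gz = Gamma_zeta_cont[OF n1 ns]
    have "(\<Sum>k. bern_coeff (Suc k) / (of_real s + of_nat k)) = bern_coeff (Suc 0) / (of_real s + of_nat 0) + (\<Sum>k. bern_coeff (Suc (Suc k)) / (of_real s + of_nat (Suc k)))"
      using suminf_split_head[OF Gz(2)] by simp
    also have "(\<lambda>k. bern_coeff (Suc (Suc k)) / (of_real s + of_nat (Suc k))) = (\<lambda>k. bern_coeff (k + 2) / of_real (real (k + 2) + s - 1))"
      by (simp add: fun_eq_iff add_ac)
    finally have S: "(\<Sum>k. bern_coeff (Suc k) / (of_real s + of_nat k)) = bern_coeff (Suc 0) / (of_real s + of_nat 0) + (\<Sum>k. bern_coeff (k + 2) / of_real (real (k + 2) + s - 1))" .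
    have e1: "complex_of_real (- 1 / (s - 2 + 1)) = - (1 / (of_real s - 1))"
    proof -
      have "s - 2 + 1 = s - 1" by simp
      thus ?thesis by (simp only: of_real_divide of_real_diff of_real_1 of_real_minus minus_divide_left)
    qed
    have e2: "complex_of_real (- 1 / (s - 1 + 1)) / 2 = bern_coeff (Suc 0) / (of_real s + of_nat 0)"
      by simp
    show ?thesis unfolding e1 e2 zeta_eq Gz(1) S by simp
  qed
  ultimately show ?thesis by simp
qed

text \<open>The two evaluations of one integral are equated; the cosine in the denominator is
  positive on -1 < s < 0.\<close>

lemma zeta_functional_real:
  assumes s: "-1 < s" "s < (0::real)"
  shows "zeta (1 - of_real s) = 2 * of_real (2 * pi) powr (- of_real s) * cos (of_real pi * of_real s / 2) * Gamma (of_real s) * zeta (of_real s)"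
proof -
  let ?I = "\<lambda>x. x powr (s - 1) * (1 / (exp x - 1) - 1 / x + 1 / 2) :: real"
  let ?S = "\<Sum>n. real (Suc n) powr (- (1 - s))"
  have summ: "summable (\<lambda>n. real (Suc n) powr (- (1 - s)))" using s by (intro summable_Suc_powr) auto
  have "zeta (1 - of_real s) = of_real ?S"
  proof -
    have "complex_of_real (real (Suc n) powr (- (1 - s))) = 1 / of_nat (Suc n) powr (1 - of_real s)" for n
      using powr_of_real[of "real (Suc n)" "1 - s"] by (simp add: powr_minus_divide del: of_nat_Suc minus_diff_eq)
    moreover have "(\<lambda>n. complex_of_real (real (Suc n) powr (- (1 - s)))) sums of_real ?S"
      using summ by (intro sums_of_real summable_sums)
    ultimately have "(\<lambda>n. 1 / of_nat (Suc n) powr (1 - of_real s)) sums complex_of_real ?S" by (simp only:)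
    moreover have "(\<lambda>n. 1 / of_nat (Suc n) powr (1 - of_real s)) sums zeta (1 - of_real s)"
      using s by (intro zeta_sums) simp
    ultimately show ?thesis by (rule sums_unique2[symmetric])
  qed
  also have "complex_of_real ?S = of_real (2 * (2 * pi) powr (- s) * cos (pi * s / 2) * (pi / cos (pi * s / 2) * (2 * pi) powr (s - 1) * ?S))"
  proof -
    have "pi * (-1) < pi * s" using s by (intro mult_strict_left_mono) auto
    hence "cos (pi * s / 2) > 0" using mult_pos_neg[OF pi_gt_zero s(2)] by (intro cos_gt_zero_pi) linarith+
    note pos = this
    have "(2 * pi) powr (- s) * (2 * pi) powr (s - 1) = 1 / (2 * pi)"
      by (subst powr_add[symmetric]) (simp add: powr_minus_divide)
    hence "2 * pi * ((2 * pi) powr (- s) * (2 * pi) powr (s - 1)) = 1" by simp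
    hence key: "(2 * (2 * pi) powr (- s) * c) * (pi / c * (2 * pi) powr (s - 1) * x) = x" if "c \<noteq> 0" for c x :: real
    proof -
      have "(2 * (2 * pi) powr (- s) * c) * (pi / c * (2 * pi) powr (s - 1) * x)
        = (2 * pi * ((2 * pi) powr (- s) * (2 * pi) powr (s - 1))) * x * (c / c)"
        by (simp only: times_divide_eq_left times_divide_eq_right mult_ac)
      thus ?thesis using that \<open>2 * pi * _ = 1\<close> by simp
    qed
    have nz: "cos (pi * s / 2) \<noteq> 0" using pos by simp
    show ?thesis by (rule arg_cong[where f=complex_of_real, OF key[OF nz, symmetric]])
  qed
  also have "\<dots> = complex_of_real (2 * (2 * pi) powr (- s) * cos (pi * s / 2)) * complex_of_real (pi / cos (pi * s / 2) * (2 * pi) powr (s - 1) * ?S)"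
    by (simp only: of_real_mult)
  also have "complex_of_real (pi / cos (pi * s / 2) * (2 * pi) powr (s - 1) * ?S) = Gamma (of_real s) * zeta (of_real s)"
    using has_bochner_integral_eq[OF Gamma_zeta_strip[OF s]] has_bochner_integral_of_real[OF has_bochner_integral_mellin_strip[OF s], where 'a=complex]
    by (simp add: scaleR_conv_of_real)
  also have "complex_of_real (2 * (2 * pi) powr (- s) * cos (pi * s / 2)) = 2 * of_real (2 * pi) powr (- of_real s) * cos (of_real pi * of_real s / 2)"
    using powr_of_real[of "2 * pi" "- s"] by (simp add: cos_of_real[symmetric])
  finally show ?thesis by (simp only: mult.assoc)
qed

text \<open>Both sides are holomorphic off the closed countable set of poles, whose complement is
  connected, so agreement on a real segment suffices.\<close>

theorem zeta_functional:
  assumes "s \<notin> \<int>\<^sub>\<le>\<^sub>0" "s \<noteq> 1"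
  shows "zeta (1 - s) = 2 * of_real (2 * pi) powr (- s) * cos (of_real pi * s / 2) * Gamma s * zeta s"
proof -
  define D where "D = (\<lambda>s. zeta (1 - s) - 2 * of_real (2 * pi) powr (- s) * cos (of_real pi * s / 2) * Gamma s * zeta s)"
  define X where "X = insert 1 (\<int>\<^sub>\<le>\<^sub>0 :: complex set)"
  have X0: "0 \<in> X" by (simp add: X_def)
  have cX: "closed X" unfolding X_def by (intro closed_insert closed_nonpos_Ints)
  have "D s = 0"
  proof (rule analytic_continuation[of D "- X" "of_real ` {-1<..<0}" "of_real (-1/2)"])
    show "open (- X)" using cX by (simp add: open_Compl)
    show "connected (- X)"
    proof -
      have "countable X" unfolding X_def nonpos_Ints_def by (auto intro: countable_subset[OF _ countable_int])
      hence "connected (UNIV - X)" by (intro connected_open_diff_countable) auto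
      thus ?thesis by (simp add: Compl_eq_Diff_UNIV)
    qed
    show "D holomorphic_on - X" unfolding D_def
      by (intro holomorphic_intros) (auto simp: X_def)
    show "of_real ` {-1<..<0} \<subseteq> - X"
      by (auto simp: X_def nonpos_Ints_def complex_eq_iff)
    have "- (1/2) \<noteq> real_of_int n" for n
    proof
      assume "- (1/2) = real_of_int n"
      hence "real_of_int (2 * n) = real_of_int (-1)" by simp
      hence "2 * n = -1" by (simp only: of_int_eq_iff)
      thus False by presburger
    qed
    thus "complex_of_real (-1/2) \<in> - X"
      by (auto simp: X_def nonpos_Ints_def complex_eq_iff)
    show "complex_of_real (-1/2) islimpt of_real ` {-1<..<0}"
      unfolding islimpt_approachable
    proof (intro allI impI)
      fix e :: real assume e: "e > 0"
      define d where "d = min (e/2) (1/4)"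
      have d: "0 < d" "d < 1/2" "d < e" using e by (auto simp: d_def)
      have "dist (complex_of_real (-1/2 + d)) (of_real (-1/2)) = d"
        using d by (simp only: dist_of_real) (simp add: dist_real_def)
      thus "\<exists>x'\<in>of_real ` {-1<..<0}. x' \<noteq> complex_of_real (-1/2) \<and> dist x' (of_real (-1/2)) < e"
        using d by (intro bexI[of _ "of_real (-1/2 + d)"] imageI) (simp_all only: of_real_eq_iff, simp_all)
    qed
    show "D z = 0" if "z \<in> of_real ` {-1<..<0}" for z
      using that zeta_functional_real by (auto simp: D_def)
    show "s \<in> - X" using assms by (simp add: X_def)
  qed
  thus ?thesis by (simp add: D_def)
qed

text \<open>The cosine in the functional equation vanishes at odd multiples of pi / 2, while Gamma
  and zeta stay finite there.\<close>

lemma zeta_even_neg [simp]: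
  assumes "n > 0"
  shows "zeta (- of_nat (2 * n)) = 0"
proof -
  have "zeta (1 - of_nat (2 * n + 1)) = 2 * of_real (2 * pi) powr (- of_nat (2 * n + 1)) * cos (of_real pi * of_nat (2 * n + 1) / 2) * Gamma (of_nat (2 * n + 1)) * zeta (of_nat (2 * n + 1))"
  proof (rule zeta_functional)
    show "(of_nat (2 * n + 1) :: complex) \<notin> \<int>\<^sub>\<le>\<^sub>0" by (rule Re_pos_not_nonpos_Int) simp
    show "of_nat (2 * n + 1) \<noteq> (1 :: complex)" using assms by (simp only: of_nat_eq_1_iff)
  qed
  moreover have "cos (of_real pi * of_nat (2 * n + 1) / 2 :: complex) = 0"
  proof -
    have "of_real pi * of_nat (2 * n + 1) / 2 = complex_of_real (real n * pi + pi / 2)" by (simp add: field_simps)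
    thus ?thesis by (simp only: cos_of_real cos_add) simp
  qed
  moreover have "1 - of_nat (2 * n + 1) = (- of_nat (2 * n) :: complex)" by simp
  ultimately show ?thesis by simp
qed

text \<open>Read off from the trivial zeros, as zeta at a negative even integer is a nonzero
  multiple of the coefficient.\<close>

lemma bern_coeff_odd: "n > 0 \<Longrightarrow> bern_coeff (Suc (2 * n)) = 0"
  using zeta_even_neg[of n] zeta_minus_of_nat[of "2 * n"] by simp

section \<open>Exponential growth in vertical strips\<close>

text \<open>Exponential rate at most \<open>k\<close> in |Im s|, uniformly in the strip. The
  arbitrary e > 0 absorbs polynomial factors, so that rates simply add under multiplication, and
  \<open>T\<close> cuts away poles of bounded height.\<close>

definition strip_growth :: "real \<Rightarrow> (complex \<Rightarrow> complex) \<Rightarrow> real \<Rightarrow> real \<Rightarrow> bool" where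
  "strip_growth k f A B \<longleftrightarrow> (\<forall>e>0. \<exists>C T. \<forall>s. A \<le> Re s \<and> Re s \<le> B \<and> \<bar>Im s\<bar> \<ge> T \<longrightarrow>
      norm (f s) \<le> C * exp ((k + e) * \<bar>Im s\<bar>))"

lemma strip_growthI:
  assumes "\<And>e. e > 0 \<Longrightarrow> \<exists>C T. \<forall>s. A \<le> Re s \<and> Re s \<le> B \<and> \<bar>Im s\<bar> \<ge> T \<longrightarrow> norm (f s) \<le> C * exp ((k + e) * \<bar>Im s\<bar>)"
  shows "strip_growth k f A B"
  using assms by (simp add: strip_growth_def)

lemma strip_growthE:
  assumes "strip_growth k f A B" "e > 0"
  obtains C T where "C \<ge> 0" "\<And>s. A \<le> Re s \<Longrightarrow> Re s \<le> B \<Longrightarrow> \<bar>Im s\<bar> \<ge> T \<Longrightarrow> norm (f s) \<le> C * exp ((k + e) * \<bar>Im s\<bar>)"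
proof -
  obtain C T where *: "\<forall>s. A \<le> Re s \<and> Re s \<le> B \<and> \<bar>Im s\<bar> \<ge> T \<longrightarrow> norm (f s) \<le> C * exp ((k + e) * \<bar>Im s\<bar>)"
    using assms unfolding strip_growth_def by metis
  have "norm (f s) \<le> \<bar>C\<bar> * exp ((k + e) * \<bar>Im s\<bar>)" if "A \<le> Re s" "Re s \<le> B" "\<bar>Im s\<bar> \<ge> T" for s
  proof -
    have "norm (f s) \<le> C * exp ((k + e) * \<bar>Im s\<bar>)" using * that by blast
    also have "\<dots> \<le> \<bar>C\<bar> * exp ((k + e) * \<bar>Im s\<bar>)" by (intro mult_right_mono) auto
    finally show ?thesis .
  qed
  thus ?thesis by (rule that[OF abs_ge_zero])
qed

lemma strip_growth_mult:
  assumes "strip_growth k f A B" "strip_growth l g A B"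
  shows "strip_growth (k + l) (\<lambda>s. f s * g s) A B"
proof (rule strip_growthI)
  fix e :: real assume e: "e > 0"
  obtain C1 T1 where 1: "C1 \<ge> 0" "\<And>s. A \<le> Re s \<Longrightarrow> Re s \<le> B \<Longrightarrow> \<bar>Im s\<bar> \<ge> T1 \<Longrightarrow> norm (f s) \<le> C1 * exp ((k + e/2) * \<bar>Im s\<bar>)"
    using strip_growthE[OF assms(1), of "e/2"] e by auto
  obtain C2 T2 where 2: "C2 \<ge> 0" "\<And>s. A \<le> Re s \<Longrightarrow> Re s \<le> B \<Longrightarrow> \<bar>Im s\<bar> \<ge> T2 \<Longrightarrow> norm (g s) \<le> C2 * exp ((l + e/2) * \<bar>Im s\<bar>)"
    using strip_growthE[OF assms(2), of "e/2"] e by auto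
  have "norm (f s * g s) \<le> (C1 * C2) * exp ((k + l + e) * \<bar>Im s\<bar>)"
    if "A \<le> Re s" "Re s \<le> B" "\<bar>Im s\<bar> \<ge> max T1 T2" for s
  proof -
    have "norm (f s * g s) \<le> (C1 * exp ((k + e/2) * \<bar>Im s\<bar>)) * (C2 * exp ((l + e/2) * \<bar>Im s\<bar>))"
      unfolding norm_mult using that 1(1) by (intro mult_mono 1(2) 2(2)) auto
    also have "\<dots> = (C1 * C2) * (exp ((k + e/2) * \<bar>Im s\<bar>) * exp ((l + e/2) * \<bar>Im s\<bar>))" by simp
    also have "exp ((k + e/2) * \<bar>Im s\<bar>) * exp ((l + e/2) * \<bar>Im s\<bar>) = exp ((k + l + e) * \<bar>Im s\<bar>)"
      by (simp add: field_simps flip: exp_add)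
    finally show ?thesis .
  qed
  thus "\<exists>C T. \<forall>s. A \<le> Re s \<and> Re s \<le> B \<and> \<bar>Im s\<bar> \<ge> T \<longrightarrow> norm (f s * g s) \<le> C * exp ((k + l + e) * \<bar>Im s\<bar>)"
    by blast
qed

lemma strip_growth_subset:
  assumes "strip_growth k f A B" "A \<le> A'" "B' \<le> B"
  shows "strip_growth k f A' B'"
  using assms unfolding strip_growth_def by (meson order.trans)

lemma strip_growth_cong:
  assumes "strip_growth k f A B" "\<And>s. A \<le> Re s \<Longrightarrow> Re s \<le> B \<Longrightarrow> \<bar>Im s\<bar> \<ge> K \<Longrightarrow> f s = g s"
  shows "strip_growth k g A B"
proof (rule strip_growthI)
  fix e :: real assume e: "e > 0"
  obtain C T where 1: "C \<ge> 0" "\<And>s. A \<le> Re s \<Longrightarrow> Re s \<le> B \<Longrightarrow> \<bar>Im s\<bar> \<ge> T \<Longrightarrow> norm (f s) \<le> C * exp ((k + e) * \<bar>Im s\<bar>)"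
    using strip_growthE[OF assms(1) e] by auto
  have "norm (g s) \<le> C * exp ((k + e) * \<bar>Im s\<bar>)" if "A \<le> Re s" "Re s \<le> B" "\<bar>Im s\<bar> \<ge> max T K" for s
    using 1(2)[of s] assms(2)[of s] that by simp
  thus "\<exists>C T. \<forall>s. A \<le> Re s \<and> Re s \<le> B \<and> \<bar>Im s\<bar> \<ge> T \<longrightarrow> norm (g s) \<le> C * exp ((k + e) * \<bar>Im s\<bar>)"
    by blast
qed

lemma strip_growth_union:
  assumes "strip_growth k f A B" "strip_growth k f B D"
  shows "strip_growth k f A D"
proof (rule strip_growthI)
  fix e :: real assume e: "e > 0"
  obtain C1 T1 where 1: "C1 \<ge> 0" "\<And>s. A \<le> Re s \<Longrightarrow> Re s \<le> B \<Longrightarrow> \<bar>Im s\<bar> \<ge> T1 \<Longrightarrow> norm (f s) \<le> C1 * exp ((k + e) * \<bar>Im s\<bar>)"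
    using strip_growthE[OF assms(1) e] by auto
  obtain C2 T2 where 2: "C2 \<ge> 0" "\<And>s. B \<le> Re s \<Longrightarrow> Re s \<le> D \<Longrightarrow> \<bar>Im s\<bar> \<ge> T2 \<Longrightarrow> norm (f s) \<le> C2 * exp ((k + e) * \<bar>Im s\<bar>)"
    using strip_growthE[OF assms(2) e] by auto
  have "norm (f s) \<le> (C1 + C2) * exp ((k + e) * \<bar>Im s\<bar>)"
    if s: "A \<le> Re s" "Re s \<le> D" "\<bar>Im s\<bar> \<ge> max T1 T2" for s
  proof -
    have "norm (f s) \<le> C1 * exp ((k + e) * \<bar>Im s\<bar>) \<or> norm (f s) \<le> C2 * exp ((k + e) * \<bar>Im s\<bar>)"
      using 1(2)[of s] 2(2)[of s] s by linarith
    moreover have "C1 * exp ((k + e) * \<bar>Im s\<bar>) \<ge> 0" "C2 * exp ((k + e) * \<bar>Im s\<bar>) \<ge> 0" using 1(1) 2(1) by auto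
    ultimately show ?thesis unfolding distrib_right by linarith
  qed
  thus "\<exists>C T. \<forall>s. A \<le> Re s \<and> Re s \<le> D \<and> \<bar>Im s\<bar> \<ge> T \<longrightarrow> norm (f s) \<le> C * exp ((k + e) * \<bar>Im s\<bar>)"
    by blast
qed

text \<open>Moving |Im s| by at most \<open>K\<close> costs only the constant factor exp (|k + e|
  K), so translations and reflections keep the rate.\<close>

lemma strip_growth_affine:
  assumes "strip_growth k f A' B'" "\<And>s. A \<le> Re s \<Longrightarrow> Re s \<le> B \<Longrightarrow> A' \<le> Re (g s) \<and> Re (g s) \<le> B'"
    and Im: "\<And>s. \<bar>\<bar>Im (g s)\<bar> - \<bar>Im s\<bar>\<bar> \<le> K"
  shows "strip_growth k (\<lambda>s. f (g s)) A B"
proof (rule strip_growthI)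
  fix e :: real assume e: "e > 0"
  obtain C T where 1: "C \<ge> 0" "\<And>s. A' \<le> Re s \<Longrightarrow> Re s \<le> B' \<Longrightarrow> \<bar>Im s\<bar> \<ge> T \<Longrightarrow> norm (f s) \<le> C * exp ((k + e) * \<bar>Im s\<bar>)"
    using strip_growthE[OF assms(1) e] by auto
  have "norm (f (g s)) \<le> (C * exp (\<bar>k + e\<bar> * K)) * exp ((k + e) * \<bar>Im s\<bar>)"
    if s: "A \<le> Re s" "Re s \<le> B" "\<bar>Im s\<bar> \<ge> T + K" for s
  proof -
    have "norm (f (g s)) \<le> C * exp ((k + e) * \<bar>Im (g s)\<bar>)"
      using assms(2)[OF s(1,2)] Im[of s] s(3) by (intro 1(2)) linarith+
    also have "\<dots> \<le> C * exp (\<bar>k + e\<bar> * K + (k + e) * \<bar>Im s\<bar>)"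
    proof (intro mult_left_mono 1(1))
      have "(k + e) * (\<bar>Im (g s)\<bar> - \<bar>Im s\<bar>) \<le> \<bar>k + e\<bar> * \<bar>\<bar>Im (g s)\<bar> - \<bar>Im s\<bar>\<bar>"
        unfolding abs_mult[symmetric] by (rule abs_ge_self)
      also have "\<dots> \<le> \<bar>k + e\<bar> * K" by (intro mult_left_mono Im) auto
      finally show "exp ((k + e) * \<bar>Im (g s)\<bar>) \<le> exp (\<bar>k + e\<bar> * K + (k + e) * \<bar>Im s\<bar>)"
        by (simp add: algebra_simps)
    qed
    finally show ?thesis by (simp add: exp_add)
  qed
  thus "\<exists>C T. \<forall>s. A \<le> Re s \<and> Re s \<le> B \<and> \<bar>Im s\<bar> \<ge> T \<longrightarrow> norm (f (g s)) \<le> C * exp ((k + e) * \<bar>Im s\<bar>)"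
    by blast
qed

lemma strip_growth_diff_const:
  assumes "strip_growth k f (A - Re a) (B - Re a)"
  shows "strip_growth k (\<lambda>s. f (s - a)) A B"
  by (rule strip_growth_affine[OF assms, where K="\<bar>Im a\<bar>"]) auto

lemma strip_growth_reflect:
  assumes "strip_growth k f (Re a - B) (Re a - A)"
  shows "strip_growth k (\<lambda>s. f (a - s)) A B"
  by (rule strip_growth_affine[OF assms, where K="\<bar>Im a\<bar>"]) auto

lemma norm_powr_complex:
  assumes "w \<noteq> 0"
  shows "norm (w powr s) = norm w powr Re s * exp (- Im (Ln w) * Im s)"
proof -
  have "norm (w powr s) = exp (Re (s * Ln w))" using assms by (simp add: powr_def)
  also have "Re (s * Ln w) = Re s * ln (norm w) + (- Im (Ln w) * Im s)" using assms by simp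
  also have "exp \<dots> = norm w powr Re s * exp (- Im (Ln w) * Im s)"
    unfolding exp_add using assms by (simp add: powr_def)
  finally show ?thesis .
qed

text \<open>The rate is |arg w|; the factor |w| to the power -Re s is bounded because the strip has
  finite width.\<close>

lemma strip_growth_powr:
  assumes "w \<noteq> 0"
  shows "strip_growth \<bar>Im (Ln w)\<bar> (\<lambda>s. w powr (- s)) A B"
proof (rule strip_growthI)
  fix e :: real assume e: "e > 0"
  have "norm (w powr (- s)) \<le> exp ((\<bar>A\<bar> + \<bar>B\<bar>) * \<bar>ln (norm w)\<bar>) * exp ((\<bar>Im (Ln w)\<bar> + e) * \<bar>Im s\<bar>)"
    if s: "A \<le> Re s" "Re s \<le> B" for s
  proof -
    have "\<bar>- Re s * ln (norm w)\<bar> \<le> (\<bar>A\<bar> + \<bar>B\<bar>) * \<bar>ln (norm w)\<bar>"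
      unfolding abs_mult using s by (intro mult_right_mono) auto
    hence "- Re s * ln (norm w) \<le> (\<bar>A\<bar> + \<bar>B\<bar>) * \<bar>ln (norm w)\<bar>" by linarith
    hence 1: "norm w powr Re (- s) \<le> exp ((\<bar>A\<bar> + \<bar>B\<bar>) * \<bar>ln (norm w)\<bar>)"
      using assms by (simp add: powr_def)
    have "- Im (Ln w) * Im (- s) \<le> \<bar>Im (Ln w)\<bar> * \<bar>Im s\<bar>"
      using abs_ge_self[of "Im (Ln w) * Im s"] by (simp add: abs_mult)
    also have "\<dots> \<le> (\<bar>Im (Ln w)\<bar> + e) * \<bar>Im s\<bar>" using e by (intro mult_right_mono) auto
    finally have "exp (- Im (Ln w) * Im (- s)) \<le> exp ((\<bar>Im (Ln w)\<bar> + e) * \<bar>Im s\<bar>)" by simp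
    thus ?thesis unfolding norm_powr_complex[OF assms] using 1 by (intro mult_mono) auto
  qed
  thus "\<exists>C T. \<forall>s. A \<le> Re s \<and> Re s \<le> B \<and> \<bar>Im s\<bar> \<ge> T \<longrightarrow> norm (w powr (- s)) \<le> C * exp ((\<bar>Im (Ln w)\<bar> + e) * \<bar>Im s\<bar>)"
    by blast
qed

lemma norm_cos_le: "norm (cos (z::complex)) \<le> exp \<bar>Im z\<bar>"
proof -
  have "norm (cos z) \<le> (norm (exp (\<i> * z)) + norm (exp (- (\<i> * z)))) / 2"
    unfolding cos_exp_eq norm_divide using norm_triangle_ineq[of "exp (\<i> * z)" "exp (- (\<i> * z))"] by simp
  also have "\<dots> \<le> (exp \<bar>Im z\<bar> + exp \<bar>Im z\<bar>) / 2"
    by (intro divide_right_mono add_mono) simp_all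
  finally show ?thesis by simp
qed

lemma strip_growth_cos: "strip_growth (pi / 2) (\<lambda>s. cos (of_real pi * s / 2)) A B"
proof (rule strip_growthI)
  fix e :: real assume e: "e > 0"
  have "norm (cos (of_real pi * s / 2)) \<le> 1 * exp ((pi / 2 + e) * \<bar>Im s\<bar>)" for s
  proof -
    have "\<bar>Im (of_real pi * s / 2)\<bar> = pi / 2 * \<bar>Im s\<bar>" by (simp add: abs_mult)
    also have "\<dots> \<le> (pi / 2 + e) * \<bar>Im s\<bar>" using e by (intro mult_right_mono) auto
    finally have "exp \<bar>Im (of_real pi * s / 2)\<bar> \<le> exp ((pi / 2 + e) * \<bar>Im s\<bar>)" by (simp only: exp_le_cancel_iff)
    thus ?thesis using norm_cos_le[of "of_real pi * s / 2"] by linarith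
  qed
  thus "\<exists>C T. \<forall>s. A \<le> Re s \<and> Re s \<le> B \<and> \<bar>Im s\<bar> \<ge> T \<longrightarrow> norm (cos (of_real pi * s / 2)) \<le> C * exp ((pi / 2 + e) * \<bar>Im s\<bar>)"
    by blast
qed

subsection \<open>Growth of the Gamma function\<close>

lemma norm_Gamma_half_line: "norm (Gamma (Complex (1/2) t)) \<le> sqrt (2 * pi) * exp (- (pi / 2) * \<bar>t\<bar>)"
proof -
  let ?z = "Complex (1/2) t"
  have c: "1 - ?z = cnj ?z" by (simp add: complex_eq_iff)
  have "Gamma ?z * Gamma (cnj ?z) = of_real pi / sin (of_real pi * ?z)"
    using Gamma_reflection_complex[of ?z] by (simp only: c)
  also have "Gamma (cnj ?z) = cnj (Gamma ?z)" by (simp add: cnj_Gamma)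
  also have "sin (of_real pi * ?z) = of_real (cosh (pi * t))"
  proof -
    have "of_real pi * ?z = of_real pi / 2 + \<i> * of_real (pi * t)" by (simp add: complex_eq_iff)
    hence "sin (of_real pi * ?z) = cos (\<i> * of_real (pi * t))" by (simp only: sin_add) simp
    also have "\<dots> = (exp (of_real (- (pi * t))) + exp (of_real (pi * t))) / 2"
      unfolding cos_exp_eq by (simp add: mult.assoc[symmetric])
    also have "\<dots> = of_real (cosh (pi * t))" by (simp only: exp_of_real cosh_def) simp
    finally show ?thesis .
  qed
  finally have "of_real ((norm (Gamma ?z))\<^sup>2) = complex_of_real (pi / cosh (pi * t))"
    by (simp only: complex_norm_square of_real_divide)
  hence sq: "(norm (Gamma ?z))\<^sup>2 = pi / cosh (pi * t)" by (simp only: of_real_eq_iff)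
  have "exp (pi * \<bar>t\<bar>) / 2 \<le> cosh (pi * t)"
    by (cases "t \<ge> 0") (auto simp: cosh_def)
  hence "pi / cosh (pi * t) \<le> pi / (exp (pi * \<bar>t\<bar>) / 2)" by (intro divide_left_mono mult_pos_pos) auto
  also have "\<dots> = (sqrt (2 * pi) * exp (- (pi / 2) * \<bar>t\<bar>))\<^sup>2"
    by (simp add: power_mult_distrib exp_minus field_simps flip: exp_double)
  finally show ?thesis unfolding sq[symmetric] by (rule power2_le_imp_le) simp
qed

text \<open>In the Gauss product the quotient is a product of factors p / sqrt (p^2 + t^2) with p =
  x + i, and each increases with x. It carries a bound on one vertical line to all positive real
  parts on its left.\<close>

lemma norm_Gamma_quotient_mono:
  assumes "0 < x" "x \<le> y"
  shows "norm (Gamma (Complex x t)) / Gamma x \<le> norm (Gamma (Complex y t)) / Gamma y"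
proof -
  have lim: "(\<lambda>n. norm (Gamma_series (Complex z t) n) / norm (Gamma_series z n)) \<longlonglongrightarrow> norm (Gamma (Complex z t)) / norm (Gamma z)" if "z > 0" for z :: real
    using Gamma_real_pos[OF that] by (intro tendsto_intros Gamma_series_LIMSEQ) simp
  have eq: "norm (Gamma_series (Complex z t) n) / norm (Gamma_series z n) = (\<Prod>i=0..n. norm (z + real i) / norm (Complex z t + of_nat i))"
    if "n > 0" "z > 0" for z :: real and n
  proof -
    have "norm (exp (Complex z t * of_real (ln (of_nat n)))) = norm (exp (z * of_real (ln (of_nat n))))" by simp
    moreover have "norm (pochhammer w (Suc n)) = (\<Prod>i=0..n. norm (w + of_nat i))" for w :: complex
      by (simp only: pochhammer_Suc_prod prod_norm[symmetric] atLeast0AtMost)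
    moreover have "norm (pochhammer w (Suc n)) = (\<Prod>i=0..n. norm (w + of_nat i))" for w :: real
      by (simp only: pochhammer_Suc_prod prod_norm[symmetric] atLeast0AtMost)
    ultimately show ?thesis
      unfolding Gamma_series_def norm_divide norm_mult by (simp add: prod_dividef)
  qed
  have "(\<Prod>i=0..n. norm (x + real i) / norm (Complex x t + of_nat i)) \<le> (\<Prod>i=0..n. norm (y + real i) / norm (Complex y t + of_nat i))" for n
  proof (intro prod_mono conjI)
    fix i
    show "0 \<le> norm (x + real i) / norm (Complex x t + of_nat i)" by simp
    define p q where "p = x + real i" and "q = y + real i"
    have pq: "0 < p" "p \<le> q" using assms by (auto simp: p_def q_def)
    have "p * sqrt (q\<^sup>2 + t\<^sup>2) \<le> q * sqrt (p\<^sup>2 + t\<^sup>2)"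
    proof (rule power2_le_imp_le)
      have "p\<^sup>2 * t\<^sup>2 \<le> q\<^sup>2 * t\<^sup>2" using pq by (intro mult_right_mono power_mono) auto
      thus "(p * sqrt (q\<^sup>2 + t\<^sup>2))\<^sup>2 \<le> (q * sqrt (p\<^sup>2 + t\<^sup>2))\<^sup>2" by (simp add: power_mult_distrib algebra_simps)
    qed (use pq in simp)
    moreover have "sqrt (p\<^sup>2 + t\<^sup>2) > 0" "sqrt (q\<^sup>2 + t\<^sup>2) > 0" using pq by (auto intro!: add_pos_nonneg)
    ultimately have "p / sqrt (p\<^sup>2 + t\<^sup>2) \<le> q / sqrt (q\<^sup>2 + t\<^sup>2)" by (simp add: divide_simps)
    thus "norm (x + real i) / norm (Complex x t + of_nat i) \<le> norm (y + real i) / norm (Complex y t + of_nat i)"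
      using pq by (simp add: cmod_def p_def q_def)
  qed
  note le = this
  have "\<forall>\<^sub>F n in sequentially. norm (Gamma_series (Complex x t) n) / norm (Gamma_series x n) \<le> norm (Gamma_series (Complex y t) n) / norm (Gamma_series y n)"
    using eventually_gt_at_top[of "0::nat"]
  proof eventually_elim
    case (elim n)
    thus ?case using assms le[of n] by (simp only: eq)
  qed
  hence "norm (Gamma (Complex x t)) / norm (Gamma x) \<le> norm (Gamma (Complex y t)) / norm (Gamma y)"
    using assms by (intro tendsto_le[OF _ lim lim]) auto
  thus ?thesis using Gamma_real_pos[of x] Gamma_real_pos[of y] assms by simp
qed

lemma power_le_exp:
  assumes "a \<ge> 0" "e > (0::real)"
  shows "\<exists>C\<ge>0. \<forall>t\<ge>0. (a + t) ^ m \<le> C * exp (e * t)"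
proof -
  \<comment> \<open>Dividing by m + 1 leaves d well defined for m = 0.\<close>
  define d where "d = e / (real m + 1)"
  have d: "d > 0" using assms by (simp add: d_def)
  have "(a + t) ^ m \<le> (a + 1/d) ^ m * exp (e * t)" if t: "t \<ge> 0" for t
  proof -
    have "a \<le> a * exp (d * t)" using assms t d by (auto simp: mult_le_cancel_left1)
    moreover have "t \<le> 1/d * exp (d * t)"
    proof -
      have "d * t \<le> exp (d * t)" using exp_ge_add_one_self[of "d * t"] by linarith
      thus ?thesis using d by (simp add: field_simps)
    qed
    ultimately have "a + t \<le> (a + 1/d) * exp (d * t)" by (simp add: algebra_simps)
    hence "(a + t) ^ m \<le> ((a + 1/d) * exp (d * t)) ^ m" using assms t by (intro power_mono) auto
    also have "\<dots> = (a + 1/d) ^ m * exp (real m * (d * t))" by (simp add: power_mult_distrib exp_of_nat_mult)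
    also have "\<dots> \<le> (a + 1/d) ^ m * exp (e * t)"
    proof (intro mult_left_mono)
      have "real m * (d * t) \<le> (real m + 1) * (d * t)" using d t by (intro mult_right_mono) auto
      also have "\<dots> = e * t" by (simp add: d_def)
      finally show "exp (real m * (d * t)) \<le> exp (e * t)" by simp
    qed (use assms d in auto)
    finally show ?thesis .
  qed
  thus ?thesis using assms d by (intro exI[of _ "(a + 1/d) ^ m"]) auto
qed

lemma norm_Gamma_right_bound:
  assumes "e > 0"
  shows "\<exists>C\<ge>0. \<forall>s. 1/2 \<le> Re s \<and> Re s \<le> B \<longrightarrow> norm (Gamma s) \<le> C * exp ((- (pi / 2) + e) * \<bar>Im s\<bar>)"
proof -
  define m where "m = nat \<lceil>B\<rceil>"
  define y where "y = 1/2 + real m"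
  have y: "y > 0" "B \<le> y" unfolding y_def m_def by linarith+
  have "continuous_on {1/2..y} (Gamma :: real \<Rightarrow> real)"
    by (intro continuous_intros continuous_on_Gamma) (auto simp: nonpos_Ints_def)
  then obtain G where G: "G \<ge> 0" "\<And>x. x \<in> {1/2..y} \<Longrightarrow> norm (Gamma x) \<le> G"
    using continuous_on_compact_norm_bound[OF compact_Icc] by blast
  obtain P where P: "P \<ge> 0" "\<And>t. t \<ge> 0 \<Longrightarrow> (y + t) ^ m \<le> P * exp (e * t)"
    using power_le_exp[of y e m] y assms by auto
  have yline: "norm (Gamma (Complex y t)) \<le> sqrt (2 * pi) * P * exp ((- (pi / 2) + e) * \<bar>t\<bar>)" for t
  proof -
    have "Complex y t = Complex (1/2) t + of_nat m" by (simp add: complex_eq_iff y_def)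
    moreover have "Complex (1/2) t \<notin> \<int>\<^sub>\<le>\<^sub>0" by (rule Re_pos_not_nonpos_Int) simp
    ultimately have "Gamma (Complex y t) = pochhammer (Complex (1/2) t) m * Gamma (Complex (1/2) t)"
      using pochhammer_Gamma[of "Complex (1/2) t" m] by (simp add: Gamma_eq_zero_iff)
    moreover have "norm (pochhammer (Complex (1/2) t) m) \<le> (y + \<bar>t\<bar>) ^ m"
    proof -
      have "norm (pochhammer (Complex (1/2) t) m) = (\<Prod>i=0..<m. norm (Complex (1/2) t + of_nat i))"
        by (simp only: pochhammer_prod prod_norm)
      also have "\<dots> \<le> (\<Prod>i=0..<m. y + \<bar>t\<bar>)"
      proof (intro prod_mono conjI norm_ge_zero)
        fix i assume "i \<in> {0..<m}"
        hence "\<bar>Re (Complex (1/2) t + of_nat i)\<bar> + \<bar>Im (Complex (1/2) t + of_nat i)\<bar> \<le> y + \<bar>t\<bar>" by (simp add: y_def)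
        thus "norm (Complex (1/2) t + of_nat i) \<le> y + \<bar>t\<bar>"
          using cmod_le[of "Complex (1/2) t + of_nat i"] by linarith
      qed
      finally show ?thesis by simp
    qed
    ultimately have "norm (Gamma (Complex y t)) \<le> (P * exp (e * \<bar>t\<bar>)) * (sqrt (2 * pi) * exp (- (pi / 2) * \<bar>t\<bar>))"
      unfolding norm_mult[of "pochhammer _ _"] \<open>Gamma (Complex y t) = _\<close>
      using P(1) P(2)[of "\<bar>t\<bar>"] norm_Gamma_half_line[of t] by (intro mult_mono) auto
    also have "\<dots> = sqrt (2 * pi) * P * (exp (e * \<bar>t\<bar>) * exp (- (pi / 2) * \<bar>t\<bar>))" by simp
    also have "exp (e * \<bar>t\<bar>) * exp (- (pi / 2) * \<bar>t\<bar>) = exp ((- (pi / 2) + e) * \<bar>t\<bar>)"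
      by (simp add: algebra_simps flip: exp_add)
    finally show ?thesis .
  qed
  have "norm (Gamma s) \<le> (G / Gamma y * (sqrt (2 * pi) * P)) * exp ((- (pi / 2) + e) * \<bar>Im s\<bar>)"
    if s: "1/2 \<le> Re s" "Re s \<le> B" for s
  proof -
    have "norm (Gamma s) / Gamma (Re s) \<le> norm (Gamma (Complex y (Im s))) / Gamma y"
      using norm_Gamma_quotient_mono[of "Re s" y "Im s"] s y by simp
    hence "norm (Gamma s) \<le> Gamma (Re s) * (norm (Gamma (Complex y (Im s))) / Gamma y)"
      using Gamma_real_pos[of "Re s"] s by (simp add: field_simps)
    also have "\<dots> \<le> G * ((sqrt (2 * pi) * P * exp ((- (pi / 2) + e) * \<bar>Im s\<bar>)) / Gamma y)"
      using G(2)[of "Re s"] s y Gamma_real_pos[of y] G(1)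
      by (intro mult_mono divide_right_mono yline) (auto simp: abs_le_iff)
    finally show ?thesis by simp
  qed
  moreover have "G / Gamma y * (sqrt (2 * pi) * P) \<ge> 0" using G(1) P(1) Gamma_real_pos[OF y(1)] by simp
  ultimately show ?thesis by blast
qed

text \<open>To reach the left part, shift n steps to the right: for |Im s| >= 1 every factor of the
  Pochhammer product has modulus at least 1, so dividing by it preserves the bound.\<close>

lemma strip_growth_Gamma: "strip_growth (- (pi / 2)) Gamma A B"
proof (rule strip_growthI)
  fix e :: real assume e: "e > 0"
  define n where "n = nat \<lceil>1/2 - A\<rceil>"
  have n: "A + real n \<ge> 1/2" unfolding n_def by linarith
  obtain C where C: "C \<ge> 0" "\<And>s. 1/2 \<le> Re s \<Longrightarrow> Re s \<le> B + real n \<Longrightarrow> norm (Gamma s) \<le> C * exp ((- (pi / 2) + e) * \<bar>Im s\<bar>)"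
    using norm_Gamma_right_bound[OF e, of "B + real n"] by auto
  have "norm (Gamma s) \<le> C * exp ((- (pi / 2) + e) * \<bar>Im s\<bar>)"
    if s: "A \<le> Re s" "Re s \<le> B" "\<bar>Im s\<bar> \<ge> 1" for s
  proof -
    have "s \<notin> \<int>\<^sub>\<le>\<^sub>0" using s(3) by (auto simp: nonpos_Ints_def)
    hence "Gamma (s + of_nat n) = pochhammer s n * Gamma s"
      using pochhammer_Gamma[of s n] by (simp add: Gamma_eq_zero_iff)
    hence "norm (Gamma (s + of_nat n)) = norm (pochhammer s n) * norm (Gamma s)" by (simp add: norm_mult)
    moreover have "norm (pochhammer s n) \<ge> 1"
    proof -
      have "(\<Prod>i=0..<n. 1) \<le> (\<Prod>i=0..<n. norm (s + of_nat i))"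
      proof (intro prod_mono conjI)
        show "1 \<le> norm (s + of_nat i)" for i using abs_Im_le_cmod[of "s + of_nat i"] s(3) by simp
      qed auto
      thus ?thesis by (simp add: pochhammer_prod prod_norm)
    qed
    ultimately have "norm (Gamma s) \<le> norm (Gamma (s + of_nat n))"
      using mult_right_mono[of 1 "norm (pochhammer s n)" "norm (Gamma s)"] by simp
    also have "\<dots> \<le> C * exp ((- (pi / 2) + e) * \<bar>Im (s + of_nat n)\<bar>)" using s n by (intro C(2)) auto
    finally show ?thesis by simp
  qed
  thus "\<exists>C T. \<forall>s. A \<le> Re s \<and> Re s \<le> B \<and> \<bar>Im s\<bar> \<ge> T \<longrightarrow> norm (Gamma s) \<le> C * exp ((- (pi / 2) + e) * \<bar>Im s\<bar>)"
    by blast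
qed

subsection \<open>Growth of the zeta function\<close>

text \<open>With N = Suc n, this is N^(-s) minus the integral of x^(-s) over [N, N + 1].\<close>

definition zeta_term :: "nat \<Rightarrow> complex \<Rightarrow> complex" where
  "zeta_term n s = of_nat (Suc n) powr (- s) - (of_nat (Suc (Suc n)) powr (1 - s) - of_nat (Suc n) powr (1 - s)) / (1 - s)"

text \<open>The mean value inequality is used twice: first for x^(-s), whose derivative is at most
  |s| N^(-Re s - 1) on the segment, then for its primitive.\<close>

lemma norm_zeta_term_le:
  assumes s: "Re s > 0" "s \<noteq> 1"
  shows "norm (zeta_term n s) \<le> norm s * real (Suc n) powr (- (Re s + 1))"
proof -
  define N where "N = real (Suc n)"
  define B where "B = norm s * N powr (- (Re s + 1))"
  define S where "S = closed_segment (complex_of_real N) (of_real (N + 1))"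
  have N: "N \<ge> 1" by (simp add: N_def)
  have S: "\<exists>y. z = of_real y \<and> N \<le> y \<and> y \<le> N + 1" if "z \<in> S" for z
  proof -
    have "Im z = 0" "Re z \<in> closed_segment N (N + 1)"
      using that by (simp_all add: S_def closed_segment_same_Im)
    thus ?thesis by (intro exI[of _ "Re z"]) (auto simp: complex_eq_iff closed_segment_eq_real_ivl)
  qed
  have inS: "complex_of_real N \<in> S" "of_real (N + 1) \<in> S" by (simp_all add: S_def)
  have pos: "z \<notin> \<real>\<^sub>\<le>\<^sub>0" if "z \<in> S" for z using S[OF that] N by auto
  have bound1: "norm (of_real N powr (- s) - z powr (- s)) \<le> B" if z: "z \<in> S" for z
  proof -
    have "norm (of_real N powr (- s) - z powr (- s)) \<le> B * norm (of_real N - z)"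
    proof (rule field_differentiable_bound[where S=S and f="\<lambda>z. z powr (- s)" and f'="\<lambda>z. - s * z powr (- s - 1)"])
      show "convex S" by (simp add: S_def)
      show "((\<lambda>z. z powr - s) has_field_derivative - s * z powr (- s - 1)) (at z within S)" if "z \<in> S" for z
        using has_field_derivative_powr[OF pos[OF that], of "- s"] by (rule has_field_derivative_at_within)
      show "norm (- s * z powr (- s - 1)) \<le> B" if z: "z \<in> S" for z
      proof -
        obtain y where y: "z = of_real y" "N \<le> y" using S[OF z] by auto
        have "norm (- s * z powr (- s - 1)) = norm s * y powr (- (Re s + 1))"
          using y N by (simp add: norm_mult norm_powr_real_powr)
        also have "\<dots> \<le> B" unfolding B_def using y N s by (intro mult_left_mono powr_mono2') auto
        finally show ?thesis .
      qed
    qed (use inS z in auto)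
    moreover have "norm (of_real N - z) \<le> 1"
    proof -
      obtain y where y: "z = of_real y" "N \<le> y" "y \<le> N + 1" using S[OF z] by auto
      have "norm (of_real N - z) = norm (complex_of_real (N - y))" by (simp add: y)
      thus ?thesis using y by (simp only: norm_of_real)
    qed
    hence "B * norm (of_real N - z) \<le> B" by (intro mult_left_le) (simp_all add: B_def)
    ultimately show ?thesis by linarith
  qed
  \<comment> \<open>A primitive of the constant N^(-s) minus z^(-s); its increment over the segment
    is \<open>zeta_term n s\<close>.\<close>
  define h where "h = (\<lambda>z. z * of_real N powr (- s) - z powr (1 - s) / (1 - s))"
  have "norm (h (of_real (N + 1)) - h (of_real N)) \<le> B * norm (complex_of_real (N + 1) - of_real N)"
  proof (rule field_differentiable_bound[where S=S and f=h and f'="\<lambda>z. of_real N powr (- s) - z powr (- s)"])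
    show "convex S" by (simp add: S_def)
    show "(h has_field_derivative of_real N powr (- s) - z powr (- s)) (at z within S)" if "z \<in> S" for z
    proof -
      have "((\<lambda>z. z * of_real N powr (- s)) has_field_derivative of_real N powr (- s)) (at z)"
        by (auto intro!: derivative_eq_intros)
      moreover have "((\<lambda>z. z powr (1 - s) / (1 - s)) has_field_derivative (1 - s) * z powr (1 - s - 1) / (1 - s)) (at z)"
        by (intro DERIV_cdivide has_field_derivative_powr pos[OF that])
      ultimately have "(h has_field_derivative of_real N powr (- s) - (1 - s) * z powr (1 - s - 1) / (1 - s)) (at z)"
        unfolding h_def by (rule DERIV_diff)
      moreover have "(1 - s) * z powr (1 - s - 1) / (1 - s) = z powr (- s)" using s by simp
      ultimately show ?thesis by (simp add: has_field_derivative_at_within)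
    qed
  qed (use inS bound1 in auto)
  also have "norm (complex_of_real (N + 1) - of_real N) = 1" by simp
  also have "h (of_real (N + 1)) - h (of_real N) = zeta_term n s"
    by (simp add: h_def zeta_term_def N_def diff_divide_distrib algebra_simps)
  finally show ?thesis by (simp add: B_def N_def)
qed

text \<open>For Re s > 1 the integrals telescope to 1 / (s - 1). The corrected series still
  converges for Re s > 0, and the identity theorem extends the formula.\<close>

lemma zeta_series_right:
  assumes s: "Re s > 0" "s \<noteq> 1"
  shows "zeta s = 1 / (s - 1) + (\<Sum>n. zeta_term n s)"
proof -
  define X where "X = {s. Re s > 0} - {1 :: complex}"
  have oX: "open X" unfolding X_def by (intro open_Diff open_halfspace_Re_gt) auto
  have cX: "connected X" unfolding X_def
    by (intro connected_open_delete convex_connected convex_halfspace_Re_gt open_halfspace_Re_gt) simp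
  have hol: "(\<lambda>s. \<Sum>n. zeta_term n s) holomorphic_on X"
  proof (rule holomorphic_on_suminf(1)[OF oX])
    show "zeta_term k holomorphic_on X" for k
      unfolding zeta_term_def by (intro holomorphic_intros) (auto simp: X_def)
    fix s0 assume "s0 \<in> X"
    hence s0: "Re s0 > 0" by (simp add: X_def)
    define r where "r = Re s0 / 2"
    have "norm (zeta_term k s) \<le> (norm s0 + r) * real (Suc k) powr (- (r + 1))" if "s \<in> ball s0 r \<inter> X" for k s
    proof -
      have d: "norm (s0 - s) < r" using that by (simp add: dist_norm)
      have "\<bar>Re s0 - Re s\<bar> < r" using d abs_Re_le_cmod[of "s0 - s"] by simp
      hence re: "r < Re s" unfolding r_def by (simp add: abs_if split: if_splits)
      have "norm s \<le> norm s0 + r" using d norm_triangle_ineq2[of s s0] by (simp add: norm_minus_commute)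
      moreover have "real (Suc k) powr (- (Re s + 1)) \<le> real (Suc k) powr (- (r + 1))"
        using re by (intro powr_mono) auto
      ultimately have "norm s * real (Suc k) powr (- (Re s + 1)) \<le> (norm s0 + r) * real (Suc k) powr (- (r + 1))"
        using s0 by (intro mult_mono) (auto simp: r_def)
      moreover have "norm (zeta_term k s) \<le> norm s * real (Suc k) powr (- (Re s + 1))"
        using that by (intro norm_zeta_term_le) (auto simp: X_def)
      ultimately show ?thesis by linarith
    qed
    moreover have "summable (\<lambda>k. (norm s0 + r) * real (Suc k) powr (- (r + 1)))"
      using s0 by (intro summable_mult summable_Suc_powr) (simp add: r_def)
    ultimately show "\<exists>r>0. \<exists>M K. summable M \<and> (\<forall>k\<ge>K. \<forall>s\<in>ball s0 r \<inter> X. norm (zeta_term k s) \<le> M k)"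
      using s0 by (intro exI[of _ r] conjI exI[of _ "\<lambda>k. (norm s0 + r) * real (Suc k) powr (- (r + 1))"] exI[of _ 0] allI impI ballI)
        (auto simp: r_def)
  qed
  have big: "zeta s = 1 / (s - 1) + (\<Sum>n. zeta_term n s)" if s: "Re s > 1" for s
  proof -
    have s1: "s \<noteq> 1" using s by auto
    have "(\<lambda>n. of_nat (Suc n) powr (1 - s)) \<longlonglongrightarrow> (0 :: complex)"
    proof (rule tendsto_norm_zero_cancel)
      have "(\<lambda>n. real (Suc n) powr (1 - Re s)) \<longlonglongrightarrow> 0"
        using s by (intro tendsto_neg_powr filterlim_compose[OF filterlim_real_sequentially filterlim_Suc]) simp
      also have "(\<lambda>n. real (Suc n) powr (1 - Re s)) = (\<lambda>n. norm (of_nat (Suc n) powr (1 - s) :: complex))"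
        using norm_powr_real_powr[of "of_nat (Suc _)" "1 - s"] by (simp add: fun_eq_iff)
      finally show "(\<lambda>n. norm (of_nat (Suc n) powr (1 - s) :: complex)) \<longlonglongrightarrow> 0" .
    qed
    hence "(\<lambda>n. of_nat (Suc (Suc n)) powr (1 - s) - of_nat (Suc n) powr (1 - s)) sums (0 - of_nat (Suc 0) powr (1 - s))"
      by (rule telescope_sums)
    hence "(\<lambda>n. (of_nat (Suc (Suc n)) powr (1 - s) - of_nat (Suc n) powr (1 - s)) / (1 - s)) sums (- 1 / (1 - s))"
      by (intro sums_divide) simp
    moreover have "(\<lambda>n. of_nat (Suc n) powr (- s)) sums zeta s"
      using zeta_sums[OF s] by (simp add: powr_minus_divide)
    ultimately have A: "(\<lambda>n. zeta_term n s) sums (zeta s - (- 1 / (1 - s)))"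
      unfolding zeta_term_def by (intro sums_diff)
    have e: "- 1 / (1 - s) = 1 / (s - 1)"
      by (simp only: minus_divide_divide[of 1 "s - 1", symmetric] minus_diff_eq)
    have "(\<Sum>n. zeta_term n s) = zeta s - 1 / (s - 1)" using sums_unique[OF A] unfolding e by simp
    thus ?thesis by simp
  qed
  have "zeta s - (1 / (s - 1) + (\<Sum>n. zeta_term n s)) = 0"
  proof (rule analytic_continuation[where f="\<lambda>s. zeta s - (1 / (s - 1) + (\<Sum>n. zeta_term n s))" and S=X and U="{s. Re s > 1}" and \<xi>=2])
    show "(\<lambda>s. zeta s - (1 / (s - 1) + (\<Sum>n. zeta_term n s))) holomorphic_on X"
      by (intro holomorphic_intros hol) (auto simp: X_def)
    show "(2::complex) islimpt {s. 1 < Re s}"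
      by (rule interior_limit_point) (simp add: interior_open open_halfspace_Re_gt)
    show "zeta z - (1 / (z - 1) + (\<Sum>n. zeta_term n z)) = 0" if "z \<in> {s. Re s > 1}" for z
      using big[of z] that by simp
  qed (use oX cX s in \<open>auto simp: X_def\<close>)
  thus ?thesis by simp
qed

text \<open>The corrected series is at most a constant times |s|, linear growth being covered by any
  positive rate.\<close>

lemma strip_growth_zeta_right: "strip_growth 0 zeta (1/2) B"
proof (rule strip_growthI)
  fix e :: real assume e: "e > 0"
  define K where "K = (\<Sum>n. real (Suc n) powr (- (3/2)))"
  have summ: "summable (\<lambda>n. real (Suc n) powr (- (3/2)))" by (intro summable_Suc_powr) simp
  have K0: "K \<ge> 0" unfolding K_def by (intro suminf_nonneg summ) simp
  obtain P where P: "P \<ge> 0" "\<And>t. t \<ge> 0 \<Longrightarrow> (\<bar>B\<bar> + t) ^ 1 \<le> P * exp (e * t)"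
    using power_le_exp[of "\<bar>B\<bar>" e 1] e by auto
  have "norm (zeta s) \<le> (1 + P * K) * exp ((0 + e) * \<bar>Im s\<bar>)"
    if s: "1/2 \<le> Re s" "Re s \<le> B" "\<bar>Im s\<bar> \<ge> 1" for s
  proof -
    have s1: "s \<noteq> 1" using s(3) by auto
    have trm: "norm (zeta_term n s) \<le> norm s * real (Suc n) powr (- (3/2))" for n
    proof -
      have "norm (zeta_term n s) \<le> norm s * real (Suc n) powr (- (Re s + 1))"
        using s s1 by (intro norm_zeta_term_le) auto
      also have "\<dots> \<le> norm s * real (Suc n) powr (- (3/2))"
        using s by (intro mult_left_mono powr_mono) auto
      finally show ?thesis .
    qed
    have "norm (\<Sum>n. zeta_term n s) \<le> (\<Sum>n. norm s * real (Suc n) powr (- (3/2)))"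
      using trm summ by (intro norm_suminf_le summable_mult) auto
    also have "\<dots> = norm s * K" unfolding K_def by (rule suminf_mult[OF summ])
    also have "norm s \<le> P * exp (e * \<bar>Im s\<bar>)"
    proof -
      have "norm s \<le> \<bar>B\<bar> + \<bar>Im s\<bar>" using cmod_le[of s] s by linarith
      also have "\<dots> \<le> P * exp (e * \<bar>Im s\<bar>)" using P(2)[of "\<bar>Im s\<bar>"] by simp
      finally show ?thesis .
    qed
    finally have 1: "norm (\<Sum>n. zeta_term n s) \<le> P * exp (e * \<bar>Im s\<bar>) * K"
      using K0 by (simp add: mult_right_mono)
    have "1 \<le> norm (s - 1)" using s(3) abs_Im_le_cmod[of "s - 1"] by simp
    hence "norm (1 / (s - 1)) \<le> 1" by (simp add: norm_divide divide_simps)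
    also have "1 \<le> exp (e * \<bar>Im s\<bar>)" using e by simp
    finally have 2: "norm (1 / (s - 1)) \<le> exp (e * \<bar>Im s\<bar>)" .
    have "zeta s = 1 / (s - 1) + (\<Sum>n. zeta_term n s)" using s s1 by (intro zeta_series_right) auto
    hence "norm (zeta s) \<le> norm (1 / (s - 1)) + norm (\<Sum>n. zeta_term n s)" by (metis norm_triangle_ineq)
    also have "\<dots> \<le> exp (e * \<bar>Im s\<bar>) + P * exp (e * \<bar>Im s\<bar>) * K" by (intro add_mono 1 2)
    also have "\<dots> = (1 + P * K) * exp ((0 + e) * \<bar>Im s\<bar>)" by (simp add: algebra_simps)
    finally show ?thesis .
  qed
  thus "\<exists>C T. \<forall>s. 1/2 \<le> Re s \<and> Re s \<le> B \<and> \<bar>Im s\<bar> \<ge> T \<longrightarrow> norm (zeta s) \<le> C * exp ((0 + e) * \<bar>Im s\<bar>)"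
    by blast
qed

text \<open>Left of 1/2 the functional equation is used: the rate pi/2 of the cosine and -pi/2 of
  Gamma cancel, and the power of 2 pi has rate 0 because its logarithm is real.\<close>

lemma strip_growth_zeta: "strip_growth 0 zeta A B"
proof -
  define A' B' where "A' = min A 0" and "B' = max B 1"
  have "strip_growth 0 zeta A' (1/2)"
  proof -
    have p: "of_real (2 * pi) \<noteq> (0::complex)" by simp
    have "strip_growth (\<bar>Im (Ln (of_real (2 * pi)))\<bar> + pi / 2 + (- (pi / 2)) + 0)
       (\<lambda>s. of_real (2 * pi) powr (- s) * cos (of_real pi * s / 2) * Gamma s * zeta s) (1/2) (1 - A')"
      by (intro strip_growth_mult strip_growth_powr[OF p] strip_growth_cos strip_growth_Gamma strip_growth_zeta_right)
    also have "\<bar>Im (Ln (of_real (2 * pi)))\<bar> + pi / 2 + (- (pi / 2)) + 0 = 0"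
      by (subst Ln_of_real) simp_all
    finally have "strip_growth 0 (\<lambda>s. of_real (2 * pi) powr (- s) * cos (of_real pi * s / 2) * Gamma s * zeta s) (1/2) (1 - A')" .
    moreover have "strip_growth 0 (\<lambda>s. 2) (1/2) (1 - A')"
      by (rule strip_growthI) (auto intro!: exI[of _ 2])
    ultimately have "strip_growth (0 + 0) (\<lambda>s. 2 * (of_real (2 * pi) powr (- s) * cos (of_real pi * s / 2) * Gamma s * zeta s)) (1/2) (1 - A')"
      by (intro strip_growth_mult)
    hence "strip_growth 0 (\<lambda>s. zeta (1 - s)) (1/2) (1 - A')"
      unfolding add_0_left
    proof (rule strip_growth_cong[where K=1])
      fix s assume "1/2 \<le> Re s" "1 \<le> \<bar>Im s\<bar>"
      hence "s \<notin> \<int>\<^sub>\<le>\<^sub>0" "s \<noteq> 1" using Re_pos_not_nonpos_Int[of s] by auto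
      thus "2 * (of_real (2 * pi) powr (- s) * cos (of_real pi * s / 2) * Gamma s * zeta s) = zeta (1 - s)"
        by (simp add: zeta_functional)
    qed
    hence "strip_growth 0 (\<lambda>s. zeta (1 - (1 - s))) A' (1/2)"
      by (intro strip_growth_reflect[where f="\<lambda>s. zeta (1 - s)" and a=1 and A=A' and B="1/2"]) simp
    thus ?thesis by simp
  qed
  hence "strip_growth 0 zeta A' B'" by (rule strip_growth_union) (rule strip_growth_zeta_right)
  thus ?thesis by (rule strip_growth_subset) (auto simp: A'_def B'_def)
qed

text \<open>Spending half of the negative rate on e leaves genuine exponential decay.\<close>

lemma strip_growth_neg_bound:
  assumes "strip_growth k f A B" "k < 0"
  shows "\<exists>C T. \<forall>s. A \<le> Re s \<and> Re s \<le> B \<and> \<bar>Im s\<bar> \<ge> T \<longrightarrow> norm (f s) \<le> C * exp (- (- k / 2) * \<bar>Im s\<bar>)"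
proof -
  have eq: "k + (- k / 2) = - (- k / 2)" by simp
  have "- k / 2 > 0" using assms(2) by simp
  hence "\<exists>C T. \<forall>s. A \<le> Re s \<and> Re s \<le> B \<and> \<bar>Im s\<bar> \<ge> T \<longrightarrow> norm (f s) \<le> C * exp ((k + (- k / 2)) * \<bar>Im s\<bar>)"
    using assms(1) unfolding strip_growth_def by blast
  thus ?thesis unfolding eq .
qed

lemma vline_integral_shift_growth:
  fixes f :: "complex \<Rightarrow> complex"
  assumes "c' < c" "open S" "connected S" "\<And>s. c' \<le> Re s \<Longrightarrow> Re s \<le> c \<Longrightarrow> s \<in> S"
    and "finite pts" "\<And>p. p \<in> pts \<Longrightarrow> c' < Re p \<and> Re p < c"
    and "f holomorphic_on S - pts" and "strip_growth k f c' c" "k < 0"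
  shows "integrable lborel (\<lambda>t. f (Complex c t))" and "integrable lborel (\<lambda>t. f (Complex c' t))"
    and "vline_integral c f = vline_integral c' f + 2 * of_real pi * \<i> * (\<Sum>p\<in>pts. residue f p)"
proof -
  obtain C T where *: "\<And>s. c' \<le> Re s \<Longrightarrow> Re s \<le> c \<Longrightarrow> \<bar>Im s\<bar> \<ge> T \<Longrightarrow> norm (f s) \<le> C * exp (- (- k / 2) * \<bar>Im s\<bar>)"
    using strip_growth_neg_bound[OF assms(8,9)] by metis
  have k: "- k / 2 > 0" using assms(9) by simp
  note 1 = vline_integral_shift[OF assms(1-7) k *]
  show "integrable lborel (\<lambda>t. f (Complex c t))" by (rule 1(1))
  show "integrable lborel (\<lambda>t. f (Complex c' t))" by (rule 1(2))
  show "vline_integral c f = vline_integral c' f + 2 * of_real pi * \<i> * (\<Sum>p\<in>pts. residue f p)" by (rule 1(3))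
qed

subsection \<open>Dirichlet series of the divisor function\<close>

lemma of_nat_powr_mult: "(of_nat (m * n) :: complex) powr s = of_nat m powr s * of_nat n powr s"
  unfolding of_nat_mult by (rule powr_times_real) auto

lemma summable_norm_dirichlet:
  assumes "Re s > 1"
  shows "summable (\<lambda>n. norm (1 / of_nat (Suc n) powr s :: complex))"
  unfolding norm_dirichlet_term using assms by (rule summable_Suc_powr)

lemma bij_betw_Suc_pos: "bij_betw Suc UNIV {0<..}"
  by (auto simp: bij_betw_def greaterThan_0)

lemma zeta_has_sum:
  assumes "Re s > 1"
  shows "((\<lambda>n. 1 / of_nat n powr s) has_sum zeta s) {0<..}"
proof -
  have "((\<lambda>n. 1 / of_nat (Suc n) powr s) has_sum zeta s) UNIV"
    by (intro norm_summable_imp_has_sum summable_norm_dirichlet zeta_sums assms)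
  thus ?thesis by (subst (asm) has_sum_reindex_bij_betw[OF bij_betw_Suc_pos, of "\<lambda>n. 1 / of_nat n powr s"])
qed

lemma dirichlet_abs_summable:
  assumes "Re s > 1"
  shows "(\<lambda>n. norm (1 / of_nat n powr s :: complex)) summable_on {0<..}"
proof -
  have "(\<lambda>n. norm (1 / of_nat (Suc n) powr s :: complex)) summable_on UNIV"
    by (intro summable_nonneg_imp_summable_on summable_norm_dirichlet assms) simp
  thus ?thesis
    by (subst (asm) summable_on_reindex_bij_betw[OF bij_betw_Suc_pos, of "\<lambda>n. norm (1 / of_nat n powr s)"])
qed

text \<open>The product is an absolutely convergent double sum over pairs (d, m), regrouped by n = d
  m; the index of the shifted zeta is the divisor d.\<close>

lemma divisor_dirichlet_sums:
  assumes s: "Re s > 1" "Re (s - b) > 1"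
  shows "(\<lambda>n. divisor_sigma b (Suc n) / of_nat (Suc n) powr s) sums (zeta s * zeta (s - b))"
proof -
  let ?g = "\<lambda>d::nat. 1 / of_nat d powr (s - b) :: complex" and ?f = "\<lambda>m::nat. 1 / of_nat m powr s :: complex"
  let ?P = "{0<..} \<times> {0<..} :: (nat \<times> nat) set"
  have "((\<lambda>p. ?g (fst p) * ?f (snd p)) has_sum (zeta (s - b) * zeta s)) ?P"
  proof (rule has_sum_SigmaI)
    show "((\<lambda>y. ?g (fst (x, y)) * ?f (snd (x, y))) has_sum (?g x * zeta s)) {0<..}" for x
      unfolding fst_conv snd_conv by (rule has_sum_cmult_right[OF zeta_has_sum[OF s(1)]])
    show "((\<lambda>x. ?g x * zeta s) has_sum (zeta (s - b) * zeta s)) {0<..}"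
      by (rule has_sum_cmult_left[OF zeta_has_sum[OF s(2)]])
    have "(\<lambda>p. norm (?g (fst p)) * norm (?f (snd p))) summable_on ?P"
    proof (rule summable_on_SigmaI)
      show "((\<lambda>y. norm (?g (fst (x, y))) * norm (?f (snd (x, y)))) has_sum (norm (?g x) * infsum (\<lambda>n. norm (?f n)) {0<..})) {0<..}" for x
        unfolding fst_conv snd_conv by (rule has_sum_cmult_right[OF has_sum_infsum[OF dirichlet_abs_summable[OF s(1)]]])
      show "(\<lambda>x. norm (?g x) * infsum (\<lambda>n. norm (?f n)) {0<..}) summable_on {0<..}"
        by (rule summable_on_cmult_left[OF dirichlet_abs_summable[OF s(2)]])
    qed simp
    hence "(\<lambda>p. norm (?g (fst p) * ?f (snd p))) summable_on ?P" by (simp only: norm_mult)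
    thus "(\<lambda>p. ?g (fst p) * ?f (snd p)) summable_on ?P" by (rule abs_summable_summable)
  qed
  moreover
  have bij: "bij_betw (\<lambda>(n, d). (d, n div d)) (SIGMA n:{0<..}. {d. d dvd n}) ?P"
  proof (rule bij_betwI[of _ _ _ "\<lambda>(d, m). (d * m, d)"])
    show "(\<lambda>(n, d). (d, n div d)) \<in> (SIGMA n:{0<..}. {d. d dvd n}) \<rightarrow> ?P"
      by (clarsimp simp: dvd_def) 
    show "(\<lambda>(d, m). (d * m, d)) \<in> ?P \<rightarrow> (SIGMA n:{0<..}. {d. d dvd n})" by auto
    show "(case (case x of (n, d) \<Rightarrow> (d, n div d)) of (d, m) \<Rightarrow> (d * m, d)) = x" if "x \<in> (SIGMA n:{0<..}. {d. d dvd n})" for x :: "nat \<times> nat"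
      using that by (cases x) simp
    show "(case (case y of (d, m) \<Rightarrow> (d * m, d)) of (n, d) \<Rightarrow> (d, n div d)) = y" if "y \<in> ?P" for y :: "nat \<times> nat"
      using that by (cases y) simp
  qed
  ultimately have "((\<lambda>x. (\<lambda>p. ?g (fst p) * ?f (snd p)) (case x of (n, d) \<Rightarrow> (d, n div d))) has_sum (zeta (s - b) * zeta s)) (SIGMA n:{0<..}. {d. d dvd n})"
    by (simp only: has_sum_reindex_bij_betw[OF bij, of "\<lambda>p. ?g (fst p) * ?f (snd p)" "zeta (s - b) * zeta s"])
  also have "?this \<longleftrightarrow> ((\<lambda>x. of_nat (snd x) powr b / of_nat (fst x) powr s) has_sum (zeta (s - b) * zeta s)) (SIGMA n:{0<..}. {d. d dvd n})"
  proof (rule has_sum_cong)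
    fix x :: "nat \<times> nat" assume "x \<in> (SIGMA n:{0<..}. {d. d dvd n})"
    then obtain d m where x: "x = (d * m, d)" "d > 0" "m > 0" by (auto elim!: dvdE)
    have "(of_nat d :: complex) powr (s - b) = of_nat d powr s / of_nat d powr b" by (rule powr_diff)
    moreover have "(of_nat (d * m) :: complex) powr s = of_nat d powr s * of_nat m powr s" by (rule of_nat_powr_mult)
    ultimately show "(\<lambda>p. ?g (fst p) * ?f (snd p)) (case x of (n, d) \<Rightarrow> (d, n div d)) = of_nat (snd x) powr b / of_nat (fst x) powr s"
      using x by (simp del: of_nat_mult)
  qed
  finally have D: "((\<lambda>x. of_nat (snd x) powr b / of_nat (fst x) powr s) has_sum (zeta (s - b) * zeta s)) (SIGMA n:{0<..}. {d. d dvd n})" .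
  have "((\<lambda>n. divisor_sigma b n / of_nat n powr s) has_sum (zeta (s - b) * zeta s)) {0<..}"
  proof (rule has_sum_SigmaD[OF D])
    fix n :: nat assume "n \<in> {0<..}"
    hence fin: "finite {d. d dvd n}" by simp
    have "divisor_sigma b n / of_nat n powr s = (\<Sum>d | d dvd n. of_nat d powr b / of_nat n powr s)"
      by (simp add: divisor_sigma_def sum_divide_distrib)
    thus "((\<lambda>y. of_nat (snd (n, y)) powr b / of_nat (fst (n, y)) powr s) has_sum (divisor_sigma b n / of_nat n powr s)) {d. d dvd n}"
      using has_sum_finite[OF fin, of "\<lambda>d. of_nat d powr b / of_nat n powr s"] by simp
  qed
  hence "((\<lambda>n. divisor_sigma b (Suc n) / of_nat (Suc n) powr s) has_sum (zeta (s - b) * zeta s)) UNIV"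
    by (subst has_sum_reindex_bij_betw[OF bij_betw_Suc_pos, of "\<lambda>n. divisor_sigma b n / of_nat n powr s"])
  thus ?thesis by (simp add: has_sum_imp_sums mult.commute)
qed

lemma norm_divisor_sigma_le: "norm (divisor_sigma b n) \<le> Re (divisor_sigma (of_real (Re b)) n)"
proof -
  have "norm (divisor_sigma b n) \<le> (\<Sum>d | d dvd n. norm (of_nat d powr b :: complex))"
    unfolding divisor_sigma_def by (rule norm_sum)
  also have "\<dots> = (\<Sum>d | d dvd n. Re (of_nat d powr of_real (Re b)))"
  proof (intro sum.cong refl)
    fix d
    have "(of_nat d :: complex) powr of_real (Re b) = of_real (real d powr Re b)"
      using powr_of_real[of "real d" "Re b"] by simp
    moreover have "norm (of_nat d powr b :: complex) = real d powr Re b"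
      using norm_powr_real_powr[of "of_nat d" b] by simp
    ultimately show "norm (of_nat d powr b :: complex) = Re (of_nat d powr of_real (Re b))" by simp
  qed
  finally show ?thesis by (simp add: divisor_sigma_def)
qed

text \<open>Replacing \<open>b\<close> by its real part makes all terms nonnegative, so plain
  convergence of the Dirichlet series yields absolute convergence.\<close>

lemma summable_divisor_dirichlet:
  assumes "x > 1" "x - Re b > 1"
  shows "summable (\<lambda>n. norm (divisor_sigma b (Suc n)) * real (Suc n) powr (- x))"
proof (rule summable_comparison_test)
  have "(\<lambda>n. Re (divisor_sigma (of_real (Re b)) (Suc n) / of_nat (Suc n) powr of_real x)) sums Re (zeta (of_real x) * zeta (of_real x - of_real (Re b)))"
    using assms by (intro sums_Re divisor_dirichlet_sums) auto
  moreover have "Re (divisor_sigma (of_real (Re b)) (Suc n) / of_nat (Suc n) powr of_real x) = Re (divisor_sigma (of_real (Re b)) (Suc n)) * real (Suc n) powr (- x)" for n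
  proof -
    have "(of_nat (Suc n) :: complex) powr of_real x = of_real (real (Suc n) powr x)"
      using powr_of_real[of "real (Suc n)" x] by simp
    thus ?thesis by (simp only: Re_divide_of_real powr_minus_divide times_divide_eq_right mult_1_right)
  qed
  ultimately show "summable (\<lambda>n. Re (divisor_sigma (of_real (Re b)) (Suc n)) * real (Suc n) powr (- x))"
    by (simp only: sums_iff)
  show "\<exists>N. \<forall>n\<ge>N. norm (norm (divisor_sigma b (Suc n)) * real (Suc n) powr (- x)) \<le> Re (divisor_sigma (of_real (Re b)) (Suc n)) * real (Suc n) powr (- x)"
    unfolding real_norm_def abs_mult abs_norm_cancel
    by (intro exI[of _ 0] allI impI mult_mono norm_divisor_sigma_le)
       (auto intro: order.trans[OF norm_ge_zero norm_divisor_sigma_le])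
qed

subsection \<open>Mellin inversion of the exponential function\<close>

lemma norm_Gamma_neg_half_line:
  "norm (Gamma (Complex (- (real N + 1/2)) t)) \<le> 2 / fact N * (sqrt (2 * pi) * exp (- (pi / 2) * \<bar>t\<bar>))"
proof -
  let ?s = "Complex (- (real N + 1/2)) t"
  have ns: "?s \<notin> \<int>\<^sub>\<le>\<^sub>0"
  proof
    assume "?s \<in> \<int>\<^sub>\<le>\<^sub>0"
    then obtain n where "?s = of_int n" by (elim nonpos_Ints_cases)
    hence "- (real N + 1/2) = real_of_int n" by (simp add: complex_eq_iff)
    hence "real_of_int (- (2 * int N + 1)) = real_of_int (2 * n)" by simp
    hence "- (2 * int N + 1) = 2 * n" by (simp only: of_int_eq_iff)
    thus False by presburger
  qed
  have "?s + of_nat (Suc N) = Complex (1/2) t" by (simp add: complex_eq_iff)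
  hence "Gamma (Complex (1/2) t) = pochhammer ?s (Suc N) * Gamma ?s"
    using pochhammer_Gamma[OF ns, of "Suc N"] ns by (simp add: Gamma_eq_zero_iff)
  hence *: "norm (Gamma (Complex (1/2) t)) = norm (pochhammer ?s (Suc N)) * norm (Gamma ?s)"
    by (simp add: norm_mult)
  have "norm (pochhammer ?s (Suc N)) \<ge> fact N / 2"
  proof -
    have "fact N / 2 \<le> (\<Prod>j=0..N. real j + 1/2)"
    proof (induction N)
      case (Suc N)
      have "fact (Suc N) / 2 = (fact N / 2) * real (Suc N)" by simp
      also have "\<dots> \<le> (\<Prod>j=0..N. real j + 1/2) * (real (Suc N) + 1/2)"
        by (intro mult_mono Suc) (auto intro!: prod_nonneg)
      finally show ?case by simp
    qed simp
    also have "\<dots> = (\<Prod>i=0..N. real (N - i) + 1/2)" by (subst prod.atLeastAtMost_rev) simp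
    also have "\<dots> \<le> (\<Prod>i=0..N. norm (?s + of_nat i))"
    proof (intro prod_mono conjI)
      fix i assume "i \<in> {0..N}"
      hence "real (N - i) + 1/2 = \<bar>Re (?s + of_nat i)\<bar>" by (simp add: of_nat_diff)
      also have "\<dots> \<le> norm (?s + of_nat i)" by (rule abs_Re_le_cmod)
      finally show "real (N - i) + 1/2 \<le> norm (?s + of_nat i)" .
    qed simp
    also have "\<dots> = norm (pochhammer ?s (Suc N))"
      by (simp only: pochhammer_Suc_prod prod_norm atLeast0AtMost)
    finally show ?thesis .
  qed
  hence "fact N / 2 * norm (Gamma ?s) \<le> norm (Gamma (Complex (1/2) t))"
    unfolding * by (intro mult_right_mono) auto
  also have "\<dots> \<le> sqrt (2 * pi) * exp (- (pi / 2) * \<bar>t\<bar>)" by (rule norm_Gamma_half_line)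
  finally show ?thesis by (simp add: field_simps)
qed

lemma strip_growth_Gamma_powr:
  assumes "w \<noteq> 0"
  shows "strip_growth (- (pi / 2) + \<bar>Im (Ln w)\<bar>) (\<lambda>s. Gamma s * w powr (- s)) A B"
  by (intro strip_growth_mult strip_growth_Gamma strip_growth_powr assms)

lemma residue_mult_Gamma:
  assumes "open S" "- of_nat k \<in> S" "(\<lambda>s. Gamma s * h s) holomorphic_on S - {- of_nat k}" "isCont h (- of_nat k)"
  shows "residue (\<lambda>s. Gamma s * h s) (- of_nat k) = (-1) ^ k / fact k * h (- of_nat k)"
proof (rule residue_simple'[OF assms(1-3)])
  have "((\<lambda>s. (Gamma s * (s + of_nat k)) * h s) \<longlongrightarrow> (-1) ^ k / fact k * h (- of_nat k)) (at (- of_nat k))"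
    using assms(4) by (intro tendsto_mult Gamma_residues) (simp add: isCont_def)
  thus "((\<lambda>s. Gamma s * h s * (s - - of_nat k)) \<longlongrightarrow> (-1) ^ k / fact k * h (- of_nat k)) (at (- of_nat k))"
    by (simp add: mult_ac)
qed

text \<open>Moving the line to -(N + 1/2), midway between poles, collects residues that form a
  partial sum of the exponential series, and the integral left over is of order |w|^N / N!.\<close>

lemma mellin_inversion_exp:
  assumes w: "Re w > 0" and c: "c > 0"
  shows "integrable lborel (\<lambda>t. Gamma (Complex c t) * w powr (- Complex c t))"
    and "vline_integral c (\<lambda>s. Gamma s * w powr (- s)) = 2 * of_real pi * \<i> * exp (- w)"
proof -
  define f where "f = (\<lambda>s. Gamma s * w powr (- s))"
  define \<theta> where "\<theta> = \<bar>Im (Ln w)\<bar>"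
  have w0: "w \<noteq> 0" using w by auto
  have \<theta>: "\<theta> < pi / 2" unfolding \<theta>_def by (rule Re_Ln_pos_lt_imp[OF w])
  define pts where "pts = (\<lambda>N. (\<lambda>k. - of_nat k :: complex) ` {..N})"
  have hol: "f holomorphic_on {s. Re s > - (real N + 1)} - pts N" for N
  proof -
    have np: "s \<notin> \<int>\<^sub>\<le>\<^sub>0" if s: "s \<in> {s. Re s > - (real N + 1)} - pts N" for s
    proof
      assume "s \<in> \<int>\<^sub>\<le>\<^sub>0"
      then obtain n where n: "s = - of_nat n" by (elim nonpos_Ints_cases')
      hence "real n < real N + 1" using s by simp
      hence "n \<le> N" by linarith
      thus False using s n by (auto simp: pts_def)
    qed
    show ?thesis unfolding f_def by (intro holomorphic_intros) (use w np in \<open>auto simp: complex_nonpos_Reals_iff\<close>)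
  qed
  have growth: "strip_growth (- (pi / 2) + \<theta>) f A B" for A B
    unfolding f_def \<theta>_def by (rule strip_growth_Gamma_powr[OF w0])
  have shift: "integrable lborel (\<lambda>t. f (Complex c t))"
      "vline_integral c f = vline_integral (- (real N + 1/2)) f + 2 * of_real pi * \<i> * (\<Sum>p\<in>pts N. residue f p)"
      "integrable lborel (\<lambda>t. f (Complex (- (real N + 1/2)) t))" for N
  proof -
    note * = vline_integral_shift_growth[where c'="- (real N + 1/2)" and c=c and S="{s. Re s > - (real N + 1)}" and pts="pts N" and f=f and k="- (pi / 2) + \<theta>"]
    have prem: "- (real N + 1/2) < c" "open {s. Re s > - (real N + 1)}" "connected {s. Re s > - (real N + 1)}"
       "finite (pts N)" "- (pi / 2) + \<theta> < 0"
      using c \<theta> by (auto simp: open_halfspace_Re_gt pts_def intro!: convex_connected convex_halfspace_Re_gt)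
    have strip: "- (real N + 1/2) \<le> Re s \<Longrightarrow> Re s \<le> c \<Longrightarrow> s \<in> {s. Re s > - (real N + 1)}" for s by auto
    have p: "- (real N + 1/2) < Re p \<and> Re p < c" if "p \<in> pts N" for p using that c by (auto simp: pts_def)
    show "integrable lborel (\<lambda>t. f (Complex c t))"
      by (rule *(1)[OF prem(1-3) strip prem(4) p hol growth prem(5)])
    show "integrable lborel (\<lambda>t. f (Complex (- (real N + 1/2)) t))"
      by (rule *(2)[OF prem(1-3) strip prem(4) p hol growth prem(5)])
    show "vline_integral c f = vline_integral (- (real N + 1/2)) f + 2 * of_real pi * \<i> * (\<Sum>p\<in>pts N. residue f p)"
      by (rule *(3)[OF prem(1-3) strip prem(4) p hol growth prem(5)])
  qed
  show "integrable lborel (\<lambda>t. Gamma (Complex c t) * w powr (- Complex c t))"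
    using shift(1) by (simp add: f_def)
  have res: "residue f (- of_nat k) = (-1) ^ k / fact k * w ^ k" for k
  proof -
    have "residue f (- of_nat k) = (-1) ^ k / fact k * w powr (- (- of_nat k))"
      unfolding f_def
    proof (rule residue_mult_Gamma)
      show "open (- (\<int>\<^sub>\<le>\<^sub>0 - {- of_nat k}) :: complex set)"
        by (intro open_Compl closed_subset_Ints) auto
      show "(\<lambda>s. Gamma s * w powr - s) holomorphic_on - (\<int>\<^sub>\<le>\<^sub>0 - {- of_nat k}) - {- of_nat k}"
        using w by (intro holomorphic_intros) (auto simp: complex_nonpos_Reals_iff)
      show "isCont (\<lambda>s. w powr - s) (- of_nat k)"
        using w by (intro continuous_intros) (auto simp: complex_nonpos_Reals_iff)
    qed auto
    thus ?thesis using w0 by (simp add: powr_nat)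
  qed
  have sum: "(\<Sum>p\<in>pts N. residue f p) = (\<Sum>k\<le>N. (- w) ^ k / fact k)" for N
    unfolding pts_def
    by (subst sum.reindex) (auto simp: inj_on_def res power_minus[of w] intro!: sum.cong)
  have lim1: "(\<lambda>N. \<Sum>k\<le>N. (- w) ^ k / fact k) \<longlonglongrightarrow> exp (- w)"
    using exp_converges[of "- w"] unfolding sums_def_le by (simp add: scaleR_conv_of_real field_simps)
  define J where "J = (\<integral>t. sqrt (2 * pi) * exp (- (pi / 2 - \<theta>) * \<bar>t\<bar>) \<partial>lborel)"
  have Jint: "integrable lborel (\<lambda>t. sqrt (2 * pi) * exp (- (pi / 2 - \<theta>) * \<bar>t\<bar>))"
    using \<theta> by (intro integrable_mult_right integrable_exp_minus_abs) simp
  have bound: "norm (vline_integral (- (real N + 1/2)) f) \<le> (norm w ^ N / fact N) * (2 * norm w powr (1/2) * J)" for N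
  proof -
    have pt: "norm (f (Complex (- (real N + 1/2)) t)) \<le> (2 / fact N * norm w powr (real N + 1/2)) * (sqrt (2 * pi) * exp (- (pi / 2 - \<theta>) * \<bar>t\<bar>))" for t
    proof -
      have "norm (w powr (- Complex (- (real N + 1/2)) t)) = norm w powr (real N + 1/2) * exp (Im (Ln w) * t)"
        unfolding norm_powr_complex[OF w0] by (simp add: add.commute)
      also have "\<dots> \<le> norm w powr (real N + 1/2) * exp (\<theta> * \<bar>t\<bar>)"
      proof (intro mult_left_mono)
        have "Im (Ln w) * t \<le> \<bar>Im (Ln w) * t\<bar>" by simp
        thus "exp (Im (Ln w) * t) \<le> exp (\<theta> * \<bar>t\<bar>)" by (simp add: \<theta>_def abs_mult)
      qed auto
      finally have "norm (f (Complex (- (real N + 1/2)) t)) \<le>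
        (2 / fact N * (sqrt (2 * pi) * exp (- (pi / 2) * \<bar>t\<bar>))) * (norm w powr (real N + 1/2) * exp (\<theta> * \<bar>t\<bar>))"
        unfolding f_def norm_mult by (intro mult_mono norm_Gamma_neg_half_line) auto
      also have "\<dots> = (2 / fact N * norm w powr (real N + 1/2)) * (sqrt (2 * pi) * (exp (- (pi / 2) * \<bar>t\<bar>) * exp (\<theta> * \<bar>t\<bar>)))"
        by (simp only: mult_ac)
      also have "exp (- (pi / 2) * \<bar>t\<bar>) * exp (\<theta> * \<bar>t\<bar>) = exp (- (pi / 2 - \<theta>) * \<bar>t\<bar>)"
        by (simp add: algebra_simps flip: exp_add)
      finally show ?thesis .
    qed
    have "norm (vline_integral (- (real N + 1/2)) f) = norm (\<integral>t. f (Complex (- (real N + 1/2)) t) \<partial>lborel)"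
      by (simp add: vline_integral_def norm_mult)
    also have "\<dots> \<le> (\<integral>t. (2 / fact N * norm w powr (real N + 1/2)) * (sqrt (2 * pi) * exp (- (pi / 2 - \<theta>) * \<bar>t\<bar>)) \<partial>lborel)"
    proof (rule order.trans[OF integral_norm_bound integral_mono])
      show "integrable lborel (\<lambda>t. norm (f (Complex (- (real N + 1/2)) t)))"
        by (intro integrable_norm shift(3))
    qed (rule integrable_mult_right[OF Jint] pt)+
    also have "\<dots> = (2 / fact N * norm w powr (real N + 1/2)) * J"
      unfolding J_def by (rule integral_mult_right_zero)
    also have "norm w powr (real N + 1/2) = norm w ^ N * norm w powr (1/2)"
      using w0 by (simp only: powr_add) (simp add: powr_realpow)
    finally show ?thesis by (simp add: mult_ac)
  qed
  have "(\<lambda>N. vline_integral (- (real N + 1/2)) f) \<longlonglongrightarrow> 0"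
  proof (rule Lim_null_comparison[OF always_eventually])
    show "\<forall>N. norm (vline_integral (- (real N + 1/2)) f) \<le> (norm w ^ N / fact N) * (2 * norm w powr (1/2) * J)"
      using bound by blast
    have "(\<lambda>N. norm w ^ N / fact N) \<longlonglongrightarrow> 0"
      using summable_LIMSEQ_zero[OF summable_exp[of "norm w"]] by (simp add: field_simps)
    thus "(\<lambda>N. (norm w ^ N / fact N) * (2 * norm w powr (1/2) * J)) \<longlonglongrightarrow> 0"
      by (rule tendsto_mult_left_zero)
  qed
  hence "(\<lambda>N. vline_integral (- (real N + 1/2)) f + 2 * of_real pi * \<i> * (\<Sum>k\<le>N. (- w) ^ k / fact k)) \<longlonglongrightarrow> 0 + 2 * of_real pi * \<i> * exp (- w)"
    by (intro tendsto_intros lim1)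
  moreover have "(\<lambda>N. vline_integral (- (real N + 1/2)) f + 2 * of_real pi * \<i> * (\<Sum>k\<le>N. (- w) ^ k / fact k)) = (\<lambda>N. vline_integral c f)"
    using shift(2) sum by (simp add: fun_eq_iff)
  ultimately have "vline_integral c f = 0 + 2 * of_real pi * \<i> * exp (- w)"
    using LIMSEQ_unique[OF tendsto_const] by metis
  thus "vline_integral c (\<lambda>s. Gamma s * w powr (- s)) = 2 * of_real pi * \<i> * exp (- w)"
    by (simp add: f_def)
qed

subsection \<open>The divisor series as a Mellin integral\<close>

lemma of_nat_mult_powr:
  assumes "n > 0"
  shows "(of_nat n * w) powr s = (of_nat n :: complex) powr s * w powr s"
  by (rule powr_times_real_left) auto

text \<open>For w = -2 pi i z the exponentials exp (-n w) are those of the series, and Re w = 2 pi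
  Im z > 0. On the line the n-th integrand is a summable constant times |G t|, which justifies the
  interchange.\<close>

lemma div_series_mellin:
  assumes z: "Im z > 0" and c: "c > 1" "c - Re b > 1"
  shows "vline_integral c (\<lambda>s. Gamma s * (- (2 * of_real pi * \<i> * z)) powr (- s) * (zeta s * zeta (s - b)))
     = 2 * of_real pi * \<i> * div_series b z"
proof -
  define w where "w = - (2 * of_real pi * \<i> * z)"
  have w: "Re w > 0" using z by (simp add: w_def)
  define G where "G = (\<lambda>t. Gamma (Complex c t) * w powr (- Complex c t))"
  define a where "a = (\<lambda>n. divisor_sigma b (Suc n))"
  define h where "h = (\<lambda>n t. a n * of_nat (Suc n) powr (- Complex c t) * G t)"
  have Gint: "integrable lborel G" unfolding G_def using c by (intro mellin_inversion_exp w) simp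
  have hG: "h n t = a n * (Gamma (Complex c t) * (of_nat (Suc n) * w) powr (- Complex c t))" for n t
    unfolding h_def G_def by (simp add: of_nat_mult_powr del: of_nat_Suc)
  have Re_n: "Re (of_nat (Suc n) * w) > 0" for n using w by (simp del: of_nat_Suc)
  have hint: "integrable lborel (h n)" for n
    unfolding hG[abs_def] using c by (intro integrable_mult_right mellin_inversion_exp Re_n) simp
  have norm_h: "norm (h n t) = (norm (a n) * real (Suc n) powr (- c)) * norm (G t)" for n t
    using norm_powr_real_powr[of "of_nat (Suc n)" "- Complex c t"] by (simp add: h_def norm_mult)
  have summ: "summable (\<lambda>n. norm (a n) * real (Suc n) powr (- c))"
    unfolding a_def using c by (intro summable_divisor_dirichlet) auto
  have hval: "(\<integral>t. h n t \<partial>lborel) = 2 * of_real pi * (a n * exp (- (of_nat (Suc n) * w)))" for n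
  proof -
    have "(\<integral>t. h n t \<partial>lborel) = a n * (\<integral>t. Gamma (Complex c t) * (of_nat (Suc n) * w) powr (- Complex c t) \<partial>lborel)"
      unfolding hG by (rule integral_mult_right_zero)
    moreover have "\<i> * (\<integral>t. Gamma (Complex c t) * (of_nat (Suc n) * w) powr (- Complex c t) \<partial>lborel) = 2 * of_real pi * \<i> * exp (- (of_nat (Suc n) * w))"
      using mellin_inversion_exp(2)[OF Re_n, of c n] c by (simp add: vline_integral_def)
    ultimately show ?thesis by (simp add: field_simps)
  qed
  have "(\<integral>t. (\<Sum>n. h n t) \<partial>lborel) = (\<Sum>n. \<integral>t. h n t \<partial>lborel)"
  proof (rule integral_suminf[OF hint])
    show "AE t in lborel. summable (\<lambda>n. norm (h n t))"
      unfolding norm_h by (intro AE_I2 summable_mult2 summ)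
    show "summable (\<lambda>n. \<integral>t. norm (h n t) \<partial>lborel)"
      unfolding norm_h integral_mult_right_zero by (intro summable_mult2 summ)
  qed
  also have "(\<lambda>t. \<Sum>n. h n t) = (\<lambda>t. G t * (zeta (Complex c t) * zeta (Complex c t - b)))"
  proof
    fix t
    have "(\<lambda>n. a n / of_nat (Suc n) powr Complex c t) sums (zeta (Complex c t) * zeta (Complex c t - b))"
      unfolding a_def using c by (intro divisor_dirichlet_sums) auto
    hence "(\<lambda>n. a n / of_nat (Suc n) powr Complex c t * G t) sums (zeta (Complex c t) * zeta (Complex c t - b) * G t)"
      by (rule sums_mult2)
    moreover have "a n / of_nat (Suc n) powr Complex c t * G t = h n t" for n
      by (simp add: h_def powr_minus_divide)
    ultimately show "(\<Sum>n. h n t) = G t * (zeta (Complex c t) * zeta (Complex c t - b))"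
      by (simp add: sums_iff mult_ac)
  qed
  also have "(\<lambda>n. \<integral>t. h n t \<partial>lborel) = (\<lambda>n. 2 * of_real pi * (a n * exp (- (of_nat (Suc n) * w))))"
    using hval by (simp only: fun_eq_iff) simp
  also have "(\<Sum>n. 2 * of_real pi * (a n * exp (- (of_nat (Suc n) * w)))) = 2 * of_real pi * (\<Sum>n. a n * exp (- (of_nat (Suc n) * w)))"
  proof (rule suminf_mult)
    show "summable (\<lambda>n. a n * exp (- (of_nat (Suc n) * w)))"
    proof (rule summable_comparison_test)
      \<comment> \<open>Summability of the exponential series is obtained from the Mellin side as
        well: each term is bounded by the integral of the norm that represents it.\<close>
      define K where "K = (\<integral>t. norm (G t) \<partial>lborel)"
      show "summable (\<lambda>n. norm (a n) * real (Suc n) powr (- c) * K)" by (intro summable_mult2 summ)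
      have "norm (a n * exp (- (of_nat (Suc n) * w))) \<le> norm (a n) * real (Suc n) powr (- c) * K" for n
      proof -
        have "norm (2 * of_real pi * (a n * exp (- (of_nat (Suc n) * w)))) \<le> (\<integral>t. norm (h n t) \<partial>lborel)"
          unfolding hval[symmetric] by (rule integral_norm_bound)
        also have "\<dots> = norm (a n) * real (Suc n) powr (- c) * K"
          unfolding norm_h K_def by (rule integral_mult_right_zero)
        finally have "2 * pi * norm (a n * exp (- (of_nat (Suc n) * w))) \<le> norm (a n) * real (Suc n) powr (- c) * K"
          by (simp only: norm_mult[of "2 * of_real pi"]) (simp add: norm_mult)
        moreover have "1 * norm (a n * exp (- (of_nat (Suc n) * w))) \<le> 2 * pi * norm (a n * exp (- (of_nat (Suc n) * w)))"
          using pi_gt3 by (intro mult_right_mono) auto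
        ultimately show ?thesis by linarith
      qed
      thus "\<exists>N. \<forall>n\<ge>N. norm (a n * exp (- (of_nat (Suc n) * w))) \<le> norm (a n) * real (Suc n) powr (- c) * K"
        by blast
    qed
  qed
  also have "(\<Sum>n. a n * exp (- (of_nat (Suc n) * w))) = div_series b z"
    unfolding div_series_def a_def w_def by (simp add: mult_ac del: of_nat_Suc)
  finally show ?thesis by (simp add: vline_integral_def G_def w_def)
qed

text \<open>The sign of ds and the reversed orientation of the line cancel, so no sign
  appears.\<close>

lemma vline_integral_reflect:
  "vline_integral c f = vline_integral (Re p - c) (\<lambda>s. f (p - s))"
proof -
  have "(\<integral>t. f (Complex c t) \<partial>lborel) = (\<integral>t. f (Complex c (Im p + (-1) * t)) \<partial>lborel)"
    using lborel_integral_real_affine[of "-1" "\<lambda>t. f (Complex c t)" "Im p"] by simp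
  also have "(\<lambda>t. f (Complex c (Im p + (-1) * t))) = (\<lambda>t. f (p - Complex (Re p - c) t))"
    by (intro ext arg_cong[where f=f]) (simp add: complex_eq_iff)
  finally show ?thesis by (simp add: vline_integral_def)
qed

lemma integrable_vline_reflect:
  fixes f :: "complex \<Rightarrow> complex"
  assumes "integrable lborel (\<lambda>t. f (Complex c t))"
  shows "integrable lborel (\<lambda>t. f (p - Complex (Re p - c) t))"
proof -
  have "integrable lborel (\<lambda>t. f (Complex c (Im p + (-1) * t)))"
    by (rule lborel_integrable_real_affine[OF assms, of "-1" "Im p"]) simp
  also have "(\<lambda>t. f (Complex c (Im p + (-1) * t))) = (\<lambda>t. f (p - Complex (Re p - c) t))"
    by (intro ext arg_cong[where f=f]) (simp add: complex_eq_iff)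
  finally show ?thesis .
qed

subsection \<open>Moving the line of integration\<close>

lemma residue_simple_pole_zeta:
  assumes "open S" "p \<in> S" "(\<lambda>s. h s * zeta (s - p + 1)) holomorphic_on S - {p}" "isCont h p"
  shows "residue (\<lambda>s. h s * zeta (s - p + 1)) p = h p"
proof (rule residue_simple'[OF assms(1-3)])
  have "filterlim (\<lambda>s. s - p + 1) (at 1) (at p)"
    unfolding filterlim_at by (auto simp: eventually_at_filter intro!: tendsto_eq_intros)
  from filterlim_compose[OF zeta_pole this]
  have "((\<lambda>s. (s - p) * zeta (s - p + 1)) \<longlongrightarrow> 1) (at p)" by simp
  hence "((\<lambda>s. h s * ((s - p) * zeta (s - p + 1))) \<longlongrightarrow> h p * 1) (at p)"
    using assms(4) by (intro tendsto_mult) (simp_all add: isCont_def)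
  thus "((\<lambda>s. h s * zeta (s - p + 1) * (s - p)) \<longlongrightarrow> h p) (at p)" by (simp add: mult_ac)
qed

lemma isCont_holomorphic:
  assumes "f holomorphic_on A" "open A" "x \<in> A"
  shows "isCont f x"
  using assms holomorphic_on_imp_continuous_on continuous_on_eq_continuous_at by blast

lemma closed_Ints_sub: "open (- (X :: complex set))" if "X \<subseteq> \<int>"
  using that by (intro open_Compl closed_subset_Ints) auto

text \<open>As \<open>b\<close> is not an integer, the poles at 1, at 1 + b and at the nonpositive
  integers are distinct, hence simple, and each residue is the value of the other factors.\<close>

lemma mellin_shift:
  fixes b z :: complex and M :: nat
  assumes b: "b \<notin> \<int>" "Re b > - 2 * real M - 1/2" and z: "Im z > 0"
  defines "w \<equiv> - (2 * of_real pi * \<i> * z)"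
  defines "F \<equiv> \<lambda>s. Gamma s * w powr (- s) * (zeta s * zeta (s - b))"
  shows "integrable lborel (\<lambda>t. F (Complex (- 1/2 - 2 * real M) t))"
    and "integrable lborel (\<lambda>t. F (Complex (Re b + 3/2 + 2 * real M) t))"
    and "2 * of_real pi * \<i> * div_series b z = vline_integral (- 1/2 - 2 * real M) F
     + 2 * of_real pi * \<i> * (zeta (1 - b) / w + Gamma (1 + b) * zeta (1 + b) * w powr (- (1 + b))
        + (\<Sum>k\<le>2 * M. bern_coeff (Suc k) * zeta (- of_nat k - b) * w ^ k))"
proof -
  \<comment> \<open>The two lines are mirror images under the reflection of s to 1 + b - s, and the
    bound on \<open>Re b\<close> puts c to the right of 1 and of 1 + Re b, inside the region of the
    Dirichlet series.\<close>
  define c c' where "c = Re b + 3/2 + 2 * real M" and "c' = - 1/2 - 2 * real M"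
  have w: "Re w > 0" using z by (simp add: w_def)
  have w0: "w \<noteq> 0" "w \<notin> \<real>\<^sub>\<le>\<^sub>0" using w by (auto simp: complex_nonpos_Reals_iff)
  define N where "N = (\<lambda>k. - of_nat k :: complex) ` {..2 * M}"
  define pts where "pts = insert 1 (insert (1 + b) N)"
  \<comment> \<open>The half plane ends at the first pole of Gamma that is not crossed.\<close>
  define S where "S = {s. Re s > - (2 * real M + 1)}"
  have oS: "open S" by (simp add: S_def open_halfspace_Re_gt)
  have b1: "1 + b \<notin> \<int>" using b(1) Ints_diff[of "1 + b" 1] by auto
  have nat_Z: "- of_nat k \<in> (\<int> :: complex set)" "- of_nat k \<in> (\<int>\<^sub>\<le>\<^sub>0 :: complex set)" for k by simp_all
  have dist: "1 \<notin> N" "1 + b \<notin> N" "1 + b \<noteq> 1"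
  proof -
    show "1 \<notin> N"
    proof
      assume "1 \<in> N"
      then obtain k where "1 = - (of_nat k :: complex)" by (auto simp: N_def)
      hence "1 = - real k" by (simp add: complex_eq_iff)
      thus False by simp
    qed
    show "1 + b \<notin> N" using b1 nat_Z(1) unfolding N_def by (metis imageE)
    show "1 + b \<noteq> 1" using b(1) by auto
  qed
  have fin: "finite N" "finite pts" by (simp_all add: N_def pts_def)
  have np: "s \<notin> \<int>\<^sub>\<le>\<^sub>0" if "s \<in> S - N" for s
  proof
    assume "s \<in> \<int>\<^sub>\<le>\<^sub>0"
    then obtain n where n: "s = - of_nat n" by (elim nonpos_Ints_cases')
    hence "real n < 2 * real M + 1" using that by (simp add: S_def)
    hence "n \<le> 2 * M" by linarith
    thus False using that n by (auto simp: N_def)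
  qed
  have hol: "F holomorphic_on S - pts" unfolding F_def
    by (intro holomorphic_intros) (use np w0 in \<open>auto simp: pts_def algebra_simps\<close>)
  have growth: "strip_growth (- (pi / 2) + \<bar>Im (Ln w)\<bar> + (0 + 0)) F c' c"
    unfolding F_def
    by (intro strip_growth_mult[OF strip_growth_Gamma_powr[OF w0(1)] strip_growth_mult] strip_growth_zeta strip_growth_diff_const)
  have neg: "- (pi / 2) + \<bar>Im (Ln w)\<bar> + (0 + 0) < 0"
    using Re_Ln_pos_lt_imp[OF w] by simp
  have cc: "c' < c" using b(2) by (simp add: c_def c'_def)
  have conn: "connected S" unfolding S_def by (intro convex_connected convex_halfspace_Re_gt)
  have strip: "s \<in> S" if "c' \<le> Re s" "Re s \<le> c" for s using that by (simp add: S_def c'_def)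
  have pin: "c' < Re p \<and> Re p < c" if "p \<in> pts" for p
  proof -
    have "p = 1 \<or> p = 1 + b \<or> (\<exists>k\<le>2*M. p = - of_nat k)" using that by (auto simp: pts_def N_def)
    thus ?thesis
    proof (elim disjE exE conjE)
      fix k assume k: "k \<le> 2 * M" "p = - of_nat k"
      hence "real k \<le> 2 * real M" by linarith
      thus ?thesis using k b(2) by (simp add: c_def c'_def)
    qed (use b(2) in \<open>auto simp: c_def c'_def\<close>)
  qed
  note shift = vline_integral_shift_growth[OF cc oS conn strip fin(2) pin hol growth neg]
  show "integrable lborel (\<lambda>t. F (Complex (- 1/2 - 2 * real M) t))"
    using shift(2) by (simp add: c'_def)
  show "integrable lborel (\<lambda>t. F (Complex (Re b + 3/2 + 2 * real M) t))"
    using shift(1) by (simp add: c_def)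
  have res1: "residue F 1 = zeta (1 - b) / w"
  proof -
    define U where "U = - (N \<union> (\<int>\<^sub>\<le>\<^sub>0 \<union> {1 + b}))"
    have U: "open U" unfolding U_def using fin
      by (intro open_Compl closed_Un finite_imp_closed closed_nonpos_Ints) auto
    have Fe: "F = (\<lambda>s. Gamma s * w powr (- s) * zeta (s - b) * zeta (s - 1 + 1))"
      by (simp add: F_def fun_eq_iff)
    have h: "(\<lambda>s. Gamma s * w powr (- s) * zeta (s - b)) holomorphic_on U"
      by (intro holomorphic_intros) (use w0 in \<open>auto simp: U_def algebra_simps\<close>)
    have in_U: "1 \<in> U" using dist Re_pos_not_nonpos_Int[of 1] by (auto simp: U_def)
    have "residue F 1 = Gamma 1 * w powr (- 1) * zeta (1 - b)"
      unfolding Fe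
    proof (rule residue_simple_pole_zeta[OF U in_U])
      show "(\<lambda>s. Gamma s * w powr - s * zeta (s - b) * zeta (s - 1 + 1)) holomorphic_on U - {1}"
        by (rule holomorphic_on_mult[OF holomorphic_on_subset[OF h] zeta_holomorphic]) (auto intro!: holomorphic_intros)
      show "isCont (\<lambda>s. Gamma s * w powr - s * zeta (s - b)) 1"
        by (rule isCont_holomorphic[OF h U in_U])
    qed
    thus ?thesis using w0 by (simp add: powr_minus_divide)
  qed
  have res2: "residue F (1 + b) = Gamma (1 + b) * zeta (1 + b) * w powr (- (1 + b))"
  proof -
    define U where "U = - (\<int>\<^sub>\<le>\<^sub>0 \<union> {1 :: complex})"
    have U: "open U" unfolding U_def Compl_Un
      by (intro open_Int closed_Ints_sub) auto
    have Fe: "F = (\<lambda>s. Gamma s * w powr (- s) * zeta s * zeta (s - (1 + b) + 1))"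
      by (simp add: F_def fun_eq_iff)
    have h: "(\<lambda>s. Gamma s * w powr (- s) * zeta s) holomorphic_on U"
      by (intro holomorphic_intros) (use w0 in \<open>auto simp: U_def\<close>)
    have in_U: "1 + b \<in> U" using b1 nonpos_Ints_subset_Ints by (auto simp: U_def)
    have "residue F (1 + b) = Gamma (1 + b) * w powr (- (1 + b)) * zeta (1 + b)"
      unfolding Fe
    proof (rule residue_simple_pole_zeta[OF U in_U])
      show "(\<lambda>s. Gamma s * w powr - s * zeta s * zeta (s - (1 + b) + 1)) holomorphic_on U - {1 + b}"
        by (rule holomorphic_on_mult[OF holomorphic_on_subset[OF h] zeta_holomorphic])
           (auto intro!: holomorphic_intros simp: algebra_simps)
      show "isCont (\<lambda>s. Gamma s * w powr - s * zeta s) (1 + b)"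
        by (rule isCont_holomorphic[OF h U in_U])
    qed
    thus ?thesis by (simp add: mult_ac)
  qed
  have res3: "residue F (- of_nat k) = bern_coeff (Suc k) * zeta (- of_nat k - b) * w ^ k" for k
  proof -
    define U where "U = - ((\<int>\<^sub>\<le>\<^sub>0 - {- of_nat k}) \<union> {1, 1 + b :: complex})"
    have U: "open U" unfolding U_def
      using nonpos_Ints_subset_Ints by (intro open_Compl[OF closed_Un[OF closed_subset_Ints finite_imp_closed]]) auto
    have Fe: "F = (\<lambda>s. Gamma s * (w powr (- s) * (zeta s * zeta (s - b))))"
      by (simp add: F_def fun_eq_iff mult.assoc)
    have h: "(\<lambda>s. w powr (- s) * (zeta s * zeta (s - b))) holomorphic_on U"
      by (intro holomorphic_intros) (use w0 in \<open>auto simp: U_def algebra_simps\<close>)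
    have in_U: "- of_nat k \<in> U"
    proof -
      have "- of_nat k \<noteq> (1 :: complex)" using Re_pos_not_nonpos_Int[of 1] nat_Z(2)[of k] by force
      moreover have "- of_nat k \<noteq> 1 + b" using b1 nat_Z(1)[of k] by metis
      ultimately show ?thesis by (simp add: U_def)
    qed
    have "residue F (- of_nat k) = (-1) ^ k / fact k * (w powr (- (- of_nat k)) * (zeta (- of_nat k) * zeta (- of_nat k - b)))"
      unfolding Fe
    proof (rule residue_mult_Gamma[OF U in_U])
      show "(\<lambda>s. Gamma s * (w powr - s * (zeta s * zeta (s - b)))) holomorphic_on U - {- of_nat k}"
        by (intro holomorphic_on_mult holomorphic_on_subset[OF h] holomorphic_Gamma) (auto simp: U_def)
      show "isCont (\<lambda>s. w powr - s * (zeta s * zeta (s - b))) (- of_nat k)"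
        by (rule isCont_holomorphic[OF h U in_U])
    qed
    also have "w powr (- (- of_nat k)) = w ^ k" using w0 by (simp add: powr_nat)
    \<comment> \<open>The value of zeta at -k brings k! and a sign, which cancel those of the
      residue of Gamma.\<close>
    finally show ?thesis by (simp add: zeta_minus_of_nat flip: power_mult_distrib)
  qed
  have "(\<Sum>p\<in>pts. residue F p) = residue F 1 + (residue F (1 + b) + (\<Sum>p\<in>N. residue F p))"
    using dist fin by (simp add: pts_def)
  also have "(\<Sum>p\<in>N. residue F p) = (\<Sum>k\<le>2 * M. bern_coeff (Suc k) * zeta (- of_nat k - b) * w ^ k)"
    unfolding N_def by (subst sum.reindex) (auto simp: inj_on_def res3)
  finally have sum: "(\<Sum>p\<in>pts. residue F p) = zeta (1 - b) / w + Gamma (1 + b) * zeta (1 + b) * w powr (- (1 + b))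
        + (\<Sum>k\<le>2 * M. bern_coeff (Suc k) * zeta (- of_nat k - b) * w ^ k)" by (simp add: res1 res2)
  have "vline_integral c F = 2 * of_real pi * \<i> * div_series b z"
    unfolding F_def w_def using b(2) by (intro div_series_mellin z) (auto simp: c_def)
  thus "2 * of_real pi * \<i> * div_series b z = vline_integral (- 1/2 - 2 * real M) F
     + 2 * of_real pi * \<i> * (zeta (1 - b) / w + Gamma (1 + b) * zeta (1 + b) * w powr (- (1 + b))
        + (\<Sum>k\<le>2 * M. bern_coeff (Suc k) * zeta (- of_nat k - b) * w ^ k))"
    using shift(3) by (simp add: sum c'_def)
qed

subsection \<open>The two Eisenstein series on the shifted line\<close>

text \<open>By the functional equation this is the integrand of the theorem without its removable
  singularities; it is symmetric under the reflection of \<^term>\<open>s\<close> to \<^term>\<open>1 + b - s\<close> up to the power of \<^term>\<open>z\<close>.\<close>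
definition reg_kernel :: "complex \<Rightarrow> complex \<Rightarrow> complex \<Rightarrow> complex" where
  "reg_kernel b z s = 2 * cos (of_real pi * b / 2) * of_real (2 * pi) powr (- 1 - b) * z powr (- s)
     * (Gamma s * zeta s) * (Gamma (1 + b - s) * zeta (1 + b - s))"

text \<open>The functional equation at u = 1 + b - s expresses zeta (s - b) with the factor cos (pi
  u / 2) = sin (pi (s - b) / 2), which is precisely the denominator of the kernel.\<close>

lemma mellin_kernel_eq_reg_kernel:
  assumes "Re (s - b) < 0" "sin (of_real pi * (s - b) / 2) \<noteq> 0"
  shows "mellin_kernel b z s = reg_kernel b z s"
proof -
  define u where "u = 1 + b - s"
  have u: "Re u > 1" using assms(1) by (simp add: u_def)
  have "zeta (1 - u) = 2 * of_real (2 * pi) powr (- u) * cos (of_real pi * u / 2) * Gamma u * zeta u"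
    using u by (intro zeta_functional Re_pos_not_nonpos_Int) auto
  moreover have "1 - u = s - b" by (simp add: u_def)
  moreover have "cos (of_real pi * u / 2) = sin (of_real pi * (s - b) / 2)"
  proof -
    have "of_real pi * u / 2 = of_real pi / 2 - of_real pi * (s - b) / 2"
      by (simp add: u_def field_simps)
    thus ?thesis by (simp only: cos_diff) simp
  qed
  ultimately have z1: "zeta (s - b) = 2 * of_real (2 * pi) powr (- u) * sin (of_real pi * (s - b) / 2) * Gamma u * zeta u"
    by simp
  have p: "(2 * of_real pi * z) powr (- s) = of_real (2 * pi) powr (- s) * z powr (- s)"
    using powr_times_real_left[of "of_real (2 * pi)" z "- s"] by simp
  have q: "of_real (2 * pi) powr (- u) * of_real (2 * pi) powr (- s) = (of_real (2 * pi) powr (- 1 - b) :: complex)"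
    by (subst powr_add[symmetric]) (simp add: u_def)
  have "mellin_kernel b z s = zeta s * (2 * of_real (2 * pi) powr (- u) * sin (of_real pi * (s - b) / 2) * Gamma u * zeta u) * Gamma s
       * (cos (of_real pi * b / 2) / sin (of_real pi * (s - b) / 2)) * (of_real (2 * pi) powr (- s) * z powr (- s))"
    unfolding mellin_kernel_def z1 p ..
  also have "\<dots> = 2 * cos (of_real pi * b / 2) * (of_real (2 * pi) powr (- u) * of_real (2 * pi) powr (- s)) * z powr (- s)
     * (Gamma s * zeta s) * (Gamma u * zeta u) * (sin (of_real pi * (s - b) / 2) / sin (of_real pi * (s - b) / 2))"
    by (simp only: times_divide_eq_left times_divide_eq_right mult_ac)
  also have "\<dots> = reg_kernel b z s"
    unfolding q using assms(2) by (simp add: reg_kernel_def u_def)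
  finally show ?thesis .
qed

lemma half_line_not_int: "Complex (- 1/2 - 2 * real M) t \<notin> \<int>"
proof
  assume "Complex (- 1/2 - 2 * real M) t \<in> \<int>"
  then obtain n where "Complex (- 1/2 - 2 * real M) t = of_int n" by (elim Ints_cases)
  hence "- 1/2 - 2 * real M = real_of_int n" by (simp add: complex_eq_iff)
  hence "real_of_int (- (4 * int M + 1)) = real_of_int (2 * n)" by simp
  hence "- (4 * int M + 1) = 2 * n" by (simp only: of_int_eq_iff)
  thus False by presburger
qed

lemma continuous_on_reg_kernel:
  assumes "Re b > - 2 * real M - 1/2" "z \<notin> \<real>\<^sub>\<le>\<^sub>0"
  shows "continuous_on UNIV (\<lambda>t. reg_kernel b z (Complex (- 1/2 - 2 * real M) t))"
proof -
  let ?X = "- \<int> \<inter> {s. Re s < Re b}"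
  have X: "s \<notin> \<int>\<^sub>\<le>\<^sub>0" "s \<noteq> 1" "1 + b - s \<notin> \<int>\<^sub>\<le>\<^sub>0" "1 + b - s \<noteq> 1" if s: "s \<in> ?X" for s
  proof -
    show "s \<notin> \<int>\<^sub>\<le>\<^sub>0" "s \<noteq> 1" using s nonpos_Ints_subset_Ints by auto
    have "Re (1 + b - s) > 1" using s by simp
    thus "1 + b - s \<notin> \<int>\<^sub>\<le>\<^sub>0" "1 + b - s \<noteq> 1" using Re_pos_not_nonpos_Int[of "1 + b - s"] by auto
  qed
  have "(\<lambda>s. reg_kernel b z s) holomorphic_on ?X"
    unfolding reg_kernel_def by (intro holomorphic_intros) (use assms in \<open>auto simp: X simp del: Int_iff Compl_iff\<close>)
  hence "continuous_on ?X (\<lambda>s. reg_kernel b z s)" by (rule holomorphic_on_imp_continuous_on)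
  thus ?thesis
  proof (rule continuous_on_compose2)
    show "continuous_on UNIV (Complex (- 1/2 - 2 * real M))" by (auto simp: Complex_eq intro!: continuous_intros)
    show "range (Complex (- 1/2 - 2 * real M)) \<subseteq> ?X" using half_line_not_int assms(1) by auto
  qed
qed

text \<open>The sine vanishes only at real arguments, so on a vertical line its zeros can occur only
  at height \<open>Im b\<close>.\<close>

lemma mellin_kernel_off_diagonal:
  assumes "Re b > c" "t \<noteq> Im b"
  shows "mellin_kernel b z (Complex c t) = reg_kernel b z (Complex c t)"
proof -
  show ?thesis
  proof (rule mellin_kernel_eq_reg_kernel)
    show "Re (Complex c t - b) < 0" using assms by simp
    show "sin (of_real pi * (Complex c t - b) / 2) \<noteq> 0"
    proof
      assume "sin (of_real pi * (Complex c t - b) / 2) = 0"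
      then obtain x where "of_real pi * (Complex c t - b) / 2 = of_real x"
        unfolding sin_eq_0 by blast
      hence "Im (of_real pi * (Complex c t - b) / 2) = 0" by (simp only: Im_complex_of_real)
      hence "t = Im b" by simp
      thus False using assms(2) by simp
    qed
  qed
qed

text \<open>At the exceptional height the kernel may take the default value of a division by 0
  instead of its limit; a single point does not affect the integral.\<close>

lemma mellin_kernel_integral:
  assumes b: "Re b > - 2 * real M - 1/2" and z: "z \<notin> \<real>\<^sub>\<le>\<^sub>0"
  defines "c \<equiv> - 1/2 - 2 * real M"
  shows "(\<integral>t. mellin_kernel b z (Complex c t) \<partial>lborel) = (\<integral>t. reg_kernel b z (Complex c t) \<partial>lborel)"
    and "integrable lborel (\<lambda>t. mellin_kernel b z (Complex c t)) \<longleftrightarrow> integrable lborel (\<lambda>t. reg_kernel b z (Complex c t))"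
proof -
  have c: "Re b > c" using b by (simp add: c_def)
  have m: "(\<lambda>t. reg_kernel b z (Complex c t)) \<in> borel_measurable borel"
    unfolding c_def by (rule borel_measurable_continuous_onI[OF continuous_on_reg_kernel[OF b z]])
  have eq: "(\<lambda>t. mellin_kernel b z (Complex c t)) = (\<lambda>t. if t = Im b then mellin_kernel b z (Complex c (Im b)) else reg_kernel b z (Complex c t))"
    using mellin_kernel_off_diagonal[OF c] by auto
  have m': "(\<lambda>t. mellin_kernel b z (Complex c t)) \<in> borel_measurable borel"
    unfolding eq using m by measurable
  have ae: "AE t in lborel. mellin_kernel b z (Complex c t) = reg_kernel b z (Complex c t)"
    using AE_lborel_singleton[of "Im b"] by eventually_elim (rule mellin_kernel_off_diagonal[OF c])
  show "(\<integral>t. mellin_kernel b z (Complex c t) \<partial>lborel) = (\<integral>t. reg_kernel b z (Complex c t) \<partial>lborel)"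
    using m m' ae by (intro integral_cong_AE) auto
  show "integrable lborel (\<lambda>t. mellin_kernel b z (Complex c t)) \<longleftrightarrow> integrable lborel (\<lambda>t. reg_kernel b z (Complex c t))"
    using m m' ae by (intro integrable_cong_AE) auto
qed

text \<open>The argument of z lies strictly between 0 and pi, so a quarter turn stays in the
  principal range and no multiple of 2 pi i arises.\<close>

lemma Ln_minus_ii_times:
  assumes "Im z > 0"
  shows "Ln (- (\<i> * z)) = Ln z - \<i> * of_real (pi / 2)" "Ln (\<i> / z) = \<i> * of_real (pi / 2) - Ln z"
proof -
  have z: "z \<noteq> 0" using assms by auto
  have Im: "0 < Im (Ln z)" "Im (Ln z) < pi" using Im_Ln_pos_lt_imp[OF assms] by auto
  have e: "exp (\<i> * of_real (pi / 2)) = \<i>" by (simp only: exp_Euler cos_of_real sin_of_real) simp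
  have "exp (Ln z - \<i> * of_real (pi / 2)) = - (\<i> * z)"
    unfolding exp_diff e using z by (simp add: field_simps)
  thus "Ln (- (\<i> * z)) = Ln z - \<i> * of_real (pi / 2)"
    using Im by (intro Ln_unique) auto
  have "exp (\<i> * of_real (pi / 2) - Ln z) = \<i> / z"
    unfolding exp_diff e using z by simp
  thus "Ln (\<i> / z) = \<i> * of_real (pi / 2) - Ln z"
    using Im by (intro Ln_unique) auto
qed

lemma rotated_powr:
  assumes "Im z > 0"
  shows "(- (2 * of_real pi * \<i> * z)) powr x = of_real (2 * pi) powr x * z powr x * exp (- (\<i> * (of_real pi * x / 2)))"
    and "(- (2 * of_real pi * \<i> * (- (1 / z)))) powr x = of_real (2 * pi) powr x * z powr (- x) * exp (\<i> * (of_real pi * x / 2))"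
proof -
  have z: "z \<noteq> 0" using assms by auto
  have "(of_real (2 * pi) * (- (\<i> * z))) powr x = of_real (2 * pi) powr x * (- (\<i> * z)) powr x"
    by (rule powr_times_real_left) auto
  also have "(- (\<i> * z)) powr x = z powr x * exp (- (\<i> * (of_real pi * x / 2)))"
    using z by (simp add: powr_def Ln_minus_ii_times[OF assms] algebra_simps flip: exp_add)
  finally show "(- (2 * of_real pi * \<i> * z)) powr x = of_real (2 * pi) powr x * z powr x * exp (- (\<i> * (of_real pi * x / 2)))"
    by (simp add: mult_ac)
  have "(of_real (2 * pi) * (\<i> / z)) powr x = of_real (2 * pi) powr x * (\<i> / z) powr x"
    by (rule powr_times_real_left) auto
  also have "(\<i> / z) powr x = z powr (- x) * exp (\<i> * (of_real pi * x / 2))"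
    using z by (simp add: powr_def Ln_minus_ii_times[OF assms] algebra_simps flip: exp_add)
  finally show "(- (2 * of_real pi * \<i> * (- (1 / z)))) powr x = of_real (2 * pi) powr x * z powr (- x) * exp (\<i> * (of_real pi * x / 2))"
    by (simp add: mult_ac)
qed

text \<open>Applying the functional equation to zeta (s - b) and to zeta (u - b) = zeta (1 - s)
  gives both integrands the same Gamma and zeta factors. With U = pi u / 2 and S = pi s / 2 the rest
  is cos U exp (i S) - exp (-i U) cos S = i sin (U + S), and U + S does not depend on s: the growing
  exponentials cancel.\<close>

lemma reg_kernel_split:
  fixes b z s :: complex
  assumes z: "Im z > 0" and u: "u = 1 + b - s" "Re u > 1" and s: "s \<notin> \<int>\<^sub>\<le>\<^sub>0" "s \<noteq> 1"
  shows "Gamma s * (- (2 * of_real pi * \<i> * z)) powr (- s) * (zeta s * zeta (s - b))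
       - 1 / z powr (b + 1) * (Gamma u * (- (2 * of_real pi * \<i> * (- (1 / z)))) powr (- u) * (zeta u * zeta (u - b)))
     = \<i> * reg_kernel b z s"
proof -
  let ?T = "of_real (2 * pi) :: complex"
  let ?U = "of_real pi * u / 2" and ?S = "of_real pi * s / 2"
  have z0: "z \<noteq> 0" using z by auto
  have z1: "zeta (s - b) = 2 * ?T powr (- u) * cos ?U * Gamma u * zeta u"
  proof -
    have "zeta (1 - u) = 2 * ?T powr (- u) * cos ?U * Gamma u * zeta u"
      using u(2) by (intro zeta_functional Re_pos_not_nonpos_Int) auto
    thus ?thesis by (simp add: u(1))
  qed
  have z2: "zeta (u - b) = 2 * ?T powr (- s) * cos ?S * Gamma s * zeta s"
  proof -
    have "u - b = 1 - s" by (simp add: u(1))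
    thus ?thesis using zeta_functional[OF s] by (simp only:)
  qed
  have p1: "(- (2 * of_real pi * \<i> * z)) powr (- s) = ?T powr (- s) * z powr (- s) * exp (\<i> * ?S)"
    using rotated_powr(1)[OF z, of "- s"] by simp
  have p2: "(- (2 * of_real pi * \<i> * (- (1 / z)))) powr (- u) = ?T powr (- u) * z powr u * exp (- (\<i> * ?U))"
    using rotated_powr(2)[OF z, of "- u"] by simp
  have T: "?T powr (- 1 - b) = ?T powr (- s) * ?T powr (- u)"
    by (subst powr_add[symmetric]) (simp add: u(1))
  have zp: "1 / z powr (b + 1) * z powr u = z powr (- s)"
  proof -
    have "z powr (- s) = z powr u / z powr (b + 1)"
      by (subst powr_diff[symmetric]) (simp add: u(1))
    thus ?thesis by simp
  qed
  have trig: "cos ?U * exp (\<i> * ?S) - exp (- (\<i> * ?U)) * cos ?S = \<i> * cos (of_real pi * b / 2)"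
  proof -
    have "cos ?U * exp (\<i> * ?S) - exp (- (\<i> * ?U)) * cos ?S = \<i> * (sin ?U * cos ?S + cos ?U * sin ?S)"
      unfolding exp_Euler exp_minus_Euler by (simp add: algebra_simps)
    also have "sin ?U * cos ?S + cos ?U * sin ?S = sin (of_real pi * b / 2 + of_real pi / 2)"
    proof -
      have "?U + ?S = of_real pi * b / 2 + of_real pi / 2" by (simp add: u(1) field_simps)
      thus ?thesis by (simp only: sin_add[symmetric])
    qed
    also have "\<dots> = cos (of_real pi * b / 2)" by (simp add: sin_add)
    finally show ?thesis .
  qed
  let ?G = "(Gamma s * zeta s) * (Gamma u * zeta u)"
  have "Gamma s * (- (2 * of_real pi * \<i> * z)) powr (- s) * (zeta s * zeta (s - b))
      = 2 * (?T powr (- s) * ?T powr (- u)) * z powr (- s) * ?G * (cos ?U * exp (\<i> * ?S))"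
    unfolding z1 p1 by (simp only: mult_ac)
  moreover have "1 / z powr (b + 1) * (Gamma u * (- (2 * of_real pi * \<i> * (- (1 / z)))) powr (- u) * (zeta u * zeta (u - b)))
      = 2 * (?T powr (- s) * ?T powr (- u)) * (1 / z powr (b + 1) * z powr u) * ?G * (exp (- (\<i> * ?U)) * cos ?S)"
    unfolding z2 p2 by (simp only: mult_ac)
  ultimately have "Gamma s * (- (2 * of_real pi * \<i> * z)) powr (- s) * (zeta s * zeta (s - b))
       - 1 / z powr (b + 1) * (Gamma u * (- (2 * of_real pi * \<i> * (- (1 / z)))) powr (- u) * (zeta u * zeta (u - b)))
     = 2 * ?T powr (- 1 - b) * z powr (- s) * ?G * (cos ?U * exp (\<i> * ?S) - exp (- (\<i> * ?U)) * cos ?S)"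
    unfolding T zp by (simp only: right_diff_distrib)
  thus ?thesis unfolding trig by (simp add: reg_kernel_def u(1) mult_ac)
qed

text \<open>Only the integral for z is moved across poles. The one for -1 / z stays on its line of
  absolute convergence, which the reflection maps onto the shifted line, so the residues enter
  once.\<close>

lemma div_series_period:
  fixes b z :: complex and M :: nat
  assumes b: "b \<notin> \<int>" "Re b > - 2 * real M - 1/2" and z: "Im z > 0"
  defines "w \<equiv> - (2 * of_real pi * \<i> * z)"
  shows "div_series b z - 1 / z powr (b + 1) * div_series b (- (1 / z))
    = vline_integral (- 1/2 - 2 * real M) (mellin_kernel b z) / (2 * of_real pi)
     + (zeta (1 - b) / w + Gamma (1 + b) * zeta (1 + b) * w powr (- (1 + b))
        + (\<Sum>k\<le>2 * M. bern_coeff (Suc k) * zeta (- of_nat k - b) * w ^ k))"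
proof -
  define c c' where "c = Re b + 3/2 + 2 * real M" and "c' = - 1/2 - 2 * real M"
  define R where "R = zeta (1 - b) / w + Gamma (1 + b) * zeta (1 + b) * w powr (- (1 + b))
        + (\<Sum>k\<le>2 * M. bern_coeff (Suc k) * zeta (- of_nat k - b) * w ^ k)"
  define F where "F = (\<lambda>z s. Gamma s * (- (2 * of_real pi * \<i> * z)) powr (- s) * (zeta s * zeta (s - b)))"
  define z' where "z' = - (1 / z)"
  have z': "Im z' > 0" using z by (auto simp: z'_def Im_divide intro!: divide_pos_pos add_nonneg_pos)
  note A = mellin_shift[OF b z, folded w_def, folded R_def]
  have A1: "integrable lborel (\<lambda>t. F z (Complex c' t))"
    and A3: "2 * of_real pi * \<i> * div_series b z = vline_integral c' (F z) + 2 * of_real pi * \<i> * R"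
    using A(1,3) unfolding F_def w_def c'_def by simp_all
  have B: "integrable lborel (\<lambda>t. F z' (Complex c t))"
    using mellin_shift(2)[OF b z'] by (simp add: F_def c_def)
  have c'eq: "c' = Re (1 + b) - c" by (simp add: c_def c'_def)
  have B1: "integrable lborel (\<lambda>t. F z' (1 + b - Complex c' t))"
    using integrable_vline_reflect[OF B, of "1 + b"] by (simp only: c'eq)
  have "2 * of_real pi * \<i> * div_series b z' = vline_integral c (F z')"
    unfolding F_def using b(2) by (intro div_series_mellin[symmetric] z') (auto simp: c_def)
  also have "\<dots> = vline_integral c' (\<lambda>s. F z' (1 + b - s))"
    using vline_integral_reflect[of c "F z'" "1 + b"] by (simp only: c'eq)
  finally have B3: "2 * of_real pi * \<i> * div_series b z' = vline_integral c' (\<lambda>s. F z' (1 + b - s))" .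
  have "(\<integral>t. F z (Complex c' t) \<partial>lborel) - 1 / z powr (b + 1) * (\<integral>t. F z' (1 + b - Complex c' t) \<partial>lborel)
      = (\<integral>t. F z (Complex c' t) \<partial>lborel) - (\<integral>t. 1 / z powr (b + 1) * F z' (1 + b - Complex c' t) \<partial>lborel)"
    by (simp only: integral_mult_right_zero)
  also have "\<dots> = (\<integral>t. F z (Complex c' t) - 1 / z powr (b + 1) * F z' (1 + b - Complex c' t) \<partial>lborel)"
    by (intro Bochner_Integration.integral_diff[symmetric] A1 integrable_mult_right B1)
  also have "\<dots> = (\<integral>t. \<i> * reg_kernel b z (Complex c' t) \<partial>lborel)"
  proof (intro Bochner_Integration.integral_cong refl)
    fix t
    have "Complex c' t \<notin> \<int>" unfolding c'_def by (rule half_line_not_int)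
    hence "Complex c' t \<notin> \<int>\<^sub>\<le>\<^sub>0" "Complex c' t \<noteq> 1" using nonpos_Ints_subset_Ints by auto
    moreover have "Re (1 + b - Complex c' t) > 1" using b(2) by (simp add: c'_def)
    ultimately show "F z (Complex c' t) - 1 / z powr (b + 1) * F z' (1 + b - Complex c' t) = \<i> * reg_kernel b z (Complex c' t)"
      unfolding F_def z'_def by (intro reg_kernel_split[OF z refl])
  qed
  also have "\<dots> = \<i> * (\<integral>t. reg_kernel b z (Complex c' t) \<partial>lborel)"
    by (rule integral_mult_right_zero)
  also have "(\<integral>t. reg_kernel b z (Complex c' t) \<partial>lborel) = (\<integral>t. mellin_kernel b z (Complex c' t) \<partial>lborel)"
    using b(2) z unfolding c'_def
    by (intro mellin_kernel_integral(1)[symmetric]) (auto simp: complex_nonpos_Reals_iff)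
  finally have D: "vline_integral c' (F z) - 1 / z powr (b + 1) * vline_integral c' (\<lambda>s. F z' (1 + b - s)) = \<i> * vline_integral c' (mellin_kernel b z)"
    unfolding vline_integral_def by (simp add: algebra_simps)
  have "2 * of_real pi * \<i> * (div_series b z - 1 / z powr (b + 1) * div_series b z')
     = 2 * of_real pi * \<i> * div_series b z - 1 / z powr (b + 1) * (2 * of_real pi * \<i> * div_series b z')"
    by (simp add: algebra_simps)
  also have "\<dots> = \<i> * vline_integral c' (mellin_kernel b z) + 2 * of_real pi * \<i> * R"
    unfolding A3 B3 using D by simp
  also have "\<dots> = 2 * of_real pi * \<i> * (vline_integral c' (mellin_kernel b z) / (2 * of_real pi) + R)"
    by (simp add: field_simps)
  finally have "div_series b z - 1 / z powr (b + 1) * div_series b z' = vline_integral c' (mellin_kernel b z) / (2 * of_real pi) + R"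
    by simp
  thus ?thesis by (simp only: R_def z'_def c'_def)
qed

text \<open>Even indices k > 0 drop out because the odd Bernoulli numbers beyond the first are 0; k
  = 0 gives -zeta (-b) / 2, and for k = 2n - 1 the power of -i x is i (-1)^n x^k.\<close>

lemma residue_sum_eq:
  "(\<Sum>k\<le>2 * M. bern_coeff (Suc k) * zeta (- of_nat k - b) * (- (\<i> * x)) ^ k)
    = - zeta (- b) / 2 + \<i> * (\<Sum>n=1..M. (-1) ^ n * bern_coeff (2 * n) * zeta (1 - 2 * of_nat n - b) * x ^ (2 * n - 1))"
proof (induction M)
  case (Suc M)
  have "2 * Suc M = Suc (Suc (2 * M))" by simp
  hence "(\<Sum>k\<le>2 * Suc M. bern_coeff (Suc k) * zeta (- of_nat k - b) * (- (\<i> * x)) ^ k)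
    = (\<Sum>k\<le>2 * M. bern_coeff (Suc k) * zeta (- of_nat k - b) * (- (\<i> * x)) ^ k)
     + bern_coeff (2 * Suc M) * zeta (- of_nat (Suc (2 * M)) - b) * (- (\<i> * x)) ^ (Suc (2 * M))
     + bern_coeff (Suc (2 * Suc M)) * zeta (- of_nat (2 * Suc M) - b) * (- (\<i> * x)) ^ (2 * Suc M)"
    by (simp del: of_nat_Suc)
  also have "bern_coeff (Suc (2 * Suc M)) = 0" by (rule bern_coeff_odd) simp
  also have "(- (\<i> * x)) ^ (Suc (2 * M)) = \<i> * (-1) ^ Suc M * x ^ (2 * Suc M - 1)"
  proof -
    have "(- (\<i> * x)) ^ (2 * M) = ((- (\<i> * x))\<^sup>2) ^ M" by (rule power_mult)
    also have "(- (\<i> * x))\<^sup>2 = - (x\<^sup>2)" by (simp add: power_mult_distrib)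
    also have "\<dots> ^ M = (-1) ^ M * x ^ (2 * M)" by (simp add: power_minus[of "x\<^sup>2"] power_mult)
    finally show ?thesis by simp
  qed
  also have "- of_nat (Suc (2 * M)) - b = 1 - 2 * of_nat (Suc M) - b" by simp
  finally show ?case unfolding Suc.IH by (simp add: algebra_simps)
qed simp

text \<open>After multiplication by 2 / zeta (-b) the residue at 0 becomes -1 and part of the
  residue at 1 + b becomes z^(-1-b). These cancel the constant terms of the two Eisenstein series,
  and the cotangent is what remains at 1 + b.\<close>

theorem period_fun_eq_period_rep:
  assumes b: "b \<notin> \<int>" "Re b > - 2 * real M - 1/2" "zeta (- b) \<noteq> 0" and z: "Im z > 0"
  shows "period_fun b z = period_rep M b z"
proof -
  define Z where "Z = zeta (- b)"
  define w where "w = - (2 * of_real pi * \<i> * z)"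
  define p where "p = z powr (1 + b)"
  define V where "V = vline_integral (- 1/2 - 2 * real M) (mellin_kernel b z)"
  define \<Sigma> where "\<Sigma> = (\<Sum>n=1..M. (-1) ^ n * bern_coeff (2 * n) * zeta (1 - 2 * of_nat n - b) * (2 * of_real pi * z) ^ (2 * n - 1))"
  let ?c = "cot (of_real pi * b / 2)"
  have z0: "z \<noteq> 0" using z by auto
  have p0: "p \<noteq> 0" using z0 by (simp add: p_def)
  have pb: "z powr (b + 1) = p" by (simp add: p_def add.commute)
  have Z0: "Z \<noteq> 0" using b(3) by (simp add: Z_def)
  have weq: "w = - (\<i> * (2 * of_real pi * z))" by (simp add: w_def)
  have sinb: "sin (of_real pi * b / 2) \<noteq> 0"
  proof
    assume "sin (of_real pi * b / 2) = 0"
    then obtain n :: int where "of_real pi * b / 2 = of_real (of_int n * pi)" by (auto simp: sin_eq_0)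
    hence "of_real pi * b = of_real pi * of_int (2 * n)" by (simp add: field_simps)
    hence "b = of_int (2 * n)" by (simp only: mult_cancel_left of_real_eq_0_iff) simp
    thus False using b(1) by (metis Ints_of_int)
  qed
  \<comment> \<open>The functional equation at 1 + b turns the residue into a multiple of Z; the
    rotation of the power by a right angle supplies the cosine over the sine.\<close>
  have G: "Gamma (1 + b) * zeta (1 + b) * w powr (- (1 + b)) = Z / 2 * (1 / p * (1 - \<i> * ?c))"
  proof -
    have nb: "1 + b \<notin> \<int>" using b(1) Ints_diff[of "1 + b" 1] by auto
    hence "1 + b \<notin> \<int>\<^sub>\<le>\<^sub>0" "1 + b \<noteq> 1" using nonpos_Ints_subset_Ints by (blast, metis Ints_1)
    from zeta_functional[OF this]
    have Zeq: "Z = 2 * of_real (2 * pi) powr (- (1 + b)) * cos (of_real pi * (1 + b) / 2) * Gamma (1 + b) * zeta (1 + b)"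
      by (simp add: Z_def)
    have "cos (of_real pi * (1 + b) / 2) = cos (of_real pi * b / 2 + of_real pi / 2)" by (simp add: field_simps)
    also have "\<dots> = - sin (of_real pi * b / 2)" by (simp add: cos_add)
    finally have co: "cos (of_real pi * (1 + b) / 2) = - sin (of_real pi * b / 2)" .
    have "w powr (- (1 + b)) = of_real (2 * pi) powr (- (1 + b)) * z powr (- (1 + b)) * exp (- (\<i> * (of_real pi * (- (1 + b)) / 2)))"
      unfolding w_def by (rule rotated_powr(1)[OF z])
    also have "z powr (- (1 + b)) = 1 / p" by (simp only: p_def powr_minus_divide)
    also have "exp (- (\<i> * (of_real pi * (- (1 + b)) / 2))) = \<i> * (cos (of_real pi * b / 2) + \<i> * sin (of_real pi * b / 2))"
    proof -
      have "- (\<i> * (of_real pi * (- (1 + b)) / 2)) = \<i> * (of_real pi * b / 2) + \<i> * (of_real pi / 2)" by (simp add: field_simps)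
      hence "exp (- (\<i> * (of_real pi * (- (1 + b)) / 2))) = exp (\<i> * (of_real pi * b / 2)) * exp (\<i> * (of_real pi / 2))"
        by (simp only: exp_add)
      thus ?thesis by (simp only: exp_Euler) simp
    qed
    finally have we: "w powr (- (1 + b)) = of_real (2 * pi) powr (- (1 + b)) * (1 / p) * (\<i> * (cos (of_real pi * b / 2) + \<i> * sin (of_real pi * b / 2)))" .
    define X where "X = of_real (2 * pi) powr (- (1 + b)) * Gamma (1 + b) * zeta (1 + b)"
    have "Z = 2 * X * (- sin (of_real pi * b / 2))" unfolding Zeq co X_def by (simp only: mult_ac)
    moreover have "Gamma (1 + b) * zeta (1 + b) * w powr (- (1 + b)) = X * (1 / p) * (\<i> * (cos (of_real pi * b / 2) + \<i> * sin (of_real pi * b / 2)))"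
      unfolding we X_def by (simp only: mult_ac)
    moreover have "X * (1 / p) * (\<i> * (C + \<i> * Sn)) = 2 * X * (- Sn) / 2 * (1 / p * (1 - \<i> * (C / Sn)))"
      if "Sn \<noteq> 0" for C Sn
    proof -
      have "2 * X * (- Sn) / 2 * (1 / p * (1 - \<i> * (C / Sn))) = X * (1 / p) * (\<i> * (C * (Sn / Sn)) - Sn)"
        by (simp add: algebra_simps)
      thus ?thesis using that by (simp add: algebra_simps)
    qed
    ultimately show ?thesis using sinb by (simp only: cot_def)
  qed
  have S: "(\<Sum>k\<le>2 * M. bern_coeff (Suc k) * zeta (- of_nat k - b) * w ^ k) = - Z / 2 + \<i> * \<Sigma>"
    unfolding weq residue_sum_eq Z_def \<Sigma>_def ..
  have D: "div_series b z - 1 / p * div_series b (- (1 / z)) = V / (2 * of_real pi) + (zeta (1 - b) / w + Z / 2 * (1 / p * (1 - \<i> * ?c)) + (- Z / 2 + \<i> * \<Sigma>))"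
    using div_series_period[OF b(1,2) z] unfolding w_def[symmetric] G S pb V_def .
  have "period_fun b z = 1 - 1 / p + 2 / Z * (div_series b z - 1 / p * div_series b (- (1 / z)))"
    unfolding period_fun_def eisenstein_def pb Z_def by (simp add: algebra_simps)
  also have "\<dots> = \<i> / (of_real pi * z) * (zeta (1 - b) / Z) - \<i> / p * ?c + \<i> * ((2 * \<Sigma> + 1 / (of_real pi * \<i>) * V) / Z)"
    unfolding D weq using Z0 p0 z0 by (simp add: divide_simps) (simp add: algebra_simps)?
  also have "2 * \<Sigma> + 1 / (of_real pi * \<i>) * V = g_fun M b z"
    unfolding g_fun_def V_def \<Sigma>_def bernoulli_conv_coeff ..
  finally show ?thesis unfolding period_rep_def Z_def p_def .
qed

subsection \<open>Bounds for the regularised kernel\<close>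

lemma norm_zeta_right_le:
  assumes "Re u \<ge> 1 + d" "d > 0"
  shows "norm (zeta u) \<le> (\<Sum>n. real (Suc n) powr (- (1 + d)))"
proof -
  have u: "Re u > 1" using assms by simp
  have summ: "summable (\<lambda>n. real (Suc n) powr (- (1 + d)))" using assms by (intro summable_Suc_powr) simp
  have "norm (\<Sum>n. 1 / of_nat (Suc n) powr u :: complex) \<le> (\<Sum>n. real (Suc n) powr (- (1 + d)))"
  proof (rule norm_suminf_le[OF _ summ])
    fix n show "norm (1 / of_nat (Suc n) powr u :: complex) \<le> real (Suc n) powr (- (1 + d))"
      unfolding norm_dirichlet_term using assms by (intro powr_mono) auto
  qed
  thus ?thesis using zeta_sums[OF u] by (simp add: sums_iff)
qed

text \<open>Staying at distance \<open>d\<close> from the pole of zeta allows a bound valid down to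
  the real axis and uniform in \<open>u\<close>, as needed when the parameter varies.\<close>

lemma Gamma_zeta_right_bound:
  assumes "d > 0" "e > 0"
  shows "\<exists>C\<ge>0. \<forall>u. 1 + d \<le> Re u \<and> Re u \<le> B \<longrightarrow> norm (Gamma u * zeta u) \<le> C * exp ((- (pi / 2) + e) * \<bar>Im u\<bar>)"
proof -
  define K where "K = (\<Sum>n. real (Suc n) powr (- (1 + d)))"
  have K0: "K \<ge> 0" unfolding K_def using assms by (intro suminf_nonneg summable_Suc_powr) auto
  obtain C where C: "C \<ge> 0" "\<And>s. 1/2 \<le> Re s \<and> Re s \<le> B \<Longrightarrow> norm (Gamma s) \<le> C * exp ((- (pi / 2) + e) * \<bar>Im s\<bar>)"
    using norm_Gamma_right_bound[OF assms(2)] by blast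
  have "norm (Gamma u * zeta u) \<le> (C * K) * exp ((- (pi / 2) + e) * \<bar>Im u\<bar>)" if "1 + d \<le> Re u" "Re u \<le> B" for u
  proof -
    have "norm (Gamma u * zeta u) \<le> (C * exp ((- (pi / 2) + e) * \<bar>Im u\<bar>)) * K"
      unfolding norm_mult K_def using that assms C(1)
      by (intro mult_mono C(2) norm_zeta_right_le) auto
    thus ?thesis by (simp add: mult_ac)
  qed
  thus ?thesis using C(1) K0 by (intro exI[of _ "C * K"]) auto
qed

lemma Gamma_zeta_line_bound:
  assumes "e > 0"
  shows "\<exists>C\<ge>0. \<forall>t. norm (Gamma (Complex (- 1/2 - 2 * real M) t) * zeta (Complex (- 1/2 - 2 * real M) t)) \<le> C * exp (- (pi / 2 - e) * \<bar>t\<bar>)"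
proof -
  define c where "c = - 1/2 - 2 * real M"
  have "strip_growth (- (pi / 2) + 0) (\<lambda>s. Gamma s * zeta s) c c"
    by (intro strip_growth_mult strip_growth_Gamma strip_growth_zeta)
  from strip_growthE[OF this assms] obtain C T where
    C: "\<And>s. c \<le> Re s \<Longrightarrow> Re s \<le> c \<Longrightarrow> \<bar>Im s\<bar> \<ge> T \<Longrightarrow> norm (Gamma s * zeta s) \<le> C * exp ((- (pi / 2) + 0 + e) * \<bar>Im s\<bar>)"
    by metis
  have "(\<lambda>s. Gamma s * zeta s) holomorphic_on - \<int>"
    by (intro holomorphic_intros) (use nonpos_Ints_subset_Ints in auto)
  hence "continuous_on (- \<int>) (\<lambda>s. Gamma s * zeta s)" by (rule holomorphic_on_imp_continuous_on)
  hence cont: "continuous_on UNIV (\<lambda>t. Gamma (Complex c t) * zeta (Complex c t))"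
  proof (rule continuous_on_compose2)
    show "continuous_on UNIV (Complex c)" by (auto simp: Complex_eq intro!: continuous_intros)
    show "range (Complex c) \<subseteq> - \<int>" unfolding c_def using half_line_not_int by auto
  qed
  have "norm (Gamma (Complex c t) * zeta (Complex c t)) \<le> C * exp (- (pi / 2 - e) * \<bar>t\<bar>)" if "\<bar>t\<bar> \<ge> T" for t
    using C[of "Complex c t"] that by simp
  from exp_bound_extend[OF cont this] show ?thesis by (simp add: c_def)
qed

text \<open>Each pair of Gamma and zeta decays at rate pi/2 up to e/2, and the power of z gives back
  |arg z|. The constant is independent of b, t and z, so the same estimate dominates in both
  variables.\<close>

lemma reg_kernel_bound:
  assumes "d > 0" "0 < e" "e < pi"
  shows "\<exists>C\<ge>0. \<forall>b t z. z \<noteq> 0 \<and> d \<le> Re b + 2 * real M + 1/2 \<and> Re b \<le> B \<longrightarrow>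
     norm (reg_kernel b z (Complex (- 1/2 - 2 * real M) t)) \<le>
       C * norm (2 * cos (of_real pi * b / 2) * of_real (2 * pi) powr (- 1 - b)) * exp (pi / 2 * \<bar>Im b\<bar>)
       * norm z powr (1/2 + 2 * real M) * exp (- (pi - \<bar>Im (Ln z)\<bar> - e) * \<bar>t\<bar>)"
proof -
  define c where "c = - 1/2 - 2 * real M"
  have e2: "e / 2 > 0" using assms by simp
  obtain C1 where C1: "C1 \<ge> 0" "\<And>t. norm (Gamma (Complex c t) * zeta (Complex c t)) \<le> C1 * exp (- (pi / 2 - e/2) * \<bar>t\<bar>)"
    using Gamma_zeta_line_bound[OF e2, of M] unfolding c_def by blast
  obtain C2 where C2: "C2 \<ge> 0" "\<And>u. 1 + d \<le> Re u \<and> Re u \<le> 1 + B - c \<Longrightarrow> norm (Gamma u * zeta u) \<le> C2 * exp ((- (pi / 2) + e/2) * \<bar>Im u\<bar>)"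
    using Gamma_zeta_right_bound[OF assms(1) e2] by blast
  have main: "norm (reg_kernel b z (Complex c t)) \<le>
       (C1 * C2) * norm (2 * cos (of_real pi * b / 2) * of_real (2 * pi) powr (- 1 - b)) * exp (pi / 2 * \<bar>Im b\<bar>)
       * norm z powr (- c) * exp (- (pi - \<bar>Im (Ln z)\<bar> - e) * \<bar>t\<bar>)"
    if z: "z \<noteq> 0" and b: "d \<le> Re b - c" "Re b \<le> B" for b t z
  proof -
    let ?A = "2 * cos (of_real pi * b / 2) * of_real (2 * pi) powr (- 1 - b) :: complex"
    let ?u = "1 + b - Complex c t"
    have h: "norm (Gamma ?u * zeta ?u) \<le> C2 * (exp (- (pi / 2 - e/2) * \<bar>t\<bar>) * exp (pi / 2 * \<bar>Im b\<bar>))"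
    proof -
      \<comment> \<open>The height of 1 + b - s is Im b - t; the coefficient is negative, so a lower
        bound for its modulus is the right one.\<close>
      have "(- (pi / 2) + e/2) * \<bar>Im ?u\<bar> \<le> (- (pi / 2) + e/2) * (\<bar>t\<bar> - \<bar>Im b\<bar>)"
        using assms by (intro mult_left_mono_neg) auto
      also have "\<dots> = - (pi / 2 - e/2) * \<bar>t\<bar> + (pi / 2 - e/2) * \<bar>Im b\<bar>" by (simp add: algebra_simps)
      also have "\<dots> \<le> - (pi / 2 - e/2) * \<bar>t\<bar> + pi / 2 * \<bar>Im b\<bar>"
        using assms by (intro add_left_mono mult_right_mono) auto
      finally have "exp ((- (pi / 2) + e/2) * \<bar>Im ?u\<bar>) \<le> exp (- (pi / 2 - e/2) * \<bar>t\<bar>) * exp (pi / 2 * \<bar>Im b\<bar>)"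
        by (simp only: exp_add[symmetric] exp_le_cancel_iff)
      hence "C2 * exp ((- (pi / 2) + e/2) * \<bar>Im ?u\<bar>) \<le> C2 * (exp (- (pi / 2 - e/2) * \<bar>t\<bar>) * exp (pi / 2 * \<bar>Im b\<bar>))"
        by (intro mult_left_mono C2)
      moreover have "norm (Gamma ?u * zeta ?u) \<le> C2 * exp ((- (pi / 2) + e/2) * \<bar>Im ?u\<bar>)"
        using b by (intro C2(2)) simp
      ultimately show ?thesis by linarith
    qed
    have p: "norm (z powr (- Complex c t)) \<le> norm z powr (- c) * exp (\<bar>Im (Ln z)\<bar> * \<bar>t\<bar>)"
    proof -
      have "norm (z powr (- Complex c t)) = norm z powr (- c) * exp (Im (Ln z) * t)"
        unfolding norm_powr_complex[OF z] by simp
      also have "\<dots> \<le> norm z powr (- c) * exp (\<bar>Im (Ln z)\<bar> * \<bar>t\<bar>)"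
        by (intro mult_left_mono) (simp_all add: abs_mult[symmetric])
      finally show ?thesis .
    qed
    have "norm (reg_kernel b z (Complex c t)) = norm ?A * norm (z powr (- Complex c t)) * norm (Gamma (Complex c t) * zeta (Complex c t)) * norm (Gamma ?u * zeta ?u)"
      unfolding reg_kernel_def by (simp only: norm_mult)
    also have "\<dots> \<le> norm ?A * (norm z powr (- c) * exp (\<bar>Im (Ln z)\<bar> * \<bar>t\<bar>)) * (C1 * exp (- (pi / 2 - e/2) * \<bar>t\<bar>)) * (C2 * (exp (- (pi / 2 - e/2) * \<bar>t\<bar>) * exp (pi / 2 * \<bar>Im b\<bar>)))"
      using C1(1) C2(1) by (intro mult_mono mult_left_mono p h C1(2) mult_nonneg_nonneg) auto
    also have "\<dots> = (C1 * C2) * norm ?A * exp (pi / 2 * \<bar>Im b\<bar>) * norm z powr (- c) * (exp (\<bar>Im (Ln z)\<bar> * \<bar>t\<bar>) * exp (- (pi / 2 - e/2) * \<bar>t\<bar>) * exp (- (pi / 2 - e/2) * \<bar>t\<bar>))"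
      by (simp only: mult_ac)
    also have "exp (\<bar>Im (Ln z)\<bar> * \<bar>t\<bar>) * exp (- (pi / 2 - e/2) * \<bar>t\<bar>) * exp (- (pi / 2 - e/2) * \<bar>t\<bar>) = exp (- (pi - \<bar>Im (Ln z)\<bar> - e) * \<bar>t\<bar>)"
      by (simp add: algebra_simps flip: exp_add)
    finally show ?thesis .
  qed
  show ?thesis
  proof (intro exI[of _ "C1 * C2"] conjI allI impI)
    show "C1 * C2 \<ge> 0" using C1(1) C2(1) by simp
    fix b z :: complex and t :: real assume "z \<noteq> 0 \<and> d \<le> Re b + 2 * real M + 1/2 \<and> Re b \<le> B"
    thus "norm (reg_kernel b z (Complex (- 1/2 - 2 * real M) t)) \<le>
       (C1 * C2) * norm (2 * cos (of_real pi * b / 2) * of_real (2 * pi) powr (- 1 - b)) * exp (pi / 2 * \<bar>Im b\<bar>)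
       * norm z powr (1/2 + 2 * real M) * exp (- (pi - \<bar>Im (Ln z)\<bar> - e) * \<bar>t\<bar>)"
      using main[of z b t] by (simp add: c_def algebra_simps)
  qed
qed

lemma abs_Im_Ln_less_pi: "z \<notin> \<real>\<^sub>\<le>\<^sub>0 \<Longrightarrow> \<bar>Im (Ln z)\<bar> < pi"
  using mpi_less_Im_Ln[of z] Im_Ln_le_pi[of z] Im_Ln_eq_pi[of z]
  by (cases "z = 0") (force simp: complex_nonpos_Reals_iff abs_less_iff)+

lemma half_gap:
  fixes x y :: real
  assumes "0 \<le> x" "x < y"
  shows "0 < (y - x) / 2" "(y - x) / 2 < y" "y - x - (y - x) / 2 = (y - x) / 2"
  using assms by (simp_all add: field_simps)

lemma reg_kernel_integrable:
  assumes b: "Re b > - 2 * real M - 1/2" and z: "z \<notin> \<real>\<^sub>\<le>\<^sub>0"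
  shows "integrable lborel (\<lambda>t. reg_kernel b z (Complex (- 1/2 - 2 * real M) t))"
proof -
  \<comment> \<open>With e half of the gap pi - |arg z|, the remaining decay rate is again
    e.\<close>
  define d e where "d = Re b + 2 * real M + 1/2" and "e = (pi - \<bar>Im (Ln z)\<bar>) / 2"
  have e: "0 < e" "e < pi" "pi - \<bar>Im (Ln z)\<bar> - e = e"
    unfolding e_def by (rule half_gap[OF abs_ge_zero abs_Im_Ln_less_pi[OF z]])+
  have d: "d > 0" using b by (simp add: d_def)
  have z0: "z \<noteq> 0" using z by auto
  obtain C where "\<And>t. norm (reg_kernel b z (Complex (- 1/2 - 2 * real M) t)) \<le>
       C * norm (2 * cos (of_real pi * b / 2) * of_real (2 * pi) powr (- 1 - b)) * exp (pi / 2 * \<bar>Im b\<bar>)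
       * norm z powr (1/2 + 2 * real M) * exp (- (pi - \<bar>Im (Ln z)\<bar> - e) * \<bar>t\<bar>)"
    using reg_kernel_bound[OF d e(1,2), of M "Re b"] z0 d_def by blast
  thus ?thesis using e
    by (intro integrable_exp_bounded[OF continuous_on_reg_kernel[OF b z], of e 0]) simp_all
qed

lemma reg_integral_holomorphic_param:
  assumes z: "z \<notin> \<real>\<^sub>\<le>\<^sub>0"
  shows "(\<lambda>b. \<integral>t. reg_kernel b z (Complex (- 1/2 - 2 * real M) t) \<partial>lborel) holomorphic_on {b. Re b > - 2 * real M - 1/2}"
proof (rule holomorphic_on_lebesgue_integral)
  let ?c = "- 1/2 - 2 * real M"
  let ?U = "{b. Re b > - 2 * real M - 1/2}"
  have z0: "z \<noteq> 0" using z by auto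
  show "open ?U" by (rule open_halfspace_Re_gt)
  show "(\<lambda>t. reg_kernel b z (Complex ?c t)) \<in> borel_measurable lborel" if "b \<in> ?U" for b
    using borel_measurable_continuous_onI[OF continuous_on_reg_kernel[of M b z]] that z by simp
  show "(\<lambda>b. reg_kernel b z (Complex ?c t)) holomorphic_on ?U" for t
  proof -
    have "1 + b - Complex ?c t \<notin> \<int>\<^sub>\<le>\<^sub>0" "1 + b - Complex ?c t \<noteq> 1" if "b \<in> ?U" for b
    proof -
      have "Re (1 + b - Complex ?c t) > 1" using that by simp
      thus "1 + b - Complex ?c t \<notin> \<int>\<^sub>\<le>\<^sub>0" "1 + b - Complex ?c t \<noteq> 1"
        using Re_pos_not_nonpos_Int[of "1 + b - Complex ?c t"] by auto
    qed
    thus ?thesis unfolding reg_kernel_def by (intro holomorphic_intros) auto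
  qed
  fix b0 assume b0: "b0 \<in> ?U"
  \<comment> \<open>Half the distance to the boundary line: all parameters within \<open>r\<close>
    of \<open>b0\<close> keep the distance \<open>r\<close> from it.\<close>
  define r where "r = (Re b0 + 2 * real M + 1/2) / 2"
  have r: "r > 0" using b0 by (simp add: r_def)
  define e where "e = (pi - \<bar>Im (Ln z)\<bar>) / 2"
  have e: "0 < e" "e < pi" "pi - \<bar>Im (Ln z)\<bar> - e = e"
    unfolding e_def by (rule half_gap[OF abs_ge_zero abs_Im_Ln_less_pi[OF z]])+
  obtain C where C: "C \<ge> 0" "\<And>b t z. z \<noteq> 0 \<and> r \<le> Re b + 2 * real M + 1/2 \<and> Re b \<le> Re b0 + r \<Longrightarrow> norm (reg_kernel b z (Complex ?c t)) \<le>
       C * norm (2 * cos (of_real pi * b / 2) * of_real (2 * pi) powr (- 1 - b)) * exp (pi / 2 * \<bar>Im b\<bar>)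
       * norm z powr (1/2 + 2 * real M) * exp (- (pi - \<bar>Im (Ln z)\<bar> - e) * \<bar>t\<bar>)"
    using reg_kernel_bound[OF r e(1,2), of M "Re b0 + r"] by blast
  have "continuous_on (cball b0 r) (\<lambda>b. 2 * cos (of_real pi * b / 2) * of_real (2 * pi) powr (- 1 - b) * of_real (exp (pi / 2 * \<bar>Im b\<bar>)))"
    by (intro continuous_intros) (auto simp: complex_nonpos_Reals_iff)
  then obtain A where A: "A \<ge> 0" "\<And>b. b \<in> cball b0 r \<Longrightarrow> norm (2 * cos (of_real pi * b / 2) * of_real (2 * pi) powr (- 1 - b) * of_real (exp (pi / 2 * \<bar>Im b\<bar>))) \<le> A"
    using continuous_on_compact_norm_bound[OF compact_cball] by blast
  define g where "g = (\<lambda>t. (C * A * norm z powr (1/2 + 2 * real M)) * exp (- e * \<bar>t\<bar>))"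
  have "norm (reg_kernel b z (Complex ?c t)) \<le> g t" if b: "b \<in> ball b0 r \<inter> ?U" for b t
  proof -
    let ?P = "2 * cos (of_real pi * b / 2) * of_real (2 * pi) powr (- 1 - b) :: complex"
    have "\<bar>Re b0 - Re b\<bar> < r" using b abs_Re_le_cmod[of "b0 - b"] by (simp add: dist_norm)
    hence "Re b0 - Re b < r" "Re b - Re b0 < r" by (simp_all add: abs_less_iff)
    moreover have "Re b0 + 2 * real M + 1/2 = 2 * r" by (simp add: r_def)
    ultimately have "r \<le> Re b + 2 * real M + 1/2" "Re b \<le> Re b0 + r" by simp_all
    hence "norm (reg_kernel b z (Complex ?c t)) \<le> C * norm ?P * exp (pi / 2 * \<bar>Im b\<bar>)
       * norm z powr (1/2 + 2 * real M) * exp (- (pi - \<bar>Im (Ln z)\<bar> - e) * \<bar>t\<bar>)"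
      using z0 by (intro C(2)) auto
    also have "\<dots> = C * (norm ?P * exp (pi / 2 * \<bar>Im b\<bar>)) * (norm z powr (1/2 + 2 * real M) * exp (- e * \<bar>t\<bar>))"
      unfolding e(3) by (simp only: mult_ac)
    also have "norm ?P * exp (pi / 2 * \<bar>Im b\<bar>) = norm (?P * of_real (exp (pi / 2 * \<bar>Im b\<bar>)))"
      by (simp only: norm_mult[of ?P] norm_of_real abs_exp_cancel)
    also have "C * \<dots> * (norm z powr (1/2 + 2 * real M) * exp (- e * \<bar>t\<bar>)) \<le> C * A * (norm z powr (1/2 + 2 * real M) * exp (- e * \<bar>t\<bar>))"
      using b C(1) by (intro mult_right_mono mult_left_mono A(2)) auto
    finally show ?thesis by (simp add: g_def mult.assoc)
  qed
  moreover have "integrable lborel g" unfolding g_def by (intro integrable_mult_right integrable_exp_minus_abs e)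
  ultimately show "\<exists>r>0. \<exists>g. integrable lborel g \<and> (\<forall>b\<in>ball b0 r \<inter> ?U. \<forall>t\<in>space lborel. norm (reg_kernel b z (Complex ?c t)) \<le> g t)"
    using r by blast
qed

lemma reg_integral_holomorphic_z:
  assumes b: "Re b > - 2 * real M - 1/2"
  shows "(\<lambda>z. \<integral>t. reg_kernel b z (Complex (- 1/2 - 2 * real M) t) \<partial>lborel) holomorphic_on (- \<real>\<^sub>\<le>\<^sub>0)"
proof (rule holomorphic_on_lebesgue_integral)
  let ?c = "- 1/2 - 2 * real M"
  let ?U = "- \<real>\<^sub>\<le>\<^sub>0 :: complex set"
  show "open ?U" by (simp add: open_Compl)
  show "(\<lambda>t. reg_kernel b z (Complex ?c t)) \<in> borel_measurable lborel" if "z \<in> ?U" for z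
    using borel_measurable_continuous_onI[OF continuous_on_reg_kernel[OF b, of z]] that by simp
  show "(\<lambda>z. reg_kernel b z (Complex ?c t)) holomorphic_on ?U" for t
    unfolding reg_kernel_def by (intro holomorphic_intros) auto
  fix z0 assume z0: "z0 \<in> ?U"
  then obtain r where r: "r > 0" "cball z0 r \<subseteq> ?U"
    using open_contains_cball[of ?U] by (auto simp: open_Compl)
  have "continuous_on (cball z0 r) (\<lambda>z. \<bar>Im (Ln z)\<bar>)" using r by (intro continuous_intros) auto
  \<comment> \<open>The largest |arg z| on the closed disc is attained and below pi, which gives one
    decay rate for the whole disc.\<close>
  then obtain z1 where z1: "z1 \<in> cball z0 r" "\<And>z. z \<in> cball z0 r \<Longrightarrow> \<bar>Im (Ln z)\<bar> \<le> \<bar>Im (Ln z1)\<bar>"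
    using continuous_attains_sup[of "cball z0 r" "\<lambda>z. \<bar>Im (Ln z)\<bar>"] r by (metis cball_eq_empty compact_cball not_less_iff_gr_or_eq order_less_imp_not_less)
  define e where "e = (pi - \<bar>Im (Ln z1)\<bar>) / 2"
  have "z1 \<notin> \<real>\<^sub>\<le>\<^sub>0" using z1(1) r(2) by auto
  hence e: "0 < e" "e < pi" "pi - \<bar>Im (Ln z1)\<bar> - e = e"
    unfolding e_def by (rule half_gap[OF abs_ge_zero abs_Im_Ln_less_pi])+
  define d where "d = Re b + 2 * real M + 1/2"
  have d: "d > 0" using b by (simp add: d_def)
  define P where "P = norm (2 * cos (of_real pi * b / 2) * of_real (2 * pi) powr (- 1 - b)) * exp (pi / 2 * \<bar>Im b\<bar>)"
  obtain C where C: "C \<ge> 0" "\<And>t z. z \<noteq> 0 \<Longrightarrow> norm (reg_kernel b z (Complex ?c t)) \<le>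
       C * norm (2 * cos (of_real pi * b / 2) * of_real (2 * pi) powr (- 1 - b)) * exp (pi / 2 * \<bar>Im b\<bar>)
       * norm z powr (1/2 + 2 * real M) * exp (- (pi - \<bar>Im (Ln z)\<bar> - e) * \<bar>t\<bar>)"
    using reg_kernel_bound[OF d e(1,2), of M "Re b"] d_def by blast
  define R where "R = (norm z0 + r) powr (1/2 + 2 * real M)"
  define g where "g = (\<lambda>t. (C * P * R) * exp (- e * \<bar>t\<bar>))"
  have "norm (reg_kernel b z (Complex ?c t)) \<le> g t" if z: "z \<in> ball z0 r \<inter> ?U" for z t
  proof -
    have zc: "z \<in> cball z0 r" and zn: "z \<noteq> 0" using z by auto
    have "norm (reg_kernel b z (Complex ?c t)) \<le> C * P * norm z powr (1/2 + 2 * real M) * exp (- (pi - \<bar>Im (Ln z)\<bar> - e) * \<bar>t\<bar>)"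
      using C(2)[OF zn, of t] by (simp only: P_def mult.assoc)
    also have "\<dots> \<le> C * P * R * exp (- e * \<bar>t\<bar>)"
    proof (intro mult_mono)
      have "norm z \<le> norm z0 + r" using zc norm_triangle_ineq2[of z z0] by (simp add: dist_norm norm_minus_commute)
      thus "norm z powr (1/2 + 2 * real M) \<le> R" unfolding R_def by (intro powr_mono2) auto
      have "e \<le> pi - \<bar>Im (Ln z)\<bar> - e" using z1(2)[OF zc] e(3) by linarith
      hence "e * \<bar>t\<bar> \<le> (pi - \<bar>Im (Ln z)\<bar> - e) * \<bar>t\<bar>" by (intro mult_right_mono) auto
      thus "exp (- (pi - \<bar>Im (Ln z)\<bar> - e) * \<bar>t\<bar>) \<le> exp (- e * \<bar>t\<bar>)"
        by (simp only: exp_le_cancel_iff mult_minus_left neg_le_iff_le)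
    qed (use C(1) in \<open>auto simp: P_def R_def\<close>)
    finally show ?thesis by (simp add: g_def)
  qed
  moreover have "integrable lborel g" unfolding g_def by (intro integrable_mult_right integrable_exp_minus_abs e)
  ultimately show "\<exists>r>0. \<exists>g. integrable lborel g \<and> (\<forall>z\<in>ball z0 r \<inter> ?U. \<forall>t\<in>space lborel. norm (reg_kernel b z (Complex ?c t)) \<le> g t)"
    using r(1) by blast
qed

lemma vline_mellin_kernel:
  assumes "Re b > - 2 * real M - 1/2" "z \<notin> \<real>\<^sub>\<le>\<^sub>0"
  shows "vline_integral (- 1/2 - 2 * real M) (mellin_kernel b z) = \<i> * (\<integral>t. reg_kernel b z (Complex (- 1/2 - 2 * real M) t) \<partial>lborel)"
  unfolding vline_integral_def mellin_kernel_integral(1)[OF assms] ..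

lemma vline_holomorphic_param:
  assumes "z \<notin> \<real>\<^sub>\<le>\<^sub>0"
  shows "(\<lambda>b. vline_integral (- 1/2 - 2 * real M) (mellin_kernel b z)) holomorphic_on {b. Re b > - 2 * real M - 1/2}"
proof -
  have "(\<lambda>b. \<i> * (\<integral>t. reg_kernel b z (Complex (- 1/2 - 2 * real M) t) \<partial>lborel)) holomorphic_on {b. Re b > - 2 * real M - 1/2}"
    by (intro holomorphic_intros reg_integral_holomorphic_param assms)
  thus ?thesis by (rule holomorphic_transform) (rule vline_mellin_kernel[symmetric], use assms in auto)
qed

lemma vline_holomorphic_z:
  assumes "Re b > - 2 * real M - 1/2"
  shows "(\<lambda>z. vline_integral (- 1/2 - 2 * real M) (mellin_kernel b z)) holomorphic_on (- \<real>\<^sub>\<le>\<^sub>0)"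
proof -
  have "(\<lambda>z. \<i> * (\<integral>t. reg_kernel b z (Complex (- 1/2 - 2 * real M) t) \<partial>lborel)) holomorphic_on (- \<real>\<^sub>\<le>\<^sub>0)"
    by (intro holomorphic_intros reg_integral_holomorphic_z assms)
  thus ?thesis by (rule holomorphic_transform) (rule vline_mellin_kernel[symmetric], use assms in auto)
qed

subsection \<open>The divisor series as a function of the parameter\<close>

text \<open>Half of the exponential decay absorbs the polynomial growth of the divisor sums,
  uniformly for all parameters with bounded real part.\<close>

lemma norm_div_series_term_le:
  assumes y: "Im z > 0"
  shows "\<exists>C\<ge>0. \<forall>b n. Re b \<le> B \<longrightarrow>
     norm (divisor_sigma b (Suc n) * exp (2 * of_real pi * \<i> * of_nat (Suc n) * z)) \<le> C * exp (- (pi * Im z)) ^ Suc n"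
proof -
  \<comment> \<open>One power more than the bound for a single divisor power, for the number of
    divisors.\<close>
  define m where "m = Suc (nat \<lceil>B\<rceil>)"
  have pos: "pi * Im z > 0" using y by simp
  obtain C where C: "C \<ge> 0" "\<And>t. t \<ge> 0 \<Longrightarrow> (0 + t) ^ m \<le> C * exp (pi * Im z * t)"
    using power_le_exp[of 0 "pi * Im z" m] pos by auto
  have "norm (divisor_sigma b (Suc n) * exp (2 * of_real pi * \<i> * of_nat (Suc n) * z)) \<le> C * exp (- (pi * Im z)) ^ Suc n"
    if b: "Re b \<le> B" for b n
  proof -
    let ?N = "Suc n"
    have "norm (divisor_sigma b ?N) \<le> (\<Sum>d | d dvd ?N. norm (of_nat d powr b :: complex))"
      unfolding divisor_sigma_def by (rule norm_sum)
    also have "\<dots> \<le> (\<Sum>d | d dvd ?N. real ?N ^ nat \<lceil>B\<rceil>)"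
    proof (intro sum_mono)
      fix d assume "d \<in> {d. d dvd ?N}"
      hence d: "d \<ge> 1" "d \<le> ?N" by (auto dest: dvd_imp_le intro: Suc_leI dvd_pos_nat)
      have "norm (of_nat d powr b :: complex) = real d powr Re b"
        using norm_powr_real_powr[of "of_nat d" b] by simp
      also have "\<dots> \<le> real d powr real (nat \<lceil>B\<rceil>)" using d b by (intro powr_mono) linarith+
      also have "\<dots> = real d ^ nat \<lceil>B\<rceil>" using d by (simp add: powr_realpow)
      also have "\<dots> \<le> real ?N ^ nat \<lceil>B\<rceil>" using d by (intro power_mono) auto
      finally show "norm (of_nat d powr b :: complex) \<le> real ?N ^ nat \<lceil>B\<rceil>" .
    qed
    also have "\<dots> = real (card {d. d dvd ?N}) * real ?N ^ nat \<lceil>B\<rceil>" by simp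
    also have "\<dots> \<le> real ?N * real ?N ^ nat \<lceil>B\<rceil>"
    proof (intro mult_right_mono)
      have "{d. d dvd ?N} \<subseteq> {1..?N}"
        by (auto simp: Suc_le_eq intro: dvd_imp_le dvd_pos_nat[of "Suc n"])
      from card_mono[OF _ this] show "real (card {d. d dvd ?N}) \<le> real ?N" by simp
    qed simp
    also have "\<dots> = (0 + real ?N) ^ m" by (simp add: m_def)
    also have "\<dots> \<le> C * exp (pi * Im z * real ?N)" by (intro C(2)) simp
    finally have 1: "norm (divisor_sigma b ?N) \<le> C * exp (pi * Im z * real ?N)" .
    have "norm (exp (2 * of_real pi * \<i> * of_nat ?N * z)) = exp (- (2 * pi * Im z * real ?N))"
      by (simp add: mult_ac del: of_nat_Suc)
    hence "norm (divisor_sigma b ?N * exp (2 * of_real pi * \<i> * of_nat ?N * z)) \<le> C * exp (pi * Im z * real ?N) * exp (- (2 * pi * Im z * real ?N))"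
      using mult_right_mono[OF 1, of "exp (- (2 * pi * Im z * real ?N))"] by (simp only: norm_mult) simp
    also have "\<dots> = C * exp (- (pi * Im z * real ?N))"
      by (simp add: algebra_simps flip: exp_add)
    also have "exp (- (pi * Im z * real ?N)) = exp (- (pi * Im z)) ^ ?N"
      using exp_of_nat_mult[of ?N "- (pi * Im z)"] by (simp add: mult_ac)
    finally show ?thesis .
  qed
  thus ?thesis using C(1) by blast
qed

lemma div_series_holomorphic:
  assumes z: "Im z > 0"
  shows "(\<lambda>b. div_series b z) holomorphic_on UNIV"
  unfolding div_series_def
proof (rule holomorphic_on_suminf(1)[OF open_UNIV])
  show "(\<lambda>b. divisor_sigma b (Suc k) * exp (2 * of_real pi * \<i> * of_nat (Suc k) * z)) holomorphic_on UNIV" for k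
    unfolding divisor_sigma_def by (intro holomorphic_intros) (auto intro: dvd_pos_nat)
  fix b0 :: complex
  obtain C where C: "C \<ge> 0" "\<And>b n. Re b \<le> Re b0 + 1 \<Longrightarrow>
     norm (divisor_sigma b (Suc n) * exp (2 * of_real pi * \<i> * of_nat (Suc n) * z)) \<le> C * exp (- (pi * Im z)) ^ Suc n"
    using norm_div_series_term_le[OF z, of "Re b0 + 1"] by blast
  have "summable (\<lambda>n. exp (- (pi * Im z)) ^ n)" using z by (intro summable_geometric) simp
  hence "summable (\<lambda>n. C * exp (- (pi * Im z)) ^ Suc n)"
    using summable_Suc_iff[of "\<lambda>n. exp (- (pi * Im z)) ^ n"] by (intro summable_mult) simp
  moreover have "Re b \<le> Re b0 + 1" if "b \<in> ball b0 1 \<inter> UNIV" for b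
    using that abs_Re_le_cmod[of "b0 - b"] by (simp add: dist_norm)
  ultimately show "\<exists>r>0. \<exists>S K. summable S \<and> (\<forall>k\<ge>K. \<forall>b\<in>ball b0 r \<inter> UNIV. norm (divisor_sigma b (Suc k) * exp (2 * of_real pi * \<i> * of_nat (Suc k) * z)) \<le> S k)"
    using C(2) by (intro exI[of _ 1] conjI exI[of _ "\<lambda>n. C * exp (- (pi * Im z)) ^ Suc n"] exI[of _ 0] allI impI ballI) simp_all
qed

section \<open>The three term relation\<close>

lemma div_series_shift: "div_series b (z + 1) = div_series b z"
proof -
  have "exp (2 * of_real pi * \<i> * of_nat (Suc n) * (z + 1)) = exp (2 * of_real pi * \<i> * of_nat (Suc n) * z)" for n
  proof -
    have "2 * of_real pi * \<i> * of_nat (Suc n) * (z + 1) = 2 * of_real pi * \<i> * of_nat (Suc n) * z + \<i> * (of_int (2 * int (Suc n)) * (of_real pi))"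
      by (simp add: algebra_simps)
    moreover have "exp (2 * of_real pi * \<i> * of_nat (Suc n) * z + \<i> * (of_int (2 * int (Suc n)) * of_real pi)) = exp (2 * of_real pi * \<i> * of_nat (Suc n) * z)"
      by (subst exp_eq) (auto intro!: exI[of _ "int (Suc n)"] simp: algebra_simps)
    ultimately show ?thesis by simp
  qed
  thus ?thesis by (simp only: div_series_def)
qed

text \<open>A consequence of period 1 alone: z / (z + 1) = 1 - 1 / (z + 1), and its negative
  reciprocal is -1 / z - 1. The powers multiply without a phase because z and z + 1 both have
  arguments in (0, pi).\<close>

lemma three_term_relation:
  assumes z: "Im z > 0"
  shows "period_fun b z - period_fun b (z + 1) = 1 / (z + 1) powr (1 + b) * period_fun b (z / (z + 1))"
proof -
  let ?E = "eisenstein (b + 1)"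
  have per: "?E (w + 1) = ?E w" for w by (simp add: eisenstein_def div_series_shift)
  have z0: "z \<noteq> 0" "z + 1 \<noteq> 0" using z by (auto simp: complex_eq_iff)
  have e1: "?E (z / (z + 1)) = ?E (- (1 / (z + 1)))"
    using per[of "- (1 / (z + 1))"] z0 by (simp add: field_simps)
  have e2: "?E (- (1 / (z / (z + 1)))) = ?E (- (1 / z))"
  proof -
    have "1 / (z / (z + 1)) = 1 / z + 1" using z0 by (simp add: field_simps)
    thus ?thesis using per[of "- (1 / z) - 1"] by simp
  qed
  have pw: "(z + 1) powr (b + 1) * (z / (z + 1)) powr (b + 1) = z powr (b + 1)"
  proof -
    have Im1: "0 < Im (Ln z)" "Im (Ln z) < pi" "0 < Im (Ln (z + 1))" "Im (Ln (z + 1)) < pi"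
      using Im_Ln_pos_lt_imp[OF z] Im_Ln_pos_lt_imp[of "z + 1"] z by auto
    have L: "Ln (z / (z + 1)) = Ln z - Ln (z + 1)"
      using Im1 z0 by (intro Ln_unique) (auto simp: exp_diff)
    have "(b + 1) * Ln (z + 1) + (b + 1) * Ln (z / (z + 1)) = (b + 1) * Ln z"
      unfolding L by (simp add: algebra_simps)
    thus ?thesis using z0 by (simp add: powr_def exp_add[symmetric])
  qed
  have nz: "(z + 1) powr (b + 1) \<noteq> 0" using z0 by simp
  have "1 / (z + 1) powr (1 + b) * period_fun b (z / (z + 1))
     = 1 / (z + 1) powr (b + 1) * ?E (- (1 / (z + 1))) - 1 / ((z + 1) powr (b + 1) * (z / (z + 1)) powr (b + 1)) * ?E (- (1 / z))"
    unfolding period_fun_def e1 e2 add.commute[of 1 b] by (simp add: right_diff_distrib)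
  also have "\<dots> = period_fun b z - period_fun b (z + 1)"
    unfolding pw period_fun_def per by simp
  finally show ?thesis ..
qed

subsection \<open>Dependence on the parameter\<close>

text \<open>The explicit continuation is meromorphic, and zeta agrees with it off the pole, where
  the conventional value 0 is harmless as only punctured neighbourhoods count.\<close>

lemma zeta_reflected_meromorphic: "(\<lambda>b. zeta (c - b)) meromorphic_on A"
proof -
  have "(\<lambda>b. rGamma (c - b) / ((c - b) - 1) + zeta_reg (c - b)) meromorphic_on UNIV"
  proof (intro meromorphic_intros analytic_on_imp_meromorphic_on)
    show "(\<lambda>b. rGamma (c - b)) analytic_on UNIV" by (simp add: analytic_on_open holomorphic_intros)
    have "(zeta_reg \<circ> (\<lambda>b. c - b)) holomorphic_on UNIV"
      by (intro holomorphic_on_compose holomorphic_intros zeta_reg_holomorphic)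
    thus "(\<lambda>b. zeta_reg (c - b)) analytic_on UNIV" by (simp add: analytic_on_open o_def)
  qed
  also have "?this \<longleftrightarrow> (\<lambda>b. zeta (c - b)) meromorphic_on UNIV"
  proof (rule meromorphic_on_cong[OF _ refl])
    fix z
    have "\<forall>\<^sub>F b in at z. b \<noteq> c - 1"
      using eventually_neq_at_within by blast
    thus "\<forall>\<^sub>F b in at z. rGamma (c - b) / ((c - b) - 1) + zeta_reg (c - b) = zeta (c - b)"
    proof eventually_elim
      case (elim b)
      hence "c - b \<noteq> 1" by (auto simp: algebra_simps)
      thus ?case by (simp add: zeta_eq zeta_cont_def)
    qed
  qed
  finally show ?thesis by (rule meromorphic_on_subset) simp
qed

lemma zeta_minus_meromorphic: "(\<lambda>b. zeta (- b)) meromorphic_on A"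
  using zeta_reflected_meromorphic[of 0] by simp

text \<open>At a = -1 because of the pole, at a zero because zeros are isolated, and elsewhere by
  continuity.\<close>

lemma eventually_zeta_minus_nonzero: "\<forall>\<^sub>F b in at a. zeta (- b) \<noteq> 0"
proof (cases "a = -1")
  case True
  have "filterlim (\<lambda>b. - b) (at 1) (at (- 1 :: complex))"
    unfolding filterlim_at by (auto simp: eventually_at_filter minus_equation_iff[of _ 1] intro!: tendsto_eq_intros)
  from filterlim_compose[OF zeta_pole this]
  have "((\<lambda>b. (- b - 1) * zeta (- b)) \<longlongrightarrow> 1) (at (- 1))" .
  hence "\<forall>\<^sub>F b in at (- 1). (- b - 1) * zeta (- b) \<noteq> 0"
    by (rule tendsto_imp_eventually_ne) simp
  thus ?thesis unfolding True by eventually_elim auto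
next
  case False
  have hol: "(\<lambda>b. zeta (- b)) holomorphic_on - {-1}"
    by (intro holomorphic_intros) (auto simp: minus_equation_iff[of _ 1])
  show ?thesis
  proof (cases "zeta (- a) = 0")
    case True
    \<comment> \<open>Zeta at 0 is -1/2, which rules out that the function vanishes
      identically.\<close>
    obtain r where "r > 0" "\<And>z. z \<in> ball a r - {a} \<Longrightarrow> zeta (- z) \<noteq> 0"
      using isolated_zeros[OF hol _ connected_punctured_complex, of a 0] False True zeta_0 by (auto simp: open_Compl)
    thus ?thesis unfolding eventually_at_filter eventually_nhds_metric by (auto simp: dist_commute)
  next
    case nz: False
    have "isCont (\<lambda>b. zeta (- b)) a"
      using False by (intro isCont_holomorphic[OF hol]) (auto simp: open_Compl)
    thus ?thesis unfolding isCont_def using nz by (intro tendsto_imp_eventually_ne)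
  qed
qed

lemma eventually_not_Ints: "\<forall>\<^sub>F b in at (a::complex). b \<notin> \<int>"
proof -
  have "open (- (\<int> - {a}))" by (intro open_Compl closed_subset_Ints) auto
  hence "\<forall>\<^sub>F b in nhds a. b \<in> - (\<int> - {a})" by (intro eventually_nhds_in_open) auto
  thus ?thesis unfolding eventually_at_filter by eventually_elim auto
qed

text \<open>At a = -1 the reciprocal tends to 0, and its formal value there is also 0, since zeta 1
  = 0 and division by 0 gives 0.\<close>

lemma tendsto_inverse_zeta_minus:
  assumes "regular_param a"
  shows "((\<lambda>b. 1 / zeta (- b)) \<longlongrightarrow> 1 / zeta (- a)) (at a)"
proof (cases "a = -1")
  case True
  have lim: "filterlim (\<lambda>b. - b) (at 1) (at (- 1 :: complex))"
    unfolding filterlim_at by (auto simp: eventually_at_filter minus_equation_iff[of _ 1] intro!: tendsto_eq_intros)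
  have "((\<lambda>b. (- b - 1) / ((- b - 1) * zeta (- b))) \<longlongrightarrow> (- (- 1) - 1) / 1) (at (- 1))"
    by (intro tendsto_divide filterlim_compose[OF zeta_pole lim] tendsto_intros) simp
  moreover have "\<forall>\<^sub>F b in at (- 1). (- b - 1) / ((- b - 1) * zeta (- b)) = 1 / zeta (- b)"
    by (auto simp: eventually_at_filter)
  ultimately show ?thesis unfolding True by (simp add: Lim_transform_eventually)
next
  case False
  hence nz: "zeta (- a) \<noteq> 0" using assms by (simp add: regular_param_def)
  have hol: "(\<lambda>b. zeta (- b)) holomorphic_on - {-1}"
    by (intro holomorphic_intros) (auto simp: minus_equation_iff[of _ 1])
  have "isCont (\<lambda>b. zeta (- b)) a"
    using False by (intro isCont_holomorphic[OF hol]) (auto simp: open_Compl)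
  thus ?thesis unfolding isCont_def using nz by (intro tendsto_divide tendsto_const)
qed

text \<open>Zeta enters only through its reciprocal, the quantity that remains continuous at a =
  -1.\<close>

lemma period_fun_expand:
  "period_fun b z = 1 + 2 * (1 / zeta (- b)) * div_series b z - 1 / z powr (b + 1) * (1 + 2 * (1 / zeta (- b)) * div_series b (- (1 / z)))"
  by (simp add: period_fun_def eisenstein_def)

lemma period_fun_tendsto:
  assumes "regular_param a" and z: "Im z > 0"
  shows "((\<lambda>b. period_fun b z) \<longlongrightarrow> period_fun a z) (at a)"
proof -
  have z': "Im (- (1 / z)) > 0" using z by (auto simp: Im_divide intro!: divide_pos_pos add_nonneg_pos)
  have D: "((\<lambda>b. div_series b w) \<longlongrightarrow> div_series a w) (at a)" if "Im w > 0" for w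
    using isCont_holomorphic[OF div_series_holomorphic[OF that], of a] by (simp add: isCont_def)
  have "z \<noteq> 0" using z by auto
  thus ?thesis unfolding period_fun_expand
    using z by (intro tendsto_intros tendsto_inverse_zeta_minus assms D z') (auto simp: complex_nonpos_Reals_iff)
qed

lemma period_fun_meromorphic:
  assumes z: "Im z > 0"
  shows "(\<lambda>b. period_fun b z) meromorphic_on UNIV"
proof -
  have z': "Im (- (1 / z)) > 0" using z by (auto simp: Im_divide intro!: divide_pos_pos add_nonneg_pos)
  have D: "(\<lambda>b. div_series b w) meromorphic_on UNIV" if "Im w > 0" for w
    using div_series_holomorphic[OF that] by (intro analytic_on_imp_meromorphic_on) (simp add: analytic_on_open)
  have z0: "z \<noteq> 0" "z \<notin> \<real>\<^sub>\<le>\<^sub>0" using z by (auto simp: complex_nonpos_Reals_iff)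
  have P: "(\<lambda>b. z powr (b + 1)) meromorphic_on UNIV"
    using z0 by (intro analytic_on_imp_meromorphic_on) (auto simp: analytic_on_open intro!: holomorphic_intros)
  show ?thesis unfolding period_fun_expand
    by (intro meromorphic_intros D z z' P zeta_minus_meromorphic)
qed

text \<open>Generic parameters fill a punctured neighbourhood of \<open>a\<close>. The margin 1/2 in
  the bound of the generic case keeps this neighbourhood admissible even when \<open>Re a\<close>
  equals -2M.\<close>

lemma period_rep_eventually_eq:
  assumes M: "Re a \<ge> - 2 * real M" and z: "Im z > 0"
  shows "\<forall>\<^sub>F b in at a. period_fun b z = period_rep M b z"
proof -
  have "\<forall>\<^sub>F b in nhds a. b \<in> {b. Re b > - 2 * real M - 1/2}"
    using M by (intro eventually_nhds_in_open open_halfspace_Re_gt) auto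
  hence "\<forall>\<^sub>F b in at a. b \<in> {b. Re b > - 2 * real M - 1/2}"
    unfolding eventually_at_filter by eventually_elim simp
  with eventually_not_Ints[of a] eventually_zeta_minus_nonzero[of a] show ?thesis
    by eventually_elim (auto intro!: period_fun_eq_period_rep z)
qed

text \<open>The term \<^term>\<open>n = 0\<close> of the sum is the first term of the representation.\<close>
lemma period_rep_expand:
  assumes "z \<noteq> 0"
  shows "period_rep M b z = \<i> * (1 / zeta (- b)) * (2 * (\<Sum>n\<le>M. (-1) ^ n * bern_coeff (2 * n) * zeta (1 - 2 * of_nat n - b) * ((2 * of_real pi * z) ^ (2 * n) / (2 * of_real pi * z)))
      + 1 / (of_real pi * \<i>) * vline_integral (- 1/2 - 2 * real M) (mellin_kernel b z))
     - \<i> / z powr (1 + b) * cot (of_real pi * b / 2)"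
proof -
  let ?t = "\<lambda>n. (-1) ^ n * bern_coeff (2 * n) * zeta (1 - 2 * of_nat n - b) * ((2 * of_real pi * z) ^ (2 * n) / (2 * of_real pi * z))"
  have "{..M} = insert 0 {1..M}" by auto
  hence "(\<Sum>n\<le>M. ?t n) = ?t 0 + (\<Sum>n=1..M. ?t n)" by simp
  also have "(\<Sum>n=1..M. ?t n) = (\<Sum>n=1..M. (-1) ^ n * bern_coeff (2 * n) * zeta (1 - 2 * of_nat n - b) * (2 * of_real pi * z) ^ (2 * n - 1))"
  proof (intro sum.cong refl)
    fix n assume "n \<in> {1..M}"
    hence "2 * n = Suc (2 * n - 1)" by auto
    hence "(2 * of_real pi * z) ^ (2 * n) / (2 * of_real pi * z) = (2 * of_real pi * z) ^ (2 * n - 1)"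
      using assms by (metis divisors_zero mult_eq_0_iff nonzero_mult_div_cancel_left of_real_eq_0_iff pi_neq_zero power_Suc zero_neq_numeral)
    thus "?t n = (-1) ^ n * bern_coeff (2 * n) * zeta (1 - 2 * of_nat n - b) * (2 * of_real pi * z) ^ (2 * n - 1)" by simp
  qed
  finally have S: "(\<Sum>n\<le>M. ?t n) = zeta (1 - b) / (2 * of_real pi * z) + (\<Sum>n=1..M. (-1) ^ n * bern_coeff (2 * n) * zeta (1 - 2 * of_nat n - b) * (2 * of_real pi * z) ^ (2 * n - 1))"
    by simp
  have "2 * (zeta (1 - b) / (2 * of_real pi * z)) = zeta (1 - b) / (of_real pi * z)" by simp
  thus ?thesis unfolding S distrib_left period_rep_def g_fun_def bernoulli_conv_coeff
    by (simp add: algebra_simps add_divide_distrib)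
qed

lemma vline_param_tendsto:
  assumes "Re a \<ge> - 2 * real M" "z \<notin> \<real>\<^sub>\<le>\<^sub>0"
  shows "((\<lambda>b. vline_integral (- 1/2 - 2 * real M) (mellin_kernel b z)) \<longlongrightarrow> vline_integral (- 1/2 - 2 * real M) (mellin_kernel a z)) (at a)"
  using isCont_holomorphic[OF vline_holomorphic_param[OF assms(2), of M] open_halfspace_Re_gt, of a] assms(1)
  by (simp add: isCont_def)

lemma period_rep_meromorphic:
  assumes M: "Re a \<ge> - 2 * real M" and z: "z \<notin> \<real>\<^sub>\<le>\<^sub>0"
  shows "(\<lambda>b. period_rep M b z) meromorphic_on {a}"
proof -
  have z0: "z \<noteq> 0" using z by auto
  have V: "(\<lambda>b. vline_integral (- 1/2 - 2 * real M) (mellin_kernel b z)) meromorphic_on {a}"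
  proof (rule analytic_on_imp_meromorphic_on)
    have "(\<lambda>b. vline_integral (- 1/2 - 2 * real M) (mellin_kernel b z)) analytic_on {b. Re b > - 2 * real M - 1/2}"
      using vline_holomorphic_param[OF z, of M] by (subst analytic_on_open) (rule open_halfspace_Re_gt)
    thus "(\<lambda>b. vline_integral (- 1/2 - 2 * real M) (mellin_kernel b z)) analytic_on {a}"
      by (rule analytic_on_subset) (use M in auto)
  qed
  have an: "f meromorphic_on {a}" if "f holomorphic_on UNIV" for f
  proof (rule analytic_on_imp_meromorphic_on)
    have "f analytic_on UNIV" using that by (simp add: analytic_on_open)
    thus "f analytic_on {a}" by (rule analytic_on_subset) simp
  qed
  have P: "(\<lambda>b. z powr (1 + b)) meromorphic_on {a}"
  proof (rule an)
    have "(\<lambda>b. exp ((1 + b) * Ln z)) holomorphic_on UNIV" by (intro holomorphic_intros)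
    thus "(\<lambda>b. z powr (1 + b)) holomorphic_on UNIV" using z0 by (simp add: powr_def)
  qed
  have C: "(\<lambda>b. cot (of_real pi * b / 2)) meromorphic_on {a}"
    unfolding cot_def by (rule meromorphic_on_divide; rule an; intro holomorphic_intros) simp_all
  have S: "(\<lambda>b. \<Sum>n\<le>M. (-1) ^ n * bern_coeff (2 * n) * zeta (1 - 2 * of_nat n - b) * ((2 * of_real pi * z) ^ (2 * n) / (2 * of_real pi * z))) meromorphic_on {a}"
    by (intro meromorphic_on_sum meromorphic_on_mult meromorphic_on_const zeta_reflected_meromorphic)
  have Z: "(\<lambda>b. 1 / zeta (- b)) meromorphic_on {a}"
    by (intro meromorphic_on_divide meromorphic_on_const zeta_minus_meromorphic)
  show ?thesis unfolding period_rep_expand[OF z0]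
    by (intro meromorphic_on_diff meromorphic_on_mult[OF meromorphic_on_mult] meromorphic_on_mult[OF meromorphic_on_divide]
        meromorphic_on_add[OF meromorphic_on_mult meromorphic_on_mult] meromorphic_on_const V P C S Z)
qed

lemma mellin_kernel_integrable:
  assumes "Re a \<ge> - 2 * real M" "z \<notin> \<real>\<^sub>\<le>\<^sub>0"
  shows "integrable lborel (\<lambda>t. mellin_kernel a z (Complex (- 1/2 - 2 * real M) t))"
proof -
  have b: "Re a > - 2 * real M - 1/2" using assms(1) by simp
  show ?thesis
    by (rule mellin_kernel_integral(2)[OF b assms(2), THEN iffD2, OF reg_kernel_integrable[OF b assms(2)]])
qed

subsection \<open>Analytic continuation of the period function\<close>

lemma zeta_reflected_tendsto:
  assumes "c - a \<noteq> 1"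
  shows "((\<lambda>b. zeta (c - b)) \<longlongrightarrow> zeta (c - a)) (at a)"
proof -
  have hol: "(\<lambda>b. zeta (c - b)) holomorphic_on - {c - 1}"
    by (intro holomorphic_intros) (auto simp: algebra_simps)
  have "isCont (\<lambda>b. zeta (c - b)) a"
    using assms by (intro isCont_holomorphic[OF hol]) (auto simp: open_Compl algebra_simps)
  thus ?thesis by (simp add: isCont_def)
qed

lemma powr_tendsto_param:
  fixes z a :: complex
  assumes "z \<noteq> 0"
  shows "((\<lambda>b. z powr (1 + b)) \<longlongrightarrow> z powr (1 + a)) (at a)"
proof -
  have "((\<lambda>b. exp ((1 + b) * Ln z)) \<longlongrightarrow> exp ((1 + a) * Ln z)) (at a)"
    by (intro tendsto_intros)
  thus ?thesis using assms by (simp add: powr_def)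
qed

text \<open>The representation without the cotangent and restricted to the indices \<open>I\<close>,
  so that an index whose zeta factor has a pole at the parameter can be split off.\<close>

definition rep_part :: "nat set \<Rightarrow> nat \<Rightarrow> complex \<Rightarrow> complex \<Rightarrow> complex" where
  "rep_part I M b z = \<i> * (1 / zeta (- b)) * (2 * (\<Sum>n\<in>I. (-1) ^ n * bern_coeff (2 * n) * zeta (1 - 2 * of_nat n - b) * ((2 * of_real pi * z) ^ (2 * n) / (2 * of_real pi * z)))
      + 1 / (of_real pi * \<i>) * vline_integral (- 1/2 - 2 * real M) (mellin_kernel b z))"

lemma rep_part_tendsto:
  assumes "regular_param a" "Re a \<ge> - 2 * real M" "z \<notin> \<real>\<^sub>\<le>\<^sub>0" and I: "\<And>n. n \<in> I \<Longrightarrow> a \<noteq> - of_nat (2 * n)"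
  shows "((\<lambda>b. rep_part I M b z) \<longlongrightarrow> rep_part I M a z) (at a)"
  unfolding rep_part_def
proof (intro tendsto_mult tendsto_add tendsto_const tendsto_sum tendsto_inverse_zeta_minus vline_param_tendsto zeta_reflected_tendsto assms)
  fix n assume "n \<in> I"
  from I[OF this] show "1 - 2 * of_nat n - a \<noteq> 1"
    by (metis add.commute add_diff_cancel_left' diff_add_cancel diff_diff_eq minus_diff_eq of_nat_mult of_nat_numeral diff_zero)
qed

lemma rep_part_holomorphic:
  assumes "Re a \<ge> - 2 * real M"
  shows "(\<lambda>z. rep_part I M a z) holomorphic_on (- \<real>\<^sub>\<le>\<^sub>0)"
proof -
  have a: "Re a > - 2 * real M - 1/2" using assms by simp
  show ?thesis unfolding rep_part_def
    by (intro holomorphic_on_mult holomorphic_on_add holomorphic_on_const holomorphic_on_sum holomorphic_on_divide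
        holomorphic_on_power holomorphic_on_ident vline_holomorphic_z[OF a]) auto
qed

lemma period_rep_eq_rep_part:
  assumes "z \<noteq> 0"
  shows "period_rep M b z = rep_part {..M} M b z - \<i> / z powr (1 + b) * cot (of_real pi * b / 2)"
  by (simp only: period_rep_expand[OF assms] rep_part_def)

text \<open>The zeros are the even integers. Positive ones are excluded by regularity, being trivial
  zeros of zeta (-a), the others by assumption.\<close>

lemma sin_half_nonzero:
  assumes "regular_param a" "\<And>n::nat. a \<noteq> - of_nat (2 * n)"
  shows "sin (of_real pi * a / 2) \<noteq> 0"
proof
  assume "sin (of_real pi * a / 2) = 0"
  then obtain n :: int where "of_real pi * a / 2 = of_real (of_int n * pi)" unfolding sin_eq_0 by blast
  hence "of_real pi * a = of_real pi * of_int (2 * n)" by (simp add: field_simps)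
  hence a: "a = of_int (2 * n)" by (simp only: mult_cancel_left of_real_eq_0_iff) simp
  show False
  proof (cases "n > 0")
    case True
    define k where "k = nat n"
    have k: "k > 0" "a = of_nat (2 * k)" using True by (simp_all add: k_def a)
    have "zeta (- a) = 0" unfolding k(2) by (rule zeta_even_neg[OF k(1)])
    moreover have "a \<noteq> -1"
    proof
      assume "a = -1"
      hence "Re (of_nat (2 * k)) = Re (-1)" using k(2) by simp
      thus False by simp
    qed
    ultimately show False using assms(1) by (simp add: regular_param_def)
  next
    case False
    hence "a = - of_nat (2 * nat (- n))" by (simp add: a)
    thus False using assms(2) by blast
  qed
qed

text \<open>Both terms have a simple pole in \<^term>\<open>b\<close>. Comparing with one point \<^term>\<open>w\<close> at which their difference
  is known to converge avoids computing the residues: the powers of \<^term>\<open>z\<close> and \<^term>\<open>w\<close> differ by a factor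
  \<^term>\<open>exp (- (b - a) * (Ln z - Ln w))\<close>, whose derivative at \<^term>\<open>a\<close> produces the logarithm.\<close>
lemma singular_part_transfer:
  fixes A C :: "complex \<Rightarrow> complex" and m :: nat
  defines "Q \<equiv> \<lambda>z::complex. z ^ (2 * m) / z"
  assumes a: "a = - of_nat (2 * m)" and z: "z \<noteq> 0" and w: "w \<noteq> 0"
    and A: "((\<lambda>b. (b - a) * A b) \<longlongrightarrow> A0) (at a)"
    and lim: "((\<lambda>b. A b * Q w - C b / w powr (1 + b)) \<longlongrightarrow> l) (at a)"
  shows "((\<lambda>b. A b * Q z - C b / z powr (1 + b)) \<longlongrightarrow> A0 * Q z * (Ln z - Ln w) + Q z / Q w * l) (at a)"
proof -
  define D where "D = Ln z - Ln w"
  define E where "E = (\<lambda>b. exp (- (b - a) * D))"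
  \<comment> \<open>Since 1 + a = 1 - 2m, the power at b = a is 1 / Q v, and the deviation of b from
    a becomes an exponential factor.\<close>
  have pw: "1 / v powr (1 + b) = Q v * exp (- (b - a) * Ln v)" if "v \<noteq> 0" for v b :: complex
  proof -
    have "v powr (1 + b) = v powr 1 / v powr of_nat (2 * m) * v powr (b - a)"
      unfolding powr_diff[symmetric] powr_add[symmetric] by (simp add: a)
    also have "v powr of_nat (2 * m) = v ^ (2 * m)" using that by (metis powr_nat')
    also have "v powr (b - a) = exp ((b - a) * Ln v)" using that by (simp add: powr_def)
    finally have "v powr (1 + b) = v powr 1 / v ^ (2 * m) * exp ((b - a) * Ln v)" .
    moreover have "exp (- (b - a) * Ln v) = inverse (exp ((b - a) * Ln v))"
      by (simp only: mult_minus_left exp_minus)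
    ultimately show ?thesis using that by (simp add: Q_def divide_inverse mult_ac)
  qed
  have Qw: "Q w \<noteq> 0" using w by (simp add: Q_def)
  have ExE: "exp (- (b - a) * Ln z) = E b * exp (- (b - a) * Ln w)" for b
    by (simp add: E_def D_def algebra_simps flip: exp_add)
  have "((\<lambda>b. 1 - E b) has_field_derivative D) (at a)"
    unfolding E_def by (auto intro!: derivative_eq_intros)
  hence d: "((\<lambda>b. (1 - E b) / (b - a)) \<longlongrightarrow> D) (at a)"
    unfolding has_field_derivative_iff by (simp add: E_def)
  have e: "(E \<longlongrightarrow> 1) (at a)"
  proof -
    have "isCont E a" unfolding E_def by (intro continuous_intros)
    thus ?thesis by (simp add: isCont_def E_def)
  qed
  \<comment> \<open>The expression at z is split into \<open>A b * Q z * (1 - E b)\<close>, where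
    the simple pole meets a simple zero, and \<open>Q z / Q w * E b\<close> times the expression at
    w.\<close>
  have "((\<lambda>b. ((b - a) * A b) * Q z * ((1 - E b) / (b - a)) + Q z / Q w * E b * (A b * Q w - C b / w powr (1 + b)))
      \<longlongrightarrow> A0 * Q z * D + Q z / Q w * 1 * l) (at a)"
    by (intro tendsto_intros A d e lim)
  moreover have "\<forall>\<^sub>F b in at a. ((b - a) * A b) * Q z * ((1 - E b) / (b - a)) + Q z / Q w * E b * (A b * Q w - C b / w powr (1 + b))
      = A b * Q z - C b / z powr (1 + b)"
    using eventually_neq_at_within[of a a UNIV]
  proof eventually_elim
    case (elim b)
    have "C b / w powr (1 + b) = C b * (Q w * exp (- (b - a) * Ln w))" using pw[OF w, of b] by (metis mult.right_neutral times_divide_eq_right)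
    moreover have "C b / z powr (1 + b) = C b * (Q z * (E b * exp (- (b - a) * Ln w)))"
      using pw[OF z, of b] unfolding ExE by (metis mult.right_neutral times_divide_eq_right)
    moreover have "((b - a) * A b) * Q z * ((1 - E b) / (b - a)) = A b * Q z * (1 - E b)" using elim by simp
    moreover have "Q z / Q w * E b * (A b * Q w - C b * (Q w * x)) = Q z * E b * A b - C b * (Q z * (E b * x))" for x
      using Qw by (simp add: field_simps)
    ultimately show ?case by (simp only:) (simp add: algebra_simps)
  qed
  ultimately show ?thesis by (simp add: Lim_transform_eventually D_def)
qed

text \<open>For a = -2m exactly two terms are singular, the summand n = m and the cotangent. On the
  upper half plane their combination converges because the period function does; one such point, z =
  i, propagates convergence to the slotted plane.\<close>

lemma period_rep_limit:
  assumes reg: "regular_param a" and M: "Re a \<ge> - 2 * real M"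
  shows "\<exists>F. F holomorphic_on (- \<real>\<^sub>\<le>\<^sub>0) \<and> (\<forall>z. z \<notin> \<real>\<^sub>\<le>\<^sub>0 \<longrightarrow> ((\<lambda>b. period_rep M b z) \<longlongrightarrow> F z) (at a))
     \<and> ((\<forall>n::nat. a \<noteq> - of_nat (2 * n)) \<longrightarrow> (\<forall>z. z \<notin> \<real>\<^sub>\<le>\<^sub>0 \<longrightarrow> F z = period_rep M a z))"
proof (cases "\<forall>n::nat. a \<noteq> - of_nat (2 * n)")
  case True
  have lim: "((\<lambda>b. period_rep M b z) \<longlongrightarrow> period_rep M a z) (at a)" if z: "z \<notin> \<real>\<^sub>\<le>\<^sub>0" for z
  proof -
    have z0: "z \<noteq> 0" using z by auto
    have c: "((\<lambda>b. cot (of_real pi * b / 2)) \<longlongrightarrow> cot (of_real pi * a / 2)) (at a)"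
      unfolding cot_def using sin_half_nonzero[OF reg] True by (intro tendsto_intros) auto
    show ?thesis unfolding period_rep_eq_rep_part[OF z0] using True z0
      by (intro tendsto_diff tendsto_mult tendsto_divide tendsto_const c rep_part_tendsto[OF reg M z] powr_tendsto_param) auto
  qed
  have "(\<lambda>z. rep_part {..M} M a z - \<i> / z powr (1 + a) * cot (of_real pi * a / 2)) holomorphic_on (- \<real>\<^sub>\<le>\<^sub>0)"
    by (intro holomorphic_on_diff rep_part_holomorphic[OF M]) (auto intro!: holomorphic_intros)
  hence "(\<lambda>z. period_rep M a z) holomorphic_on (- \<real>\<^sub>\<le>\<^sub>0)"
    by (rule holomorphic_transform) (subst period_rep_eq_rep_part, auto)
  thus ?thesis using lim by blast
next
  case False
  then obtain m :: nat where a: "a = - of_nat (2 * m)" by blast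
  \<comment> \<open>The singular index must be among the summands for the cancellation to be
    possible.\<close>
  have mM: "m \<le> M"
  proof -
    have "- (2 * real m) \<ge> - 2 * real M" using M unfolding a by simp
    thus ?thesis by linarith
  qed
  have za: "zeta (- a) \<noteq> 0"
  proof -
    have "a \<noteq> -1"
    proof
      assume "a = -1"
      hence "of_nat (2 * m) = (of_nat 1 :: complex)" using a by simp
      hence "2 * m = 1" by (simp only: of_nat_eq_iff)
      thus False by presburger
    qed
    thus ?thesis using reg by (simp add: regular_param_def)
  qed
  define I where "I = {..M} - {m}"
  define Q where "Q = (\<lambda>z::complex. z ^ (2 * m) / z)"
  define k where "k = (2 * of_real pi) ^ (2 * m) / (2 * of_real pi :: complex)"
  define A where "A = (\<lambda>b. 2 * ((-1) ^ m * bern_coeff (2 * m) * zeta (1 - 2 * of_nat m - b)) * (1 / zeta (- b)) * k)"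
  define S where "S = (\<lambda>b z. A b * Q z - cot (of_real pi * b / 2) / z powr (1 + b))"
  have split: "period_rep M b z = rep_part I M b z + \<i> * S b z" if "z \<noteq> 0" for b z
  proof -
    let ?t = "\<lambda>n. (-1) ^ n * bern_coeff (2 * n) * zeta (1 - 2 * of_nat n - b) * ((2 * of_real pi * z) ^ (2 * n) / (2 * of_real pi * z))"
    have "(\<Sum>n\<le>M. ?t n) = ?t m + (\<Sum>n\<in>I. ?t n)"
      unfolding I_def using mM by (intro sum.remove) auto
    also have "(2 * of_real pi * z) ^ (2 * m) / (2 * of_real pi * z) = k * Q z"
      by (simp add: k_def Q_def power_mult_distrib)
    finally have sum: "(\<Sum>n\<le>M. ?t n) = (-1) ^ m * bern_coeff (2 * m) * zeta (1 - 2 * of_nat m - b) * (k * Q z) + (\<Sum>n\<in>I. ?t n)" .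
    have "\<i> * Z * (2 * (T * (x * q) + R) + V) - \<i> / p * c = \<i> * Z * (2 * R + V) + \<i> * (2 * T * Z * x * q - c / p)"
      for Z T x q R V p c :: complex by (simp add: algebra_simps)
    thus ?thesis
      unfolding period_rep_eq_rep_part[OF that] rep_part_def S_def A_def sum .
  qed
  have I: "a \<noteq> - of_nat (2 * n)" if "n \<in> I" for n
  proof
    assume "a = - of_nat (2 * n)"
    hence "(of_nat (2 * n) :: complex) = of_nat (2 * m)" using a by simp
    hence "2 * n = 2 * m" by (simp only: of_nat_eq_iff)
    thus False using that by (simp add: I_def)
  qed
  note R = rep_part_tendsto[OF reg M _ I]
  obtain A0 where A0: "((\<lambda>b. (b - a) * A b) \<longlongrightarrow> A0) (at a)"
  proof -
    have "filterlim (\<lambda>b. 1 - 2 * of_nat m - b) (at 1) (at a)"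
      unfolding filterlim_at by (auto simp: eventually_at_filter a intro!: tendsto_eq_intros)
    from filterlim_compose[OF zeta_pole this]
    have p: "((\<lambda>b. (1 - 2 * of_nat m - b - 1) * zeta (1 - 2 * of_nat m - b)) \<longlongrightarrow> 1) (at a)" .
    have "((\<lambda>b. - (2 * ((-1) ^ m * bern_coeff (2 * m)) * k) * ((1 - 2 * of_nat m - b - 1) * zeta (1 - 2 * of_nat m - b)) * (1 / zeta (- b)))
       \<longlongrightarrow> - (2 * ((-1) ^ m * bern_coeff (2 * m)) * k) * 1 * (1 / zeta (- a))) (at a)"
      by (intro tendsto_mult tendsto_const p tendsto_inverse_zeta_minus reg)
    also have "(\<lambda>b. - (2 * ((-1) ^ m * bern_coeff (2 * m)) * k) * ((1 - 2 * of_nat m - b - 1) * zeta (1 - 2 * of_nat m - b)) * (1 / zeta (- b)))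
        = (\<lambda>b. (b - a) * A b)"
    proof
      fix b
      have "1 - 2 * of_nat m - b - 1 = - (b - a)" by (simp add: a)
      thus "- (2 * ((-1) ^ m * bern_coeff (2 * m)) * k) * ((1 - 2 * of_nat m - b - 1) * zeta (1 - 2 * of_nat m - b)) * (1 / zeta (- b)) = (b - a) * A b"
        unfolding A_def by (simp only: mult_minus_left mult_minus_right minus_minus mult_ac)
    qed
    finally show thesis by (rule that)
  qed
  have i: "\<i> \<notin> \<real>\<^sub>\<le>\<^sub>0" by (simp add: complex_nonpos_Reals_iff)
  \<comment> \<open>The limit at i is not computed but solved for from the known limit of the whole
    representation.\<close>
  define l where "l = (period_fun a \<i> - rep_part I M a \<i>) / \<i>"
  have l: "((\<lambda>b. S b \<i>) \<longlongrightarrow> l) (at a)"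
  proof -
    have "((\<lambda>b. period_rep M b \<i>) \<longlongrightarrow> period_fun a \<i>) (at a)"
      using period_fun_tendsto[OF reg, of \<i>] period_rep_eventually_eq[OF M, of \<i>]
      by (simp add: Lim_transform_eventually)
    hence "((\<lambda>b. (period_rep M b \<i> - rep_part I M b \<i>) / \<i>) \<longlongrightarrow> l) (at a)"
      unfolding l_def by (intro tendsto_divide tendsto_diff R i tendsto_const) auto
    moreover have "(\<lambda>b. (period_rep M b \<i> - rep_part I M b \<i>) / \<i>) = (\<lambda>b. S b \<i>)"
      by (simp add: split fun_eq_iff)
    ultimately show ?thesis by simp
  qed
  \<comment> \<open>The logarithm comes from differentiating the power of z in the parameter; on the
    slotted plane it is holomorphic.\<close>
  define F where "F = (\<lambda>z. rep_part I M a z + \<i> * (A0 * Q z * (Ln z - Ln \<i>) + Q z / Q \<i> * l))"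
  have "((\<lambda>b. period_rep M b z) \<longlongrightarrow> F z) (at a)" if z: "z \<notin> \<real>\<^sub>\<le>\<^sub>0" for z
  proof -
    have z0: "z \<noteq> 0" using z by auto
    have "((\<lambda>b. S b z) \<longlongrightarrow> A0 * Q z * (Ln z - Ln \<i>) + Q z / Q \<i> * l) (at a)"
      using l unfolding S_def Q_def by (intro singular_part_transfer[OF a z0 _ A0]) auto
    thus ?thesis unfolding split[OF z0] F_def by (intro tendsto_add tendsto_mult tendsto_const R z)
  qed
  moreover have "F holomorphic_on (- \<real>\<^sub>\<le>\<^sub>0)"
    unfolding F_def Q_def by (intro holomorphic_on_add rep_part_holomorphic[OF M]) (auto intro!: holomorphic_intros)
  ultimately show ?thesis using False by blast
qed

lemma connected_slotted_plane: "connected (- \<real>\<^sub>\<le>\<^sub>0 :: complex set)"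
proof -
  have "(\<real>\<^sub>\<le>\<^sub>0 :: complex set) = complex_of_real ` {..0}"
    by (auto simp: nonpos_Reals_def)
  thus ?thesis using starlike_imp_connected[OF starlike_slotted_complex_plane_left[of 0]] by simp
qed

lemma holomorphic_eq_on_slotted_plane:
  assumes "F holomorphic_on (- \<real>\<^sub>\<le>\<^sub>0)" "G holomorphic_on (- \<real>\<^sub>\<le>\<^sub>0)" "\<And>z. Im z > 0 \<Longrightarrow> F z = G z" "z \<notin> \<real>\<^sub>\<le>\<^sub>0"
  shows "F z = G z"
proof -
  have "F z - G z = 0"
  proof (rule analytic_continuation[where f="\<lambda>z. F z - G z" and S="- \<real>\<^sub>\<le>\<^sub>0" and U="{z. Im z > 0}" and \<xi>=\<i>])
    show "\<i> islimpt {z. Im z > 0}"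
      by (rule interior_limit_point) (simp add: interior_open open_halfspace_Im_gt)
    show "{z. Im z > 0} \<subseteq> - \<real>\<^sub>\<le>\<^sub>0" "\<i> \<in> - \<real>\<^sub>\<le>\<^sub>0" by (auto simp: complex_nonpos_Reals_iff)
    show "(\<lambda>z. F z - G z) holomorphic_on - \<real>\<^sub>\<le>\<^sub>0" by (intro holomorphic_intros assms)
  qed (use assms connected_slotted_plane in \<open>auto simp: open_Compl\<close>)
  thus ?thesis by simp
qed

text \<open>For each admissible M the limit in the parameter equals the period function on the upper
  half plane. The slotted plane is connected, so all these limits are one and the same
  function.\<close>

lemma period_continuation:
  assumes reg: "regular_param a"
  shows "\<exists>F. F analytic_on (- \<real>\<^sub>\<le>\<^sub>0) \<and>
           (\<forall>z. Im z > 0 \<longrightarrow> F z = period_fun a z) \<and>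
           (\<forall>M z. Re a \<ge> - 2 * real M \<and> z \<in> - \<real>\<^sub>\<le>\<^sub>0 \<longrightarrow>
              ((\<lambda>b. period_rep M b z) \<longlongrightarrow> F z) (at a) \<and>
              ((\<forall>n::nat. a \<noteq> - of_nat (2 * n)) \<longrightarrow> F z = period_rep M a z))"
proof -
  define P where "P = (\<lambda>M F. F holomorphic_on (- \<real>\<^sub>\<le>\<^sub>0) \<and> (\<forall>z. z \<notin> \<real>\<^sub>\<le>\<^sub>0 \<longrightarrow> ((\<lambda>b. period_rep M b z) \<longlongrightarrow> F z) (at a))
     \<and> ((\<forall>n::nat. a \<noteq> - of_nat (2 * n)) \<longrightarrow> (\<forall>z. z \<notin> \<real>\<^sub>\<le>\<^sub>0 \<longrightarrow> F z = period_rep M a z)))"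
  have ex: "\<exists>F. P M F" if "Re a \<ge> - 2 * real M" for M
    using period_rep_limit[OF reg that] by (simp add: P_def)
  have upper: "F z = period_fun a z" if "P M F" "Re a \<ge> - 2 * real M" "Im z > 0" for M F z
  proof (rule tendsto_unique)
    have "z \<notin> \<real>\<^sub>\<le>\<^sub>0" using that(3) by (auto simp: complex_nonpos_Reals_iff)
    thus "((\<lambda>b. period_rep M b z) \<longlongrightarrow> F z) (at a)" using that(1) by (simp add: P_def)
    show "((\<lambda>b. period_rep M b z) \<longlongrightarrow> period_fun a z) (at a)"
      using period_fun_tendsto[OF reg that(3)] period_rep_eventually_eq[OF that(2,3)]
      by (rule Lim_transform_eventually)
  qed simp
  \<comment> \<open>The least admissible M, which serves to pick the function.\<close>
  define M0 where "M0 = nat \<lceil>- Re a / 2\<rceil>"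
  have M0: "Re a \<ge> - 2 * real M0" unfolding M0_def by linarith
  obtain F where F: "P M0 F" using ex[OF M0] by blast
  have same: "P M F" if M: "Re a \<ge> - 2 * real M" for M
  proof -
    obtain G where G: "P M G" using ex[OF M] by blast
    have eq: "G z = F z" if "z \<notin> \<real>\<^sub>\<le>\<^sub>0" for z
      by (rule holomorphic_eq_on_slotted_plane[OF _ _ _ that])
         (use F G upper[OF F M0] upper[OF G M] in \<open>auto simp: P_def\<close>)
    thus ?thesis using F G by (simp add: P_def)
  qed
  show ?thesis
  proof (intro exI[of _ F] conjI allI impI)
    show "F analytic_on - \<real>\<^sub>\<le>\<^sub>0" using F by (simp add: P_def analytic_on_open open_Compl)
    show "F z = period_fun a z" if "Im z > 0" for z by (rule upper[OF F M0 that])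
  qed (use same in \<open>auto simp: P_def\<close>)
qed

text \<open>Equality of meromorphic functions of the parameter is expressed by meromorphy together
  with equality on punctured neighbourhoods, so that default values at poles have no influence. At a
  = -1 and at the nonpositive even integers, where factors of the representation have poles, the
  continuation is described by the limit only.\<close>

theorem theorem1:
  fixes a :: complex
  shows
    "(\<forall>z. Im z > 0 \<longrightarrow>
        (\<lambda>b. period_fun b z) meromorphic_on UNIV \<and>
        (\<forall>\<^sub>F b in at a.
           period_fun b z - period_fun b (z + 1)
             = 1 / (z + 1) powr (1 + b) * period_fun b (z / (z + 1)))) \<and>
     (\<forall>M z. real M \<ge> - (1 / 2) * min 0 (Re a) \<and> z \<in> - \<real>\<^sub>\<le>\<^sub>0 \<longrightarrow>
        integrable lborel (\<lambda>t. mellin_kernel a z (Complex (- 1/2 - 2 * real M) t)) \<and>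
        (\<lambda>b. period_rep M b z) meromorphic_on {a} \<and>
        (Im z > 0 \<longrightarrow> (\<forall>\<^sub>F b in at a. period_fun b z = period_rep M b z))) \<and>
     (regular_param a \<longrightarrow>
        (\<forall>z. Im z > 0 \<longrightarrow>
           ((\<lambda>b. period_fun b z) \<longlongrightarrow> period_fun a z) (at a) \<and>
           period_fun a z - period_fun a (z + 1)
             = 1 / (z + 1) powr (1 + a) * period_fun a (z / (z + 1))) \<and>
        (\<exists>F. F analytic_on (- \<real>\<^sub>\<le>\<^sub>0) \<and>
           (\<forall>z. Im z > 0 \<longrightarrow> F z = period_fun a z) \<and>
           (\<forall>M z. real M \<ge> - (1 / 2) * min 0 (Re a) \<and> z \<in> - \<real>\<^sub>\<le>\<^sub>0 \<longrightarrow>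
              ((\<lambda>b. period_rep M b z) \<longlongrightarrow> F z) (at a) \<and>
              (a \<noteq> -1 \<and> (\<forall>n::nat. a \<noteq> - of_nat (2 * n)) \<longrightarrow> F z = period_rep M a z))))"
proof -
  \<comment> \<open>For a natural number M the stated bound amounts to this inequality.\<close>
  have M: "Re a \<ge> - 2 * real M" if "real M \<ge> - (1 / 2) * min 0 (Re a)" for M
    using that by (simp add: min_def split: if_splits)
  show ?thesis
  proof (intro conjI allI impI)
    fix z :: complex assume z: "Im z > 0"
    show "(\<lambda>b. period_fun b z) meromorphic_on UNIV" by (rule period_fun_meromorphic[OF z])
    show "\<forall>\<^sub>F b in at a. period_fun b z - period_fun b (z + 1) = 1 / (z + 1) powr (1 + b) * period_fun b (z / (z + 1))"
      by (intro always_eventually allI three_term_relation[OF z])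
  next
    fix M :: nat and z :: complex assume *: "real M \<ge> - (1 / 2) * min 0 (Re a) \<and> z \<in> - \<real>\<^sub>\<le>\<^sub>0"
    show "integrable lborel (\<lambda>t. mellin_kernel a z (Complex (- 1/2 - 2 * real M) t))"
      using * by (intro mellin_kernel_integrable M) auto
    show "(\<lambda>b. period_rep M b z) meromorphic_on {a}"
      using * by (intro period_rep_meromorphic M) auto
    show "\<forall>\<^sub>F b in at a. period_fun b z = period_rep M b z" if "Im z > 0"
      using * that by (intro period_rep_eventually_eq M) auto
  next
    fix z :: complex assume reg: "regular_param a" and z: "Im z > 0"
    show "((\<lambda>b. period_fun b z) \<longlongrightarrow> period_fun a z) (at a)" by (rule period_fun_tendsto[OF reg z])
    show "period_fun a z - period_fun a (z + 1) = 1 / (z + 1) powr (1 + a) * period_fun a (z / (z + 1))"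
      by (rule three_term_relation[OF z])
  next
    assume reg: "regular_param a"
    from period_continuation[OF reg] M show "\<exists>F. F analytic_on (- \<real>\<^sub>\<le>\<^sub>0) \<and>
           (\<forall>z. Im z > 0 \<longrightarrow> F z = period_fun a z) \<and>
           (\<forall>M z. real M \<ge> - (1 / 2) * min 0 (Re a) \<and> z \<in> - \<real>\<^sub>\<le>\<^sub>0 \<longrightarrow>
              ((\<lambda>b. period_rep M b z) \<longlongrightarrow> F z) (at a) \<and>
              (a \<noteq> -1 \<and> (\<forall>n::nat. a \<noteq> - of_nat (2 * n)) \<longrightarrow> F z = period_rep M a z))"
      by blast
  qed
qed

end
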